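(* Fix $\sigma\in\{1,-1\}$, $a>0$, $e\in\{-1,0,1\}$, a real-valued $H\in C^\infty(\mathbb R^3)$, and $\rho\in C^\infty(\mathbb R)$ with $\operatorname{supp}\rho\subseteq[-1,1]$ and $\int_{\mathbb R}\rho=1$; put $\delta_\varepsilon(x)=\varepsilon^{-1}\rho(x/\varepsilon)$ for $\varepsilon\in I=(0,1]$. Let $M=\{(U,V,Z_2,Z_3,Z_4)\in\mathbb R^5:\ -2UV+Z_2^2+Z_3^2+\sigma Z_4^2=\sigma a^2\}$. Let $\gamma^-:\mathbb R\to M$ be a geodesic of the background metric $g_0$ induced on $M$ by $dZ_2^2+dZ_3^2+\sigma dZ_4^2-2\,dU\,dV$, with $U^-(0)=0$, $\dot U^-(0)>0$ (where $U^-$ is the $U$-component of $\gamma^-$) and $g_0(\dot\gamma^-,\dot\gamma^-)=e$. For $\varepsilon$ small let $\alpha_\varepsilon<0$ be the parameter value closest to $0$ with $U^-(\alpha_\varepsilon)=-\varepsilon$. Consider, for curves $(U,V,Z_2,Z_3,Z_4)$, the system \[ \begin{aligned} \ddot U&=-\Phi_\varepsilon\,\frac{U}{N_\varepsilon},\\ \ddot V-\tfrac12 H\,\delta_\varepsilon'(U)\,\dot U^2-\delta_\varepsilon(U)\,\dot U\sum_{p=2}^4 H_{,p}\dot Z_p&=-\Phi_\varepsilon\,\frac{V+H\,\delta_\varepsilon(U)\,U}{N_\varepsilon},\\ \ddot Z_i-\tfrac12 H_{,i}\,\delta_\varepsilon(U)\,\dot U^2&=-\Phi_\varepsilon\,\frac{Z_i}{N_\varepsilon}\quad(i=2,3),\\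 \ddot Z_4-\tfrac{\sigma}{2} H_{,4}\,\delta_\varepsilon(U)\,\dot U^2&=-\Phi_\varepsilon\,\frac{Z_4}{N_\varepsilon}, \end{aligned} \] with $H,H_{,p}$ evaluated at $(Z_2,Z_3,Z_4)$, $N_\varepsilon=\sigma a^2-U^2H\delta_\varepsilon(U)$, $G_\varepsilon=\delta_\varepsilon(U)\sum_{p=2}^4H_{,p}Z_p+H\delta_\varepsilon'(U)U$, $\Phi_\varepsilon=e+\tfrac12\dot U^2G_\varepsilon-\dot U\frac{d}{dt}(H\delta_\varepsilon(U)U)$. Then the global generalized solution of this system with data $\gamma^-(\alpha_\varepsilon)$, $\dot\gamma^-(\alpha_\varepsilon)$ at $t=\alpha_\varepsilon$ is unique: if $\gamma=[(\gamma_\varepsilon)_\varepsilon]$ and $\tilde\gamma=[(\tilde\gamma_\varepsilon)_\varepsilon]$ in $\mathcal G[\mathbb R,M]$ both solve the system in the generalized sense and both satisfy $\big(\gamma_\varepsilon(\alpha_\varepsilon)-\gamma^-(\alpha_\varepsilon)\big)_\varepsilon$, $\big(\dot\gamma_\varepsilon(\alpha_\varepsilon)-\dot\gamma^-(\alpha_\varepsilon)\big)_\varepsilon$ negligible (and likewise for $\tilde\gamma_\varepsilon$), then $\gamma=\tilde\gamma$ in $\mathcal G[\mathbb R,M]$.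
   Context: Colombeau notions: a net of real numbers $(r_\varepsilon)_\varepsilon$ is negligible if $|r_\varepsilon|=O(\varepsilon^m)$ for every $m$. For an interval $J\subseteq\mathbb R$, a net $(\gamma_\varepsilon)_{\varepsilon\in I}$ of smooth curves $J\to\mathbb R^5$ depending smoothly on $\varepsilon$ is moderate if for every compact $K\subseteq J$ and every $k\ge0$ there is $N$ with $\sup_{K}|\gamma_\varepsilon^{(k)}|=O(\varepsilon^{-N})$; negligible if moderate and $\sup_K|\gamma_\varepsilon|=O(\varepsilon^m)$ for all compact $K$ and all $m$; c-bounded if for every compact $K\subseteq J$ there is a compact $L$ with $\gamma_\varepsilon(K)\subseteq L$ for small $\varepsilon$. $\mathcal G[J,\mathbb R^5]$ is the set of moderate c-bounded nets modulo negligible differences, $\mathcal G[J,M]$ the classes with representatives in $M$. A generalized curve solves the system in the generalized sense if inserting a representative yields a negligible residual net. The system is the geodesic equation (for velocity of squared norm $e$) of the generalized metric on $M$ induced by the generalized metric with representative $dZ_2^2+dZ_3^2+\sigma dZ_4^2-2\,dU\,dV+H(Z_2,Z_3,Z_4)\delta_\varepsilon(U)\,dU^2$ on $\mathbb R^5$. *)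

theory Defs
  imports "HOL-Analysis.Analysis"
begin

definition dpartial :: "'a::euclidean_space \<Rightarrow> ('a \<Rightarrow> 'b::real_normed_vector) \<Rightarrow> 'a \<Rightarrow> 'b" where
  "dpartial b f x = vector_derivative (\<lambda>s. f (x + s *\<^sub>R b)) (at 0)"

fun ipartial :: "'a::euclidean_space list \<Rightarrow> ('a \<Rightarrow> 'b::real_normed_vector) \<Rightarrow> 'a \<Rightarrow> 'b" where
  "ipartial [] f = f"
| "ipartial (b # bs) f = dpartial b (ipartial bs f)"

definition Cinf_on :: "'a::euclidean_space set \<Rightarrow> ('a \<Rightarrow> 'b::real_normed_vector) \<Rightarrow> bool" where
  "Cinf_on S f \<longleftrightarrow> open S \<and>
     (\<forall>bs. set bs \<subseteq> Basis \<longrightarrow>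
        continuous_on S (ipartial bs f) \<and>
        (\<forall>b\<in>Basis. \<forall>x\<in>S. (\<lambda>s. ipartial bs f (x + s *\<^sub>R b)) differentiable (at 0)))"

definition tder :: "nat \<Rightarrow> (real \<Rightarrow> 'b::real_normed_vector) \<Rightarrow> real \<Rightarrow> 'b" where
  "tder k g = ((\<lambda>h t. vector_derivative h (at t)) ^^ k) g"

definition negl_vec :: "(real \<Rightarrow> 'b::real_normed_vector) \<Rightarrow> bool" where
  "negl_vec r \<longleftrightarrow> (\<forall>m::nat. \<exists>C. eventually (\<lambda>\<epsilon>. norm (r \<epsilon>) \<le> C * \<epsilon> ^ m) (at_right 0))"

definition smooth_net :: "(real \<Rightarrow> real \<Rightarrow> real^5) \<Rightarrow> bool" where
  "smooth_net \<gamma> \<longleftrightarrow> (\<forall>\<epsilon>\<in>{0<..1}. Cinf_on UNIV (\<gamma> \<epsilon>)) \<and>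
      Cinf_on ({0<..<1} \<times> UNIV) (\<lambda>p. \<gamma> (fst p) (snd p))"

definition moderate_net :: "(real \<Rightarrow> real \<Rightarrow> real^5) \<Rightarrow> bool" where
  "moderate_net \<gamma> \<longleftrightarrow> smooth_net \<gamma> \<and>
     (\<forall>K k. compact K \<longrightarrow> (\<exists>N::nat. \<exists>C.
        eventually (\<lambda>\<epsilon>. \<forall>t\<in>K. norm (tder k (\<gamma> \<epsilon>) t) \<le> C * \<epsilon> powr (- real N)) (at_right 0)))"

definition negligible_net :: "(real \<Rightarrow> real \<Rightarrow> real^5) \<Rightarrow> bool" where
  "negligible_net \<gamma> \<longleftrightarrow> moderate_net \<gamma> \<and>
     (\<forall>K (m::nat). compact K \<longrightarrow> (\<exists>C.
        eventually (\<lambda>\<epsilon>. \<forall>t\<in>K. norm (\<gamma> \<epsilon> t) \<le> C * \<epsilon> ^ m) (at_right 0)))"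

definition c_bounded :: "(real \<Rightarrow> real \<Rightarrow> real^5) \<Rightarrow> bool" where
  "c_bounded \<gamma> \<longleftrightarrow> (\<forall>K. compact K \<longrightarrow>
     (\<exists>L. compact L \<and> eventually (\<lambda>\<epsilon>. \<gamma> \<epsilon> ` K \<subseteq> L) (at_right 0)))"

text \<open>Coordinates: x\$1 = U, x\$2 = V, x\$3 = Z2, x\$4 = Z3, x\$5 = Z4.\<close>

definition Mset :: "real \<Rightarrow> real \<Rightarrow> (real^5) set" where
  "Mset \<sigma> a = {x. - 2 * x$1 * x$2 + (x$3)^2 + (x$4)^2 + \<sigma> * (x$5)^2 = \<sigma> * a^2}"

definition eta :: "real \<Rightarrow> real^5 \<Rightarrow> real^5 \<Rightarrow> real" where
  "eta \<sigma> x y = x$3 * y$3 + x$4 * y$4 + \<sigma> * x$5 * y$5 - x$1 * y$2 - x$2 * y$1"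

text \<open>tangent space of M at p: kernel of the differential of
  F = -2UV + Z2^2 + Z3^2 + sigma Z4^2, i.e. dF_p(w) = 0\<close>
definition tangent_M :: "real \<Rightarrow> real^5 \<Rightarrow> (real^5) set" where
  "tangent_M \<sigma> p = {w. - 2 * (p$2 * w$1 + p$1 * w$2) + 2 * p$3 * w$3 + 2 * p$4 * w$4
                          + 2 * \<sigma> * p$5 * w$5 = 0}"

text \<open>Geodesic of the induced metric g0 on M: a smooth curve in M whose covariant
  acceleration (tangential part of the ambient acceleration) vanishes.\<close>
definition geodesic_M :: "real \<Rightarrow> real \<Rightarrow> (real \<Rightarrow> real^5) \<Rightarrow> bool" where
  "geodesic_M \<sigma> a c \<longleftrightarrow> Cinf_on UNIV c \<and> (\<forall>t. c t \<in> Mset \<sigma> a) \<and>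
     (\<forall>t. \<forall>w\<in>tangent_M \<sigma> (c t). eta \<sigma> (tder 2 c t) w = 0)"

definition gen_curve_M :: "real \<Rightarrow> real \<Rightarrow> (real \<Rightarrow> real \<Rightarrow> real^5) \<Rightarrow> bool" where
  "gen_curve_M \<sigma> a \<gamma> \<longleftrightarrow> moderate_net \<gamma> \<and> c_bounded \<gamma> \<and>
     (\<forall>\<epsilon>\<in>{0<..1}. \<forall>t. \<gamma> \<epsilon> t \<in> Mset \<sigma> a)"

definition delta :: "(real \<Rightarrow> real) \<Rightarrow> real \<Rightarrow> real \<Rightarrow> real" where
  "delta \<rho> \<epsilon> x = \<rho> (x / \<epsilon>) / \<epsilon>"

definition Zvec :: "real^5 \<Rightarrow> real^3" where
  "Zvec x = vector [x$3, x$4, x$5]"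

text \<open>H_{,p} for p = 2,3,4 is the partial derivative w.r.t. the (p-1)-th argument\<close>
definition Hp :: "(real^3 \<Rightarrow> real) \<Rightarrow> 3 \<Rightarrow> real^3 \<Rightarrow> real" where
  "Hp H j z = dpartial (axis j 1) H z"

definition residual ::
  "real \<Rightarrow> real \<Rightarrow> real \<Rightarrow> (real^3 \<Rightarrow> real) \<Rightarrow> (real \<Rightarrow> real) \<Rightarrow> real \<Rightarrow> (real \<Rightarrow> real^5) \<Rightarrow> real \<Rightarrow> real^5"
  where
  "residual \<sigma> a e H \<rho> \<epsilon> c t =
    (let x = c t; xd = tder 1 c t; xdd = tder 2 c t;
         U = x$1; V = x$2; Z2 = x$3; Z3 = x$4; Z4 = x$5;
         Ud = xd$1; Z2d = xd$3; Z3d = xd$4; Z4d = xd$5;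
         z = Zvec x; h = H z; h2 = Hp H 1 z; h3 = Hp H 2 z; h4 = Hp H 3 z;
         d = delta \<rho> \<epsilon> U; d' = deriv (delta \<rho> \<epsilon>) U;
         N = \<sigma> * a^2 - U^2 * h * d;
         G = d * (h2 * Z2 + h3 * Z3 + h4 * Z4) + h * d' * U;
         \<Phi> = e + 1/2 * Ud^2 * G
               - Ud * vector_derivative (\<lambda>s. H (Zvec (c s)) * delta \<rho> \<epsilon> (c s $ 1) * c s $ 1) (at t)
     in vector [ xdd$1 + \<Phi> * U / N,
                 xdd$2 - 1/2 * h * d' * Ud^2 - d * Ud * (h2 * Z2d + h3 * Z3d + h4 * Z4d)
                   + \<Phi> * (V + h * d * U) / N,
                 xdd$3 - 1/2 * h2 * d * Ud^2 + \<Phi> * Z2 / N,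
                 xdd$4 - 1/2 * h3 * d * Ud^2 + \<Phi> * Z3 / N,
                 xdd$5 - \<sigma>/2 * h4 * d * Ud^2 + \<Phi> * Z4 / N ])"

definition solves_gen :: "real \<Rightarrow> real \<Rightarrow> real \<Rightarrow> (real^3 \<Rightarrow> real) \<Rightarrow> (real \<Rightarrow> real) \<Rightarrow> (real \<Rightarrow> real \<Rightarrow> real^5) \<Rightarrow> bool" where
  "solves_gen \<sigma> a e H \<rho> \<gamma> \<longleftrightarrow> negligible_net (\<lambda>\<epsilon> t. residual \<sigma> a e H \<rho> \<epsilon> (\<gamma> \<epsilon>) t)"

definition alpha :: "(real \<Rightarrow> real^5) \<Rightarrow> real \<Rightarrow> real" where
  "alpha c \<epsilon> = (GREATEST t. t < 0 \<and> c t $ 1 = - \<epsilon>)"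

end

theory Submission
  imports Defs
begin

text \<open>
  With \<open>\<kappa> = e / (\<sigma> a\<^sup>2)\<close>, both the background geodesic and every solution outside the strip
  \<open>\<bar>U\<bar> \<le> \<epsilon>\<close> satisfy \<open>x'' = - \<kappa> x\<close> (up to a negligible error). In the variables
  \<open>X = (U, \<epsilon>\<^sup>2 V, \<epsilon> Z)\<close> the equation inside the strip is \<open>X'' = - \<kappa> X + B(\<epsilon>, X/\<epsilon>, X')\<close> with
  \<open>B\<close> bounded and Lipschitz uniformly in \<open>\<epsilon>\<close>. Hence the energy \<open>y = |X|\<^sup>2 + |X'|\<^sup>2 + n\<^sup>2\<close> of the
  difference of two curves obeys \<open>|y'| \<le> C (1 + l) y\<close> with the weight \<open>l = \<epsilon> / (\<epsilon>\<^sup>2 + U\<^sup>2)\<close>, whose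
  integral is bounded as long as \<open>U\<close> is \<open>C\<^sup>1\<close>-close to the background component, which crosses 0 only
  with nonzero speed. A first application with \<open>n = \<epsilon>\<close>, comparing with the background geodesic,
  establishes this closeness by a continuation argument; a second one with \<open>n = \<epsilon>\<^sup>k\<close>, comparing the
  two solutions, shows that their difference is \<open>O(\<epsilon>\<^sup>k\<^sup>-\<^sup>2)\<close> for every \<open>k\<close>.
\<close>

section \<open>Smooth functions\<close>

text \<open>A plain Gronwall argument fails: as a function of X the force has a Lipschitz constant
  of order 1/\<epsilon>, so a fixed time interval would cost a factor exp(C/\<epsilon>), which no
  power of \<epsilon> compensates. What saves the estimate is that a curve crossing U = 0 with speed
  bounded below spends only a time of order \<epsilon> in the strip. That speed bound is no part of
  being a solution, since moderateness admits derivatives as large as a negative power of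
  \<epsilon>; it must be inherited from the background. In the comparison with the background only
  one of the two curves feels the force, so a Lipschitz bound is of no help there, and boundedness
  of the force has to suffice. For \<kappa> > 0 the background oscillates and U vanishes many times
  on a long interval. The estimates are therefore proved locally in time and glued, and they run in
  both time directions because the data are prescribed at an inner time.\<close>

lemma ipartial_append: "ipartial (bs @ cs) f = ipartial bs (ipartial cs f)"
  by (induction bs) auto

lemma Cinf_on_dpartial:
  assumes "Cinf_on S f" "b \<in> Basis"
  shows "Cinf_on S (dpartial b f)"
proof -
  have "ipartial bs (dpartial b f) = ipartial (bs @ [b]) f" for bs
    by (simp add: ipartial_append)
  with assms show ?thesis
    unfolding Cinf_on_def by auto
qed

lemma Cinf_on_continuous: "Cinf_on S f \<Longrightarrow> continuous_on S f"
  unfolding Cinf_on_def by (metis ipartial.simps(1) empty_set empty_subsetI)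

lemma Cinf_on_has_dpartial:
  assumes "Cinf_on S f" "b \<in> Basis" "x \<in> S"
  shows "((\<lambda>s. f (x + s *\<^sub>R b)) has_vector_derivative dpartial b f x) (at 0)"
proof -
  have "(\<lambda>s. f (x + s *\<^sub>R b)) differentiable (at 0)"
    using assms unfolding Cinf_on_def by (metis ipartial.simps(1) empty_set empty_subsetI)
  then show ?thesis
    unfolding dpartial_def by (simp add: vector_derivative_works)
qed

lemma has_vector_derivative_shift:
  fixes f :: "real \<Rightarrow> 'b::real_normed_vector"
  shows "((\<lambda>s. f (x + s)) has_vector_derivative D) (at 0) \<longleftrightarrow> (f has_vector_derivative D) (at x)"
proof
  have d1: "((\<lambda>s. x + s) has_vector_derivative 1) (at 0)"
    and d2: "((\<lambda>t. t - x) has_vector_derivative 1) (at x)"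
    by (auto intro!: derivative_eq_intros)
  show "((\<lambda>s. f (x + s)) has_vector_derivative D) (at 0)" if "(f has_vector_derivative D) (at x)"
  proof -
    have "(f has_vector_derivative D) (at (x + 0))" using that by simp
    from vector_diff_chain_at[OF d1 this] show ?thesis by (simp only: o_def scaleR_one)
  qed
  show "(f has_vector_derivative D) (at x)" if A: "((\<lambda>s. f (x + s)) has_vector_derivative D) (at 0)"
  proof -
    have "((\<lambda>s. f (x + s)) has_vector_derivative D) (at (x - x))" unfolding diff_self by (rule A)
    from vector_diff_chain_at[OF d2 this] show ?thesis
      by (simp only: o_def scaleR_one add_diff_eq add_diff_cancel_left')
  qed
qed

lemma has_vector_derivative_line:
  fixes f :: "'a::real_normed_vector \<Rightarrow> 'b::real_normed_vector"
  assumes "((\<lambda>s. f (x + t *\<^sub>R b + s *\<^sub>R b)) has_vector_derivative D) (at 0)"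
  shows "((\<lambda>s. f (x + s *\<^sub>R b)) has_vector_derivative D) (at t)"
proof -
  have "(\<lambda>s. f (x + t *\<^sub>R b + s *\<^sub>R b)) = (\<lambda>s. f (x + (t + s) *\<^sub>R b))"
    by (simp add: scaleR_add_left add.assoc)
  then show ?thesis
    using assms has_vector_derivative_shift[of "\<lambda>s. f (x + s *\<^sub>R b)" t D] by simp
qed

lemma Cinf_on_real_has_vector_derivative:
  assumes "Cinf_on S (f :: real \<Rightarrow> 'b::real_normed_vector)" "x \<in> S"
  shows "(f has_vector_derivative dpartial 1 f x) (at x)"
  using Cinf_on_has_dpartial[OF assms(1) _ assms(2), of 1] has_vector_derivative_shift[of f x]
  by simp

lemma tder_0 [simp]: "tder 0 f = f"
  and tder_Suc: "tder (Suc k) f t = vector_derivative (tder k f) (at t)"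
  by (simp_all add: tder_def)

lemma tder_1: "tder 1 f t = vector_derivative f (at t)"
  by (simp add: tder_def)

lemma Cinf_tder:
  assumes "Cinf_on UNIV (f :: real \<Rightarrow> 'b::real_normed_vector)"
  shows "Cinf_on UNIV (tder k f)"
proof (induction k)
  case 0
  show ?case using assms by simp
next
  case (Suc k)
  have "tder (Suc k) f = dpartial 1 (tder k f)"
  proof
    fix t
    show "tder (Suc k) f t = dpartial 1 (tder k f) t"
      unfolding tder_Suc by (rule vector_derivative_at[OF Cinf_on_real_has_vector_derivative[OF Suc UNIV_I]])
  qed
  with Cinf_on_dpartial[OF Suc, of 1] show ?case by simp
qed

lemma has_vector_derivative_tder:
  assumes "Cinf_on UNIV (f :: real \<Rightarrow> 'b::real_normed_vector)"
  shows "(tder k f has_vector_derivative tder (Suc k) f t) (at t)"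
proof -
  note d = Cinf_on_real_has_vector_derivative[OF Cinf_tder[OF assms, of k] UNIV_I, of t]
  show ?thesis
    unfolding tder_Suc vector_derivative_at[OF d] by (rule d)
qed

text \<open>\<open>Cinf_on\<close> speaks of partial derivatives only, while the chain rule and the
  mean value inequality need the total derivative. The increment is split along the coordinate axes,
  and on each piece the mean value inequality compares with the partial derivative at
  \<open>x\<close>.\<close>

lemma has_derivative_from_partials:
  fixes f :: "'a::euclidean_space \<Rightarrow> 'b::real_normed_vector"
  assumes part: "\<And>b x. b \<in> Basis \<Longrightarrow> ((\<lambda>s. f (x + s *\<^sub>R b)) has_vector_derivative g b x) (at 0)"
    and cont: "\<And>b. b \<in> Basis \<Longrightarrow> continuous_on UNIV (g b)"
  shows "(f has_derivative (\<lambda>h. \<Sum>b\<in>Basis. (h \<bullet> b) *\<^sub>R g b x)) (at x)"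
  unfolding has_derivative_within_alt
proof (intro conjI allI impI)
  show "bounded_linear (\<lambda>h. \<Sum>b\<in>Basis. (h \<bullet> b) *\<^sub>R g b x)"
    by (intro bounded_linear_sum bounded_linear_scaleR_const bounded_linear_inner_left)
  fix e :: real assume "e > 0"
  define e' where "e' = e / (2 * real DIM('a))"
  have "e' > 0" using \<open>e > 0\<close> by (simp add: e'_def)
  have "\<forall>b\<in>Basis. \<exists>d>0. \<forall>y. dist y x < d \<longrightarrow> norm (g b y - g b x) < e'"
  proof
    fix b :: 'a assume "b \<in> Basis"
    from cont[OF this] have "isCont (g b) x" by (simp add: continuous_on_eq_continuous_at)
    then show "\<exists>d>0. \<forall>y. dist y x < d \<longrightarrow> norm (g b y - g b x) < e'"
      unfolding continuous_at_eps_delta dist_norm using \<open>e' > 0\<close> by blast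
  qed
  from bchoice[OF this] obtain d
    where d: "\<And>b. b \<in> Basis \<Longrightarrow> d b > 0 \<and> (\<forall>y. dist y x < d b \<longrightarrow> norm (g b y - g b x) < e')"
    by blast
  define d0 where "d0 = Min (d ` Basis)"
  have d0: "d0 > 0" "\<And>b y. b \<in> Basis \<Longrightarrow> dist y x < d0 \<Longrightarrow> norm (g b y - g b x) < e'"
    using d by (auto simp: d0_def)
  define n where "n = real DIM('a)"
  have n: "n \<ge> 1" unfolding n_def using DIM_positive[where 'a='a] by linarith
  show "\<exists>d>0. \<forall>y\<in>UNIV. norm (y - x) < d \<longrightarrow>
     norm (f y - f x - (\<Sum>b\<in>Basis. ((y - x) \<bullet> b) *\<^sub>R g b x)) \<le> e * norm (y - x)"
  proof (intro exI conjI ballI impI)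
    \<comment> \<open>Every intermediate point differs from \<open>x\<close> by at most n + 1 times
      the length of the increment, so this radius keeps all of them where the partials vary by less
      than \<open>e'\<close>.\<close>
    show "d0 / (n + 1) > 0" using d0 n by simp
    fix y assume y: "norm (y - x) < d0 / (n + 1)"
    define h where "h = y - x"
    have le: "norm (\<Sum>b\<in>B. (h \<bullet> b) *\<^sub>R b) \<le> n * norm h" if "B \<subseteq> Basis" for B :: "'a set"
    proof -
      have "norm (\<Sum>b\<in>B. (h \<bullet> b) *\<^sub>R b) \<le> (\<Sum>b\<in>B. norm h)"
        using that by (intro sum_norm_le) (auto simp: Basis_le_norm)
      also have "\<dots> \<le> n * norm h"
        using that card_mono[of "Basis :: 'a set" B] by (auto simp: n_def intro!: mult_right_mono)
      finally show ?thesis .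
    qed
    have "norm (f (x + (\<Sum>b\<in>B. (h \<bullet> b) *\<^sub>R b)) - f x - (\<Sum>b\<in>B. (h \<bullet> b) *\<^sub>R g b x))
       \<le> real (card B) * (2 * e' * norm h)" if "finite B" "B \<subseteq> Basis" for B :: "'a set"
      using that
    proof (induction B)
      case (insert b B)
      define z where "z = x + (\<Sum>b\<in>B. (h \<bullet> b) *\<^sub>R b)"
      \<comment> \<open>With the linear term already subtracted, the mean value inequality bounds
        the error itself: its derivative is the oscillation of the partial derivative.\<close>
      define \<phi> where "\<phi> s = f (z + s *\<^sub>R b) - s *\<^sub>R g b x" for s
      have bB: "b \<in> Basis" using insert by auto
      have der: "(\<phi> has_vector_derivative g b (z + s *\<^sub>R b) - g b x) (at s)" for s
      proof -
        have "((\<lambda>s. f (z + s *\<^sub>R b)) has_vector_derivative g b (z + s *\<^sub>R b)) (at s)"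
          by (rule has_vector_derivative_line[OF part[OF bB]])
        moreover have "((\<lambda>s. s *\<^sub>R g b x) has_vector_derivative g b x) (at s)"
          by (auto intro!: derivative_eq_intros)
        ultimately show ?thesis
          unfolding \<phi>_def by (rule has_vector_derivative_diff)
      qed
      have "norm (\<phi> (h \<bullet> b) - \<phi> 0) \<le> e' * norm (h \<bullet> b - 0)"
      proof (rule differentiable_bound[where S="closed_segment 0 (h \<bullet> b)"
            and f'="\<lambda>s r. r *\<^sub>R (g b (z + s *\<^sub>R b) - g b x)"])
        fix s assume s: "s \<in> closed_segment 0 (h \<bullet> b)"
        show "(\<phi> has_derivative (\<lambda>r. r *\<^sub>R (g b (z + s *\<^sub>R b) - g b x))) (at s within closed_segment 0 (h \<bullet> b))"
          using has_vector_derivative_at_within[OF der] unfolding has_vector_derivative_def .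
        have "\<bar>s\<bar> \<le> \<bar>h \<bullet> b\<bar>" using s by (auto simp: closed_segment_eq_real_ivl split: if_splits)
        also have "\<dots> \<le> norm h" using bB by (simp add: Basis_le_norm)
        finally have "norm (s *\<^sub>R b) \<le> norm h" using bB by simp
        then have "norm (z + s *\<^sub>R b - x) \<le> n * norm h + norm h"
          unfolding z_def using insert.prems le[of B]
            norm_triangle_ineq[of "\<Sum>b\<in>B. (h \<bullet> b) *\<^sub>R b" "s *\<^sub>R b"]
          by simp
        also have "\<dots> = (n + 1) * norm h" by (simp add: algebra_simps)
        also have "\<dots> < d0" using y n unfolding h_def by (simp add: field_simps)
        finally show "onorm (\<lambda>r. r *\<^sub>R (g b (z + s *\<^sub>R b) - g b x)) \<le> e'"
          using d0(2)[OF bB, of "z + s *\<^sub>R b"]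
          by (intro onorm_le) (simp add: dist_norm less_imp_le mult_left_mono mult.commute[of e'])
      qed auto
      also have "\<dots> \<le> e' * norm h"
        using bB \<open>e' > 0\<close> by (auto intro!: mult_left_mono simp: Basis_le_norm)
      finally have 1: "norm (f (z + (h \<bullet> b) *\<^sub>R b) - (h \<bullet> b) *\<^sub>R g b x - f z) \<le> e' * norm h"
        by (simp add: \<phi>_def)
      have eq: "f (x + (\<Sum>b\<in>insert b B. (h \<bullet> b) *\<^sub>R b)) - f x - (\<Sum>b\<in>insert b B. (h \<bullet> b) *\<^sub>R g b x)
        = (f (z + (h \<bullet> b) *\<^sub>R b) - (h \<bullet> b) *\<^sub>R g b x - f z) +
          (f z - f x - (\<Sum>b\<in>B. (h \<bullet> b) *\<^sub>R g b x))"
        unfolding sum.insert[OF insert.hyps] by (simp add: z_def add_ac)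
      have 2: "norm (f z - f x - (\<Sum>b\<in>B. (h \<bullet> b) *\<^sub>R g b x)) \<le> real (card B) * (2 * e' * norm h)"
        unfolding z_def using insert.prems by (intro insert.IH) simp
      have "norm (f (x + (\<Sum>b\<in>insert b B. (h \<bullet> b) *\<^sub>R b)) - f x - (\<Sum>b\<in>insert b B. (h \<bullet> b) *\<^sub>R g b x))
         \<le> e' * norm h + real (card B) * (2 * e' * norm h)"
        unfolding eq by (rule norm_triangle_le) (use 1 2 in linarith)
      also have "\<dots> \<le> real (card (insert b B)) * (2 * e' * norm h)"
        using insert.hyps \<open>e' > 0\<close> by (simp add: algebra_simps)
      finally show ?case .
    qed auto
    from this[of Basis] show "norm (f y - f x - (\<Sum>b\<in>Basis. ((y - x) \<bullet> b) *\<^sub>R g b x)) \<le> e * norm (y - x)"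
      by (simp add: euclidean_representation h_def e'_def)
  qed
qed

lemma Cinf_has_derivative:
  assumes "Cinf_on UNIV (f :: 'a::euclidean_space \<Rightarrow> 'b::real_normed_vector)"
  shows "(f has_derivative (\<lambda>h. \<Sum>b\<in>Basis. (h \<bullet> b) *\<^sub>R dpartial b f x)) (at x)"
  by (rule has_derivative_from_partials)
    (auto intro: Cinf_on_has_dpartial[OF assms] Cinf_on_continuous Cinf_on_dpartial[OF assms])

text \<open>Compactness of the ball bounds the partials; convexity makes the mean value inequality
  applicable.\<close>

lemma Cinf_lipschitz_on_cball:
  assumes "Cinf_on UNIV (f :: 'a::euclidean_space \<Rightarrow> 'b::real_normed_vector)"
  shows "\<exists>L. L-lipschitz_on (cball 0 R) f"
proof -
  have "\<exists>C. \<forall>x\<in>cball 0 R. norm (dpartial b f x) \<le> C" if "b \<in> Basis" for b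
  proof -
    have "continuous_on (cball 0 R) (dpartial b f)"
      by (meson Cinf_on_dpartial[OF assms that] Cinf_on_continuous continuous_on_subset subset_UNIV)
    then have "bounded (dpartial b f ` cball 0 R)"
      by (intro compact_imp_bounded compact_continuous_image) auto
    then show ?thesis by (auto simp: bounded_iff)
  qed
  then obtain C where C: "\<And>b x. b \<in> Basis \<Longrightarrow> x \<in> cball 0 R \<Longrightarrow> norm (dpartial b f x) \<le> C b"
    by metis
  define L where "L = (\<Sum>b\<in>Basis. \<bar>C b\<bar>)"
  have "norm (f x - f y) \<le> L * norm (x - y)" if "x \<in> cball 0 R" "y \<in> cball 0 R" for x y
  proof (rule differentiable_bound[of "cball 0 R"])
    show "(f has_derivative (\<lambda>h. \<Sum>b\<in>Basis. (h \<bullet> b) *\<^sub>R dpartial b f z)) (at z within cball 0 R)" for z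
      using Cinf_has_derivative[OF assms] has_derivative_at_withinI by blast
    show "onorm (\<lambda>h. \<Sum>b\<in>Basis. (h \<bullet> b) *\<^sub>R dpartial b f z) \<le> L" if z: "z \<in> cball 0 R" for z
    proof (rule onorm_le)
      fix h
      have "norm (\<Sum>b\<in>Basis. (h \<bullet> b) *\<^sub>R dpartial b f z) \<le> (\<Sum>b\<in>Basis. norm h * \<bar>C b\<bar>)"
      proof (rule sum_norm_le)
        fix b :: 'a assume b: "b \<in> Basis"
        show "norm ((h \<bullet> b) *\<^sub>R dpartial b f z) \<le> norm h * \<bar>C b\<bar>"
          using C[OF b z] b by (auto intro!: mult_mono simp: Basis_le_norm)
      qed
      then show "norm (\<Sum>b\<in>Basis. (h \<bullet> b) *\<^sub>R dpartial b f z) \<le> L * norm h"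
        by (simp add: L_def sum_distrib_left mult.commute)
    qed
  qed (use that in auto)
  then have "L-lipschitz_on (cball 0 R) f"
    by (intro lipschitz_onI) (auto simp: dist_norm L_def sum_nonneg)
  then show ?thesis ..
qed

section \<open>Differences of smooth and of moderate nets\<close>

lemma ipartial_diff:
  assumes f: "Cinf_on S f" and g: "Cinf_on S g" and bs: "set bs \<subseteq> Basis" and x: "x \<in> S"
  shows "ipartial bs (\<lambda>x. f x - g x) x = ipartial bs f x - ipartial bs g x"
    and "b \<in> Basis \<Longrightarrow> (\<lambda>s. ipartial bs (\<lambda>x. f x - g x) (x + s *\<^sub>R b)) differentiable (at 0)"
proof -
  let ?d = "\<lambda>x. f x - g x"
  \<comment> \<open>The induction hypothesis holds only on \<open>S\<close>, so the derivative along
    \<open>b\<close> is transferred through the open set of parameters that stay in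
    \<open>S\<close>. Differentiability of both parts is essential, because
    \<open>vector_derivative\<close> has an arbitrary value otherwise.\<close>
  have key: "((\<lambda>s. ipartial bs ?d (x + s *\<^sub>R b)) has_vector_derivative
      ipartial (b # bs) f x - ipartial (b # bs) g x) (at 0)"
    if IH: "\<And>y. y \<in> S \<Longrightarrow> ipartial bs ?d y = ipartial bs f y - ipartial bs g y"
      and bs: "set bs \<subseteq> Basis" and b: "b \<in> Basis" and x: "x \<in> S" for bs b x
  proof -
    have d: "((\<lambda>s. ipartial bs h (x + s *\<^sub>R b)) has_vector_derivative ipartial (b # bs) h x) (at 0)"
      if "Cinf_on S h" for h :: "'a \<Rightarrow> 'b"
      using that bs b x unfolding Cinf_on_def by (simp add: dpartial_def vector_derivative_works)
    have "((\<lambda>s. ipartial bs f (x + s *\<^sub>R b) - ipartial bs g (x + s *\<^sub>R b)) has_vector_derivative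
      ipartial (b # bs) f x - ipartial (b # bs) g x) (at 0)"
      by (intro has_vector_derivative_diff d f g)
    moreover have "open ((\<lambda>s. x + s *\<^sub>R b) -` S)"
      using f unfolding Cinf_on_def by (intro continuous_open_vimage continuous_intros) auto
    ultimately show ?thesis
      by (rule has_vector_derivative_transform_within_open) (use x in \<open>auto simp: IH\<close>)
  qed
  have eq: "ipartial bs ?d x = ipartial bs f x - ipartial bs g x"
    if "set bs \<subseteq> Basis" "x \<in> S" for bs x
    using that
  proof (induction bs arbitrary: x)
    case (Cons b bs)
    then show ?case
      using key[of bs b x] by (simp add: dpartial_def vector_derivative_at)
  qed auto
  show "ipartial bs ?d x = ipartial bs f x - ipartial bs g x" by (rule eq[OF bs x])
  show "(\<lambda>s. ipartial bs ?d (x + s *\<^sub>R b)) differentiable (at 0)" if "b \<in> Basis"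
    using key[OF eq bs that x] bs differentiableI_vector by blast
qed

lemma Cinf_on_diff:
  assumes "Cinf_on S f" "Cinf_on S g"
  shows "Cinf_on S (\<lambda>x. f x - g x)"
proof -
  have "continuous_on S (ipartial bs (\<lambda>x. f x - g x))" if "set bs \<subseteq> Basis" for bs
  proof -
    have "continuous_on S (\<lambda>x. ipartial bs f x - ipartial bs g x)"
      using assms that unfolding Cinf_on_def by (intro continuous_on_diff) auto
    then show ?thesis
      using ipartial_diff(1)[OF assms that] by (metis (no_types, lifting) continuous_on_cong)
  qed
  then show ?thesis
    using ipartial_diff(2)[OF assms] assms(1) unfolding Cinf_on_def by blast
qed

lemma tder_diff:
  fixes f g :: "real \<Rightarrow> 'b::real_normed_vector"
  assumes "Cinf_on UNIV f" "Cinf_on UNIV g"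
  shows "tder k (\<lambda>t. f t - g t) = (\<lambda>t. tder k f t - tder k g t)"
proof (induction k)
  case (Suc k)
  show ?case
    unfolding tder_Suc[of k "\<lambda>t. f t - g t", abs_def] Suc fun_eq_iff
    by (intro allI vector_derivative_at has_vector_derivative_diff has_vector_derivative_tder assms)
qed auto

text \<open>The common exponent is N + N', since for \<epsilon> < 1 a larger exponent gives a larger
  bound. Absolute values guard against negative constants.\<close>

lemma moderate_net_diff:
  assumes "moderate_net \<gamma>" "moderate_net \<gamma>'"
  shows "moderate_net (\<lambda>\<epsilon> t. \<gamma> \<epsilon> t - \<gamma>' \<epsilon> t)"
  unfolding moderate_net_def
proof (intro conjI allI impI)
  show "smooth_net (\<lambda>\<epsilon> t. \<gamma> \<epsilon> t - \<gamma>' \<epsilon> t)"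
    using assms unfolding moderate_net_def smooth_net_def by (simp add: Cinf_on_diff)
  fix K :: "real set" and k assume K: "compact K"
  from assms K obtain N C N' C' where
    1: "eventually (\<lambda>\<epsilon>. \<forall>t\<in>K. norm (tder k (\<gamma> \<epsilon>) t) \<le> C * \<epsilon> powr (- real N)) (at_right 0)" and
    2: "eventually (\<lambda>\<epsilon>. \<forall>t\<in>K. norm (tder k (\<gamma>' \<epsilon>) t) \<le> C' * \<epsilon> powr (- real N')) (at_right 0)"
    unfolding moderate_net_def by meson
  show "\<exists>N C. \<forall>\<^sub>F \<epsilon> in at_right 0. \<forall>t\<in>K. norm (tder k (\<lambda>t. \<gamma> \<epsilon> t - \<gamma>' \<epsilon> t) t) \<le> C * \<epsilon> powr (- real N)"
  proof (intro exI)
    show "\<forall>\<^sub>F \<epsilon> in at_right 0. \<forall>t\<in>K. norm (tder k (\<lambda>t. \<gamma> \<epsilon> t - \<gamma>' \<epsilon> t) t)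
        \<le> (\<bar>C\<bar> + \<bar>C'\<bar>) * \<epsilon> powr (- real (N + N'))"
      using 1 2 eventually_at_right_less[of "0::real"] eventually_at_right_real[OF zero_less_one]
    proof eventually_elim
      case (elim \<epsilon>)
      have sm: "Cinf_on UNIV (\<gamma> \<epsilon>)" "Cinf_on UNIV (\<gamma>' \<epsilon>)"
        using assms elim(3,4) by (simp_all add: moderate_net_def smooth_net_def)
      show ?case
      proof
        fix t assume t: "t \<in> K"
        have "norm (tder k (\<lambda>t. \<gamma> \<epsilon> t - \<gamma>' \<epsilon> t) t) \<le> norm (tder k (\<gamma> \<epsilon>) t) + norm (tder k (\<gamma>' \<epsilon>) t)"
          by (simp add: tder_diff[OF sm] norm_triangle_ineq4)
        also have "\<dots> \<le> \<bar>C\<bar> * \<epsilon> powr (- real N) + \<bar>C'\<bar> * \<epsilon> powr (- real N')"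
        proof (rule add_mono)
          have "norm (tder k (\<gamma> \<epsilon>) t) \<le> C * \<epsilon> powr (- real N)" using elim(1) t by (rule bspec)
          also have "\<dots> \<le> \<bar>C\<bar> * \<epsilon> powr (- real N)" by (intro mult_right_mono) auto
          finally show "norm (tder k (\<gamma> \<epsilon>) t) \<le> \<bar>C\<bar> * \<epsilon> powr (- real N)" .
          have "norm (tder k (\<gamma>' \<epsilon>) t) \<le> C' * \<epsilon> powr (- real N')" using elim(2) t by (rule bspec)
          also have "\<dots> \<le> \<bar>C'\<bar> * \<epsilon> powr (- real N')" by (intro mult_right_mono) auto
          finally show "norm (tder k (\<gamma>' \<epsilon>) t) \<le> \<bar>C'\<bar> * \<epsilon> powr (- real N')" .
        qed
        also have "\<dots> \<le> \<bar>C\<bar> * \<epsilon> powr (- real (N + N')) + \<bar>C'\<bar> * \<epsilon> powr (- real (N + N'))"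
          using elim(3,4) by (intro add_mono mult_left_mono powr_mono') auto
        finally show "norm (tder k (\<lambda>t. \<gamma> \<epsilon> t - \<gamma>' \<epsilon> t) t) \<le> (\<bar>C\<bar> + \<bar>C'\<bar>) * \<epsilon> powr (- real (N + N'))"
          by (simp add: algebra_simps)
      qed
    qed
  qed
qed

section \<open>Gronwall estimates with delta-like weights\<close>

text \<open>\<open>y * exp (- A)\<close> is nonincreasing and \<open>y * exp A\<close>
  nondecreasing. Only the increment of the potential \<open>A\<close> enters the result, so
  \<open>A'\<close> may be as large as 1/\<epsilon> as long as \<open>A\<close> itself varies by a
  bounded amount.\<close>

lemma gronwall_potential:
  fixes y A :: "real \<Rightarrow> real"
  assumes "s \<le> t"
    and y: "\<And>r. r \<in> {s..t} \<Longrightarrow> (y has_real_derivative y' r) (at r)"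
    and A: "\<And>r. r \<in> {s..t} \<Longrightarrow> (A has_real_derivative A' r) (at r)"
    and le: "\<And>r. r \<in> {s..t} \<Longrightarrow> \<bar>y' r\<bar> \<le> A' r * y r"
  shows "y t \<le> exp (A t - A s) * y s" "y s \<le> exp (A t - A s) * y t"
proof -
  have d1: "((\<lambda>r. y r * exp (- A r)) has_real_derivative (y' r - A' r * y r) * exp (- A r)) (at r)"
    if "r \<in> {s..t}" for r
    using y[OF that] A[OF that] by (auto intro!: derivative_eq_intros simp: algebra_simps)
  have d2: "((\<lambda>r. y r * exp (A r)) has_real_derivative (y' r + A' r * y r) * exp (A r)) (at r)"
    if "r \<in> {s..t}" for r
    using y[OF that] A[OF that] by (auto intro!: derivative_eq_intros simp: algebra_simps)
  have "y t * exp (- A t) \<le> y s * exp (- A s)"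
  proof (rule DERIV_nonpos_imp_nonincreasing[OF \<open>s \<le> t\<close>])
    fix r assume "s \<le> r" "r \<le> t"
    then have r: "r \<in> {s..t}" by simp
    have "(y' r - A' r * y r) * exp (- A r) \<le> 0"
      using le[OF r] by (intro mult_nonpos_nonneg) auto
    with d1[OF r] show "\<exists>z. ((\<lambda>r. y r * exp (- A r)) has_real_derivative z) (at r) \<and> z \<le> 0" by blast
  qed
  then show "y t \<le> exp (A t - A s) * y s"
    by (simp add: exp_diff exp_minus field_simps)
  have "y s * exp (A s) \<le> y t * exp (A t)"
  proof (rule DERIV_nonneg_imp_nondecreasing[OF \<open>s \<le> t\<close>])
    fix r assume "s \<le> r" "r \<le> t"
    then have r: "r \<in> {s..t}" by simp
    have "0 \<le> (y' r + A' r * y r) * exp (A r)"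
      using le[OF r] by (intro mult_nonneg_nonneg) auto
    with d2[OF r] show "\<exists>z. ((\<lambda>r. y r * exp (A r)) has_real_derivative z) (at r) \<and> 0 \<le> z" by blast
  qed
  then show "y s \<le> exp (A t - A s) * y t"
    by (simp add: exp_diff field_simps)
qed

text \<open>Up to the factor 1/pi this is the Poisson kernel. It replaces the indicator of the strip
  divided by \<epsilon>: it dominates half of it, stays bounded in \<epsilon> away from x = 0, and
  has the bounded primitive arctan(x/\<epsilon>).\<close>

definition delta_weight :: "real \<Rightarrow> real \<Rightarrow> real" where
  "delta_weight \<epsilon> x = \<epsilon> / (\<epsilon>\<^sup>2 + x\<^sup>2)"

lemma delta_weight_nonneg: "0 < \<epsilon> \<Longrightarrow> 0 \<le> delta_weight \<epsilon> x"
  by (simp add: delta_weight_def)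

lemma delta_weight_le:
  assumes "0 < \<epsilon>" "\<epsilon> \<le> 1" "0 < m" "m \<le> \<bar>x\<bar>"
  shows "delta_weight \<epsilon> x \<le> 1 / m\<^sup>2"
proof -
  have "m\<^sup>2 \<le> \<epsilon>\<^sup>2 + x\<^sup>2"
    using assms abs_le_square_iff[of m x] by (simp add: add_increasing)
  then show ?thesis
    unfolding delta_weight_def using assms by (intro frac_le) auto
qed

lemma delta_weight_ge:
  assumes "0 < \<epsilon>" "\<bar>x\<bar> \<le> \<epsilon>"
  shows "1 / \<epsilon> \<le> 2 * delta_weight \<epsilon> x"
proof -
  have "x\<^sup>2 \<le> \<epsilon>\<^sup>2" using assms abs_le_square_iff[of x \<epsilon>] by simp
  moreover have "0 < \<epsilon>\<^sup>2 + x\<^sup>2" using assms by (simp add: add_pos_nonneg)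
  ultimately show ?thesis
    unfolding delta_weight_def using assms by (simp add: field_simps power2_eq_square)
qed

lemma has_real_derivative_arctan_scaled:
  assumes "0 < \<epsilon>" "(f has_real_derivative f') (at r)"
  shows "((\<lambda>r. arctan (f r / \<epsilon>)) has_real_derivative f' * delta_weight \<epsilon> (f r)) (at r)"
proof -
  have "0 < \<epsilon>\<^sup>2 + (f r)\<^sup>2" using assms by (simp add: add_pos_nonneg)
  then have "f' / \<epsilon> * inverse (1 + (f r / \<epsilon>)\<^sup>2) = f' * delta_weight \<epsilon> (f r)"
    unfolding delta_weight_def using assms(1) by (simp add: field_simps power2_eq_square)
  then show ?thesis
    using assms by (auto intro!: derivative_eq_intros simp: mult.commute)
qed

section \<open>Growth bounds uniform in \<epsilon>\<close>

definition C1_near where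
  "C1_near g g' \<delta> f f' S \<longleftrightarrow>
    (\<forall>r\<in>S. (f has_real_derivative f' r) (at r) \<and> \<bar>f r - g r\<bar> \<le> \<delta> \<and> \<bar>f' r - g' r\<bar> \<le> \<delta>)"
  for g g' f f' :: "real \<Rightarrow> real"

lemma C1_near_mono: "C1_near g g' \<delta> f f' S \<Longrightarrow> \<delta> \<le> \<delta>' \<Longrightarrow> T \<subseteq> S \<Longrightarrow> C1_near g g' \<delta>' f f' T"
  unfolding C1_near_def by fastforce

text \<open>Two curves \<open>f\<close> and \<open>h\<close> appear because the forces of two
  solutions may differ as soon as either of them is in the strip; a comparison with the background
  puts the same curve in both places.\<close>

definition delta_growth where
  "delta_growth C \<epsilon> f h y y' S \<longleftrightarrow>
    (\<forall>r\<in>S. (y has_real_derivative y' r) (at r) \<and> 0 \<le> y r \<and>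
      \<bar>y' r\<bar> \<le> C * (1 + delta_weight \<epsilon> (f r) + delta_weight \<epsilon> (h r)) * y r)"
  for f h y y' :: "real \<Rightarrow> real"

lemma delta_growth_subset: "delta_growth C \<epsilon> f h y y' S \<Longrightarrow> T \<subseteq> S \<Longrightarrow> delta_growth C \<epsilon> f h y y' T"
  unfolding delta_growth_def by blast

text \<open>The order of quantifiers is the point: \<delta> and \<open>K\<close> are fixed before
  \<epsilon>, the curves and the energy. Admitting every subinterval of [a, b] makes the property
  pass to unions of adjacent intervals.\<close>

definition growth_bound where
  "growth_bound g g' C \<delta> K a b \<longleftrightarrow> 
    (\<forall>f f' h h' y y' \<epsilon> s t. 0 < \<epsilon> \<longrightarrow> \<epsilon> \<le> 1 \<longrightarrow> a \<le> s \<longrightarrow> s \<le> t \<longrightarrow> t \<le> b \<longrightarrow>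
      C1_near g g' \<delta> f f' {s..t} \<longrightarrow> C1_near g g' \<delta> h h' {s..t} \<longrightarrow>
      delta_growth C \<epsilon> f h y y' {s..t} \<longrightarrow> y t \<le> K * y s \<and> y s \<le> K * y t)"

lemma growth_bound_mono:
  assumes "growth_bound g g' C \<delta> K a b" "\<delta>' \<le> \<delta>"
  shows "growth_bound g g' C \<delta>' K a b"
  using assms(1) C1_near_mono[OF _ assms(2) order_refl] unfolding growth_bound_def by blast

text \<open>An interval across \<open>b\<close> is cut there and the factors multiply. That both
  factors are at least 1 lets the product also serve intervals on one side of
  \<open>b\<close>.\<close>

lemma growth_bound_trans:
  assumes 1: "growth_bound g g' C \<delta>1 K1 a b" and 2: "growth_bound g g' C \<delta>2 K2 b c"
    and K: "1 \<le> K1" "1 \<le> K2"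
  shows "growth_bound g g' C (min \<delta>1 \<delta>2) (K1 * K2) a c"
  unfolding growth_bound_def
proof (intro allI impI)
  fix f f' h h' y y' :: "real \<Rightarrow> real" and \<epsilon> s t :: real
  assume \<epsilon>: "0 < \<epsilon>" "\<epsilon> \<le> 1" and st: "a \<le> s" "s \<le> t" "t \<le> c"
    and f: "C1_near g g' (min \<delta>1 \<delta>2) f f' {s..t}" and h: "C1_near g g' (min \<delta>1 \<delta>2) h h' {s..t}"
    and y: "delta_growth C \<epsilon> f h y y' {s..t}"
  have nn: "0 \<le> y r" if "r \<in> {s..t}" for r using y that unfolding delta_growth_def by blast
  have b1: "y q \<le> K1 * y p \<and> y p \<le> K1 * y q" if "s \<le> p" "p \<le> q" "q \<le> t" "q \<le> b" for p q
  proof -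
    have sub: "{p..q} \<subseteq> {s..t}" using that by auto
    show ?thesis
      using 1[unfolded growth_bound_def, rule_format, OF \<epsilon> _ \<open>p \<le> q\<close> \<open>q \<le> b\<close>
          C1_near_mono[OF f _ sub, of \<delta>1] C1_near_mono[OF h _ sub, of \<delta>1] delta_growth_subset[OF y sub]]
        st that by simp
  qed
  have b2: "y q \<le> K2 * y p \<and> y p \<le> K2 * y q" if "s \<le> p" "p \<le> q" "q \<le> t" "b \<le> p" for p q
  proof -
    have sub: "{p..q} \<subseteq> {s..t}" using that by auto
    show ?thesis
      using 2[unfolded growth_bound_def, rule_format, OF \<epsilon> \<open>b \<le> p\<close> \<open>p \<le> q\<close> _
          C1_near_mono[OF f _ sub, of \<delta>2] C1_near_mono[OF h _ sub, of \<delta>2] delta_growth_subset[OF y sub]]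
        st that by simp
  qed
  have KK: "K1 \<le> K1 * K2" "K2 \<le> K1 * K2" using K by auto
  have up: "x \<le> (K1 * K2) * z" if "x \<le> K * z" "K \<le> K1 * K2" "0 \<le> z" for x z K
    using that mult_right_mono[of K "K1 * K2" z] by linarith
  have nst: "0 \<le> y s" "0 \<le> y t" using nn st by auto
  consider "t \<le> b" | "b \<le> s" | "s \<le> b" "b \<le> t" by linarith
  then show "y t \<le> K1 * K2 * y s \<and> y s \<le> K1 * K2 * y t"
  proof cases
    case 1
    then show ?thesis using b1[of s t] st KK nst by (auto intro: up)
  next
    case 2
    then show ?thesis using b2[of s t] st KK nst by (auto intro: up)
  next
    case 3
    have "y t \<le> K2 * y b" "y b \<le> K1 * y s" "y s \<le> K1 * y b" "y b \<le> K2 * y t"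
      using b1[of s b] b2[of b t] 3 by auto
    moreover from this have "K2 * y b \<le> K2 * (K1 * y s)" "K1 * y b \<le> K1 * (K2 * y t)"
      using K by (auto intro!: mult_left_mono)
    ultimately show ?thesis by (simp add: mult_ac)
  qed
qed

text \<open>With |g| >= m and tolerance m/2 both curves keep distance m/2 from 0, so each weight is
  at most 4/m^2. The two together give 8/m^2, and an ordinary Gronwall factor suffices.\<close>

lemma growth_bound_local_away:
  assumes m: "0 < m" and C: "0 \<le> C" and g: "\<And>r. r \<in> {a..b} \<Longrightarrow> m \<le> \<bar>g r\<bar>"
  shows "growth_bound g g' C (m / 2) (exp (C * (1 + 8 / m\<^sup>2) * (b - a))) a b"
  unfolding growth_bound_def
proof (intro allI impI)
  fix f f' h h' y y' :: "real \<Rightarrow> real" and \<epsilon> s t :: real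
  assume \<epsilon>: "0 < \<epsilon>" "\<epsilon> \<le> 1" and st: "a \<le> s" "s \<le> t" "t \<le> b"
    and f: "C1_near g g' (m / 2) f f' {s..t}" and h: "C1_near g g' (m / 2) h h' {s..t}"
    and y: "delta_growth C \<epsilon> f h y y' {s..t}"
  define B where "B = C * (1 + 8 / m\<^sup>2)"
  have nn: "0 \<le> y r" if "r \<in> {s..t}" for r using y that unfolding delta_growth_def by blast
  have le: "\<bar>y' r\<bar> \<le> B * y r" if r: "r \<in> {s..t}" for r
  proof -
    have "m \<le> \<bar>g r\<bar>" "\<bar>f r - g r\<bar> \<le> m / 2" "\<bar>h r - g r\<bar> \<le> m / 2"
      using g f h r st unfolding C1_near_def by auto
    then have "m / 2 \<le> \<bar>f r\<bar>" "m / 2 \<le> \<bar>h r\<bar>" by linarith+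
    then have "delta_weight \<epsilon> (f r) \<le> 1 / (m / 2)\<^sup>2" "delta_weight \<epsilon> (h r) \<le> 1 / (m / 2)\<^sup>2"
      using \<epsilon> m by (auto intro!: delta_weight_le)
    then have "1 + delta_weight \<epsilon> (f r) + delta_weight \<epsilon> (h r) \<le> 1 + 8 / m\<^sup>2"
      by (simp add: power_divide)
    then have "C * (1 + delta_weight \<epsilon> (f r) + delta_weight \<epsilon> (h r)) * y r \<le> B * y r"
      unfolding B_def using C nn[OF r] by (intro mult_right_mono mult_left_mono)
    moreover have "\<bar>y' r\<bar> \<le> C * (1 + delta_weight \<epsilon> (f r) + delta_weight \<epsilon> (h r)) * y r"
      using y r unfolding delta_growth_def by blast
    ultimately show ?thesis by linarith
  qed
  have yd: "\<And>r. r \<in> {s..t} \<Longrightarrow> (y has_real_derivative y' r) (at r)"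
    using y unfolding delta_growth_def by blast
  have Ad: "((\<lambda>r. B * r) has_real_derivative B) (at r)" for r
    by (auto intro!: derivative_eq_intros)
  have "B * t - B * s = B * (t - s)" by (simp add: algebra_simps)
  also have "\<dots> \<le> B * (b - a)"
    unfolding B_def using st C m by (intro mult_left_mono) auto
  finally have e: "exp (B * t - B * s) \<le> exp (B * (b - a))" by simp
  have "exp (B * t - B * s) * y s \<le> exp (B * (b - a)) * y s" "exp (B * t - B * s) * y t \<le> exp (B * (b - a)) * y t"
    using e nn st by (auto intro!: mult_right_mono)
  with gronwall_potential[OF \<open>s \<le> t\<close> yd Ad le]
  show "y t \<le> exp (C * (1 + 8 / m\<^sup>2) * (b - a)) * y s \<and> y s \<le> exp (C * (1 + 8 / m\<^sup>2) * (b - a)) * y t"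
    unfolding B_def by auto
qed

text \<open>\<open>sg\<close> is the direction of crossing. Tolerance m/2 leaves sg f' >= m/2, so
  the weight is at most 2/m times the derivative of sg arctan(f/\<epsilon>). Each of the two
  arctangents varies by at most pi, which gives 4 pi/m whatever \<epsilon> is.\<close>

lemma growth_bound_local_crossing:
  assumes m: "0 < m" and C: "0 \<le> C" and sg: "\<bar>sg\<bar> = 1" and g: "\<And>r. r \<in> {a..b} \<Longrightarrow> m \<le> sg * g' r"
  shows "growth_bound g g' C (m / 2) (exp (C * (b - a + 4 * pi / m))) a b"
  unfolding growth_bound_def
proof (intro allI impI)
  fix f f' h h' y y' :: "real \<Rightarrow> real" and \<epsilon> s t :: real
  assume \<epsilon>: "0 < \<epsilon>" "\<epsilon> \<le> 1" and st: "a \<le> s" "s \<le> t" "t \<le> b"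
    and f: "C1_near g g' (m / 2) f f' {s..t}" and h: "C1_near g g' (m / 2) h h' {s..t}"
    and y: "delta_growth C \<epsilon> f h y y' {s..t}"
  have nn: "0 \<le> y r" if "r \<in> {s..t}" for r using y that unfolding delta_growth_def by blast
  define A where "A r = C * (r + 2 / m * sg * (arctan (f r / \<epsilon>) + arctan (h r / \<epsilon>)))" for r
  define A' where "A' r = C * (1 + 2 / m * sg * (f' r * delta_weight \<epsilon> (f r) + h' r * delta_weight \<epsilon> (h r)))" for r
  have Ad: "(A has_real_derivative A' r) (at r)" if r: "r \<in> {s..t}" for r
  proof -
    have fd: "(f has_real_derivative f' r) (at r)" and hd: "(h has_real_derivative h' r) (at r)"
      using f h r unfolding C1_near_def by auto
    show ?thesis
      unfolding A_def A'_def
      by (intro DERIV_cmult DERIV_add DERIV_ident has_real_derivative_arctan_scaled[OF \<epsilon>(1)] fd hd)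
  qed
  have yd: "\<And>r. r \<in> {s..t} \<Longrightarrow> (y has_real_derivative y' r) (at r)"
    using y unfolding delta_growth_def by blast
  have wt: "delta_weight \<epsilon> x \<le> 2 / m * sg * (v * delta_weight \<epsilon> x)"
    if "\<bar>v - g' r\<bar> \<le> m / 2" "r \<in> {s..t}" for v x r
  proof -
    have "m \<le> sg * g' r" using g that st by auto
    moreover have "\<bar>sg * v - sg * g' r\<bar> \<le> m / 2"
      using that sg abs_mult[of sg "v - g' r"] by (simp add: right_diff_distrib)
    ultimately have "m / 2 \<le> sg * v" by linarith
    then have "1 \<le> 2 / m * sg * v" using m by (simp add: field_simps)
    from mult_right_mono[OF this delta_weight_nonneg[OF \<epsilon>(1), of x]] show ?thesis by (simp add: mult_ac)
  qed
  have le: "\<bar>y' r\<bar> \<le> A' r * y r" if r: "r \<in> {s..t}" for r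
  proof -
    have fv: "\<bar>f' r - g' r\<bar> \<le> m / 2" and hv: "\<bar>h' r - g' r\<bar> \<le> m / 2"
      using f h r unfolding C1_near_def by auto
    have "1 + delta_weight \<epsilon> (f r) + delta_weight \<epsilon> (h r)
        \<le> 1 + 2 / m * sg * (f' r * delta_weight \<epsilon> (f r) + h' r * delta_weight \<epsilon> (h r))"
      using wt[OF fv r, of "f r"] wt[OF hv r, of "h r"] by (simp add: distrib_left)
    then have "C * (1 + delta_weight \<epsilon> (f r) + delta_weight \<epsilon> (h r)) * y r \<le> A' r * y r"
      unfolding A'_def using C nn[OF r] by (intro mult_right_mono mult_left_mono)
    moreover have "\<bar>y' r\<bar> \<le> C * (1 + delta_weight \<epsilon> (f r) + delta_weight \<epsilon> (h r)) * y r"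
      using y r unfolding delta_growth_def by blast
    ultimately show ?thesis by linarith
  qed
  have "sg * (arctan u - arctan v) \<le> pi" for u v
  proof -
    have "sg * (arctan u - arctan v) \<le> \<bar>sg\<bar> * \<bar>arctan u - arctan v\<bar>"
      unfolding abs_mult[symmetric] by (rule abs_ge_self)
    also have "\<dots> \<le> pi"
      using sg arctan_bounded[of u] arctan_bounded[of v] unfolding sg by (simp add: abs_le_iff)
    finally show ?thesis .
  qed
  then have "sg * (arctan (f t / \<epsilon>) - arctan (f s / \<epsilon>)) + sg * (arctan (h t / \<epsilon>) - arctan (h s / \<epsilon>)) \<le> 2 * pi"
    by (smt (verit))
  then have "2 / m * (sg * (arctan (f t / \<epsilon>) - arctan (f s / \<epsilon>)) + sg * (arctan (h t / \<epsilon>) - arctan (h s / \<epsilon>)))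
      \<le> 2 / m * (2 * pi)"
    using m by (intro mult_left_mono) auto
  moreover have "A t - A s = C * ((t - s) + 2 / m * (sg * (arctan (f t / \<epsilon>) - arctan (f s / \<epsilon>)) + sg * (arctan (h t / \<epsilon>) - arctan (h s / \<epsilon>))))"
    unfolding A_def by (simp add: algebra_simps)
  ultimately have "A t - A s \<le> C * (b - a + 4 * pi / m)"
    using st C by (auto intro!: mult_left_mono)
  then have e: "exp (A t - A s) \<le> exp (C * (b - a + 4 * pi / m))" by simp
  have "exp (A t - A s) * y s \<le> exp (C * (b - a + 4 * pi / m)) * y s"
    "exp (A t - A s) * y t \<le> exp (C * (b - a + 4 * pi / m)) * y t"
    using e nn st by (auto intro!: mult_right_mono)
  with gronwall_potential[OF \<open>s \<le> t\<close> yd Ad le]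
  show "y t \<le> exp (C * (b - a + 4 * pi / m)) * y s \<and> y s \<le> exp (C * (b - a + 4 * pi / m)) * y t"
    by auto
qed

text \<open>Where \<open>g\<close> is nonzero it keeps away from 0 nearby; at a zero of
  \<open>g\<close> the value of \<open>g'\<close> is nonzero and keeps its sign nearby. Half the
  absolute value at \<open>x\<close> serves as the lower bound \<open>m\<close>. The conclusion is
  shaped as the local hypothesis of \<open>Bolzano\<close>.\<close>

lemma growth_bound_local:
  fixes g g' :: "real \<Rightarrow> real"
  assumes C: "0 \<le> C" and g: "isCont g x" and g': "isCont g' x" and nz: "g x \<noteq> 0 \<or> g' x \<noteq> 0"
  shows "\<exists>d>0. \<forall>a b. a \<le> x \<and> x \<le> b \<and> b - a < d \<longrightarrow> (\<exists>\<delta>>0. \<exists>K\<ge>1. growth_bound g g' C \<delta> K a b)"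
proof (cases "g x = 0")
  case False
  define m where "m = \<bar>g x\<bar> / 2"
  have m: "0 < m" using False by (simp add: m_def)
  from g m obtain d where d: "0 < d" "\<And>r. dist r x < d \<Longrightarrow> dist (g r) (g x) < m"
    unfolding continuous_at_eps_delta by blast
  show ?thesis
  proof (rule exI[of _ d], rule conjI[OF d(1)], rule allI, rule allI, rule impI)
    fix a b assume ab: "a \<le> x \<and> x \<le> b \<and> b - a < d"
    have ge: "m \<le> \<bar>g r\<bar>" if "r \<in> {a..b}" for r
    proof -
      have "dist r x < d" using that ab by (auto simp: dist_real_def)
      from d(2)[OF this] show ?thesis by (auto simp: dist_real_def m_def abs_if split: if_splits)
    qed
    have "growth_bound g g' C (m / 2) (exp (C * (1 + 8 / m\<^sup>2) * (b - a))) a b"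
      by (rule growth_bound_local_away[OF m C]) (rule ge)
    moreover have "1 \<le> exp (C * (1 + 8 / m\<^sup>2) * (b - a))" using C m ab by simp
    ultimately show "\<exists>\<delta>>0. \<exists>K\<ge>1. growth_bound g g' C \<delta> K a b" using m half_gt_zero by blast
  qed
next
  case True
  define m where "m = \<bar>g' x\<bar> / 2"
  have m: "0 < m" using True nz by (simp add: m_def)
  from g' m obtain d where d: "0 < d" "\<And>r. dist r x < d \<Longrightarrow> dist (g' r) (g' x) < m"
    unfolding continuous_at_eps_delta by blast
  have sg: "\<bar>sgn (g' x)\<bar> = 1" using True nz by (simp add: sgn_if)
  show ?thesis
  proof (rule exI[of _ d], rule conjI[OF d(1)], rule allI, rule allI, rule impI)
    fix a b assume ab: "a \<le> x \<and> x \<le> b \<and> b - a < d"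
    have ge: "m \<le> sgn (g' x) * g' r" if "r \<in> {a..b}" for r
    proof -
      have "dist r x < d" using that ab by (auto simp: dist_real_def)
      from d(2)[OF this] show ?thesis by (auto simp: dist_real_def m_def abs_if sgn_if split: if_splits)
    qed
    have "growth_bound g g' C (m / 2) (exp (C * (b - a + 4 * pi / m))) a b"
      by (rule growth_bound_local_crossing[OF m C sg]) (rule ge)
    moreover have "1 \<le> exp (C * (b - a + 4 * pi / m))" using C m ab by simp
    ultimately show "\<exists>\<delta>>0. \<exists>K\<ge>1. growth_bound g g' C \<delta> K a b" using m half_gt_zero by blast
  qed
qed

text \<open>Near a zero of \<open>g\<close>, \<open>arctan (f / \<epsilon>)\<close> is, up to a factor, a bounded primitive of the weight; elsewhere
  the weight is bounded.\<close>

lemma growth_bound_exists: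
  fixes g g' :: "real \<Rightarrow> real"
  assumes "0 \<le> C" "a \<le> b" "\<And>x. isCont g x" "\<And>x. isCont g' x" "\<And>x. g x \<noteq> 0 \<or> g' x \<noteq> 0"
  shows "\<exists>\<delta>>0. \<exists>K\<ge>1. growth_bound g g' C \<delta> K a b"
\<comment> \<open>\<open>Bolzano\<close> reduces the claim to gluing and to short intervals around
  each point, so the zeros of \<open>g\<close> never have to be counted or located.\<close>
proof (rule Bolzano[OF \<open>a \<le> b\<close>])
  fix a b c :: real
  assume "\<exists>\<delta>>0. \<exists>K\<ge>1. growth_bound g g' C \<delta> K a b" "\<exists>\<delta>>0. \<exists>K\<ge>1. growth_bound g g' C \<delta> K b c"
  then obtain \<delta>1 K1 \<delta>2 K2 where "0 < \<delta>1" "1 \<le> K1" "growth_bound g g' C \<delta>1 K1 a b"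
    "0 < \<delta>2" "1 \<le> K2" "growth_bound g g' C \<delta>2 K2 b c" by blast
  then have "growth_bound g g' C (min \<delta>1 \<delta>2) (K1 * K2) a c" "0 < min \<delta>1 \<delta>2" "1 \<le> K1 * K2"
    using mult_mono[of 1 K1 1 K2] by (auto intro: growth_bound_trans)
  then show "\<exists>\<delta>>0. \<exists>K\<ge>1. growth_bound g g' C \<delta> K a c" by blast
next
  show "\<exists>d>0. \<forall>a b. a \<le> x \<and> x \<le> b \<and> b - a < d \<longrightarrow> (\<exists>\<delta>>0. \<exists>K\<ge>1. growth_bound g g' C \<delta> K a b)" for x
    by (rule growth_bound_local) (use assms in auto)
qed

section \<open>Continuation arguments\<close>

lemma bootstrap_right:
  fixes y :: "real \<Rightarrow> real"
  assumes cont: "continuous_on {a..b} y" and start: "y a < D"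
    and step: "\<And>t. t \<in> {a..b} \<Longrightarrow> (\<And>s. s \<in> {a..t} \<Longrightarrow> y s \<le> D) \<Longrightarrow> y t < D"
    and t: "t \<in> {a..b}"
  shows "y t < D"
proof (rule ccontr)
  assume "\<not> y t < D"
  define S where "S = {s \<in> {a..b}. y s = D}"
  \<comment> \<open>Intermediate values: a time with value at least \<open>D\<close> is preceded by
    one, possibly itself, with value exactly \<open>D\<close>. The least element \<open>x\<close> of
    the compact set \<open>S\<close> is then a time up to which the hypothesis of
    \<open>step\<close> holds, and \<open>step\<close> contradicts the value \<open>D\<close>
    there.\<close>
  have first: "\<exists>r\<in>S. r \<le> s" if s: "s \<in> {a..b}" "D \<le> y s" for s
  proof -
    have "continuous_on {a..s} y" using s by (intro continuous_on_subset[OF cont]) auto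
    then have "\<exists>r\<ge>a. r \<le> s \<and> y r = D" using start s by (intro IVT') auto
    then show ?thesis using s unfolding S_def by force
  qed
  have "S \<noteq> {}" using first[of t] t \<open>\<not> y t < D\<close> by auto
  have "closed S" unfolding S_def
    by (rule continuous_closed_preimage_constant[OF cont closed_atLeastAtMost])
  moreover have "bounded S" by (rule bounded_subset[of "{a..b}"]) (auto simp: S_def)
  ultimately have "compact S" by (simp add: compact_eq_bounded_closed)
  from compact_attains_inf[OF this \<open>S \<noteq> {}\<close>] obtain x where x: "x \<in> S" "\<And>r. r \<in> S \<Longrightarrow> x \<le> r"
    by blast
  have "y x < D"
  proof (rule step)
    show "x \<in> {a..b}" using x by (simp add: S_def)
    show "y s \<le> D" if s: "s \<in> {a..x}" for s
    proof (rule ccontr)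
      assume "\<not> y s \<le> D"
      then have "D \<le> y s" by simp
      with first[of s] s \<open>x \<in> {a..b}\<close> obtain r where "r \<in> S" "r \<le> s" by auto
      with x(2) s have "s = x" by force
      with x(1) \<open>\<not> y s \<le> D\<close> show False by (simp add: S_def)
    qed
  qed
  with x(1) show False by (simp add: S_def)
qed

text \<open>The starting time may lie anywhere in the interval. Times before it are treated by
  reflecting \<open>y\<close>, and \<open>closed_segment\<close> phrases the hypothesis for both
  orders at once.\<close>

lemma bootstrap_closed_segment:
  fixes y :: "real \<Rightarrow> real"
  assumes cont: "continuous_on {a..b} y" and \<alpha>: "\<alpha> \<in> {a..b}" and start: "y \<alpha> < D"
    and step: "\<And>t. t \<in> {a..b} \<Longrightarrow> (\<And>s. s \<in> closed_segment \<alpha> t \<Longrightarrow> y s \<le> D) \<Longrightarrow> y t < D"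
    and t: "t \<in> {a..b}"
  shows "y t < D"
proof (cases "\<alpha> \<le> t")
  case True
  show ?thesis
  proof (rule bootstrap_right[of \<alpha> b y D t])
    show "continuous_on {\<alpha>..b} y" using \<alpha> by (intro continuous_on_subset[OF cont]) auto
    show "y r < D" if "r \<in> {\<alpha>..b}" "\<And>s. s \<in> {\<alpha>..r} \<Longrightarrow> y s \<le> D" for r
      using that \<alpha> by (intro step) (auto simp: closed_segment_eq_real_ivl)
  qed (use True t start in auto)
next
  case False
  have "(\<lambda>s. y (- s)) (- t) < D"
  proof (rule bootstrap_right[of "- \<alpha>" "- a" "\<lambda>s. y (- s)" D "- t"])
    show "continuous_on {- \<alpha>..- a} (\<lambda>s. y (- s))"
      using \<alpha> by (intro continuous_on_compose2[OF cont] continuous_intros) auto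
    show "y (- r) < D" if r: "r \<in> {- \<alpha>..- a}" and le: "\<And>s. s \<in> {- \<alpha>..r} \<Longrightarrow> y (- s) \<le> D" for r
    proof (rule step)
      show "y s \<le> D" if "s \<in> closed_segment \<alpha> (- r)" for s
        using le[of "- s"] that r by (auto simp: closed_segment_eq_real_ivl split: if_splits)
    qed (use r \<alpha> in auto)
  qed (use False t start in auto)
  then show ?thesis by simp
qed

section \<open>Bounded Lipschitz functions\<close>

text \<open>Boundedness is included because products of merely Lipschitz functions need not be
  Lipschitz. The combined property survives sums, products and quotients with denominators away from
  0, so the estimate of the force reduces to its atoms.\<close>

definition bounded_lipschitz :: "'a::metric_space set \<Rightarrow> ('a \<Rightarrow> 'b::real_normed_vector) \<Rightarrow> bool" where
  "bounded_lipschitz S f \<longleftrightarrow>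
    (\<exists>C\<ge>0. \<forall>x\<in>S. norm (f x) \<le> C \<and> (\<forall>y\<in>S. norm (f x - f y) \<le> C * dist x y))"

lemma bounded_lipschitzI:
  assumes "\<And>x. x \<in> S \<Longrightarrow> norm (f x) \<le> B"
    and "\<And>x y. x \<in> S \<Longrightarrow> y \<in> S \<Longrightarrow> norm (f x - f y) \<le> L * dist x y"
  shows "bounded_lipschitz S f"
  unfolding bounded_lipschitz_def
proof (intro exI[of _ "\<bar>B\<bar> + \<bar>L\<bar>"] conjI ballI)
  fix x y assume "x \<in> S" "y \<in> S"
  then have "norm (f x) \<le> B" "norm (f x - f y) \<le> L * dist x y" using assms by auto
  moreover have "L * dist x y \<le> (\<bar>B\<bar> + \<bar>L\<bar>) * dist x y" by (intro mult_right_mono) auto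
  ultimately show "norm (f x - f y) \<le> (\<bar>B\<bar> + \<bar>L\<bar>) * dist x y" by linarith
next
  fix x assume "x \<in> S"
  with assms(1)[of x] show "norm (f x) \<le> \<bar>B\<bar> + \<bar>L\<bar>" by linarith
qed simp

lemma bounded_lipschitzE:
  assumes "bounded_lipschitz S f"
  obtains C where "0 \<le> C" "\<And>x. x \<in> S \<Longrightarrow> norm (f x) \<le> C"
    "\<And>x y. x \<in> S \<Longrightarrow> y \<in> S \<Longrightarrow> norm (f x - f y) \<le> C * dist x y"
  using assms unfolding bounded_lipschitz_def by blast

lemma bounded_lipschitz_const: "bounded_lipschitz S (\<lambda>x. c)"
  by (rule bounded_lipschitzI[of _ _ "norm c" 0]) auto

lemma bounded_lipschitz_add:
  assumes "bounded_lipschitz S f" "bounded_lipschitz S g"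
  shows "bounded_lipschitz S (\<lambda>x. f x + g x)"
proof -
  obtain C where C: "\<And>x. x \<in> S \<Longrightarrow> norm (f x) \<le> C"
    "\<And>x y. x \<in> S \<Longrightarrow> y \<in> S \<Longrightarrow> norm (f x - f y) \<le> C * dist x y"
    using assms(1) by (rule bounded_lipschitzE) blast
  obtain D where D: "\<And>x. x \<in> S \<Longrightarrow> norm (g x) \<le> D"
    "\<And>x y. x \<in> S \<Longrightarrow> y \<in> S \<Longrightarrow> norm (g x - g y) \<le> D * dist x y"
    using assms(2) by (rule bounded_lipschitzE) blast
  show ?thesis
  proof (rule bounded_lipschitzI[of _ _ "C + D" "C + D"])
    show "norm (f x + g x) \<le> C + D" if "x \<in> S" for x
      using norm_triangle_ineq[of "f x" "g x"] C(1)[OF that] D(1)[OF that] by linarith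
    show "norm (f x + g x - (f y + g y)) \<le> (C + D) * dist x y" if "x \<in> S" "y \<in> S" for x y
      using norm_diff_triangle_ineq[of "f x" "g x" "f y" "g y"] C(2)[OF that] D(2)[OF that]
      by (simp add: distrib_right)
  qed
qed

lemma bounded_lipschitz_mult:
  fixes f g :: "'a::metric_space \<Rightarrow> real"
  assumes "bounded_lipschitz S f" "bounded_lipschitz S g"
  shows "bounded_lipschitz S (\<lambda>x. f x * g x)"
proof -
  obtain C where C: "0 \<le> C" "\<And>x. x \<in> S \<Longrightarrow> norm (f x) \<le> C"
    "\<And>x y. x \<in> S \<Longrightarrow> y \<in> S \<Longrightarrow> norm (f x - f y) \<le> C * dist x y"
    using assms(1) by (rule bounded_lipschitzE) blast
  obtain D where D: "0 \<le> D" "\<And>x. x \<in> S \<Longrightarrow> norm (g x) \<le> D"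
    "\<And>x y. x \<in> S \<Longrightarrow> y \<in> S \<Longrightarrow> norm (g x - g y) \<le> D * dist x y"
    using assms(2) by (rule bounded_lipschitzE) blast
  show ?thesis
  proof (rule bounded_lipschitzI[of _ _ "C * D" "2 * C * D"])
    show "norm (f x * g x) \<le> C * D" if "x \<in> S" for x
      using C D that by (auto simp: abs_mult intro!: mult_mono)
    show "norm (f x * g x - f y * g y) \<le> 2 * C * D * dist x y" if xy: "x \<in> S" "y \<in> S" for x y
    proof -
      have "f x * g x - f y * g y = (f x - f y) * g x + f y * (g x - g y)"
        by (simp add: algebra_simps)
      then have "norm (f x * g x - f y * g y) \<le> norm (f x - f y) * norm (g x) + norm (f y) * norm (g x - g y)"
        using norm_triangle_ineq[of "(f x - f y) * g x" "f y * (g x - g y)"] by (simp add: abs_mult)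
      also have "\<dots> \<le> (C * dist x y) * D + C * (D * dist x y)"
        using C(1) D(1) C(2)[OF xy(2)] D(2)[OF xy(1)] C(3)[OF xy] D(3)[OF xy]
        by (intro add_mono mult_mono) auto
      finally show ?thesis by simp
    qed
  qed
qed

lemma bounded_lipschitz_minus:
  fixes f :: "'a::metric_space \<Rightarrow> real"
  assumes "bounded_lipschitz S f"
  shows "bounded_lipschitz S (\<lambda>x. - f x)"
  using bounded_lipschitz_mult[OF bounded_lipschitz_const[of S "-1"] assms] by simp

lemma bounded_lipschitz_diff:
  fixes f g :: "'a::metric_space \<Rightarrow> real"
  assumes "bounded_lipschitz S f" "bounded_lipschitz S g"
  shows "bounded_lipschitz S (\<lambda>x. f x - g x)"
  using bounded_lipschitz_add[OF assms(1) bounded_lipschitz_minus[OF assms(2)]] by simp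

lemma bounded_lipschitz_power2:
  fixes f :: "'a::metric_space \<Rightarrow> real"
  assumes "bounded_lipschitz S f"
  shows "bounded_lipschitz S (\<lambda>x. (f x)\<^sup>2)"
  unfolding power2_eq_square by (intro bounded_lipschitz_mult assms)

lemma bounded_lipschitz_inverse:
  fixes f :: "'a::metric_space \<Rightarrow> real"
  assumes "bounded_lipschitz S f" and c: "0 < c" "\<And>x. x \<in> S \<Longrightarrow> c \<le> \<bar>f x\<bar>"
  shows "bounded_lipschitz S (\<lambda>x. inverse (f x))"
proof -
  obtain C where C: "0 \<le> C" "\<And>x y. x \<in> S \<Longrightarrow> y \<in> S \<Longrightarrow> norm (f x - f y) \<le> C * dist x y"
    using assms(1) by (rule bounded_lipschitzE) blast
  show ?thesis
  proof (rule bounded_lipschitzI[of _ _ "inverse c" "C * (inverse c * inverse c)"])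
    have le: "\<bar>inverse (f x)\<bar> \<le> inverse c" if "x \<in> S" for x
      using c(1) c(2)[OF that] by (simp add: le_imp_inverse_le)
    then show "norm (inverse (f x)) \<le> inverse c" if "x \<in> S" for x using that by simp
    show "norm (inverse (f x) - inverse (f y)) \<le> C * (inverse c * inverse c) * dist x y"
      if xy: "x \<in> S" "y \<in> S" for x y
    proof -
      have "f x \<noteq> 0" "f y \<noteq> 0" using c(1) c(2)[OF xy(1)] c(2)[OF xy(2)] by auto
      then have "inverse (f x) - inverse (f y) = - (inverse (f x) * (f x - f y) * inverse (f y))"
        by (rule inverse_diff_inverse)
      then have "norm (inverse (f x) - inverse (f y)) = norm (f x - f y) * (\<bar>inverse (f x)\<bar> * \<bar>inverse (f y)\<bar>)"
        by (simp add: abs_mult)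
      also have "\<dots> \<le> (C * dist x y) * (inverse c * inverse c)"
        using C xy c(1) by (intro mult_mono le) auto
      finally show ?thesis by (simp add: mult_ac)
    qed
  qed
qed

lemma bounded_lipschitz_divide:
  fixes f g :: "'a::metric_space \<Rightarrow> real"
  assumes "bounded_lipschitz S f" "bounded_lipschitz S g" and c: "0 < c" "\<And>x. x \<in> S \<Longrightarrow> c \<le> \<bar>g x\<bar>"
  shows "bounded_lipschitz S (\<lambda>x. f x / g x)"
  unfolding divide_inverse
  by (intro bounded_lipschitz_mult assms(1) bounded_lipschitz_inverse[OF assms(2) c])

lemma bounded_lipschitz_compose:
  assumes "bounded_lipschitz T g" and f: "\<And>x y. x \<in> S \<Longrightarrow> y \<in> S \<Longrightarrow> dist (f x) (f y) \<le> L * dist x y"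
    and ST: "\<And>x. x \<in> S \<Longrightarrow> f x \<in> T"
  shows "bounded_lipschitz S (\<lambda>x. g (f x))"
proof -
  obtain C where C: "0 \<le> C" "\<And>x. x \<in> T \<Longrightarrow> norm (g x) \<le> C"
    "\<And>x y. x \<in> T \<Longrightarrow> y \<in> T \<Longrightarrow> norm (g x - g y) \<le> C * dist x y"
    using assms(1) by (rule bounded_lipschitzE) blast
  show ?thesis
  proof (rule bounded_lipschitzI[of _ _ C "C * L"])
    show "norm (g (f x)) \<le> C" if "x \<in> S" for x using C ST that by blast
    show "norm (g (f x) - g (f y)) \<le> C * L * dist x y" if xy: "x \<in> S" "y \<in> S" for x y
      using C(3)[OF ST[OF xy(1)] ST[OF xy(2)]] mult_left_mono[OF f[OF xy] C(1)] by (simp add: mult.assoc)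
  qed
qed

lemma bounded_lipschitz_vec:
  fixes f :: "'a::metric_space \<Rightarrow> real^'n"
  assumes "\<And>i. bounded_lipschitz S (\<lambda>x. f x $ i)"
  shows "bounded_lipschitz S f"
proof -
  have "\<forall>i. \<exists>C. (\<forall>x\<in>S. \<bar>f x $ i\<bar> \<le> C) \<and> (\<forall>x\<in>S. \<forall>y\<in>S. \<bar>f x $ i - f y $ i\<bar> \<le> C * dist x y)"
  proof
    fix i
    obtain C where "\<And>x. x \<in> S \<Longrightarrow> norm (f x $ i) \<le> C"
      "\<And>x y. x \<in> S \<Longrightarrow> y \<in> S \<Longrightarrow> norm (f x $ i - f y $ i) \<le> C * dist x y"
      using assms[of i] by (rule bounded_lipschitzE) blast
    then show "\<exists>C. (\<forall>x\<in>S. \<bar>f x $ i\<bar> \<le> C) \<and> (\<forall>x\<in>S. \<forall>y\<in>S. \<bar>f x $ i - f y $ i\<bar> \<le> C * dist x y)"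
      by auto
  qed
  from choice[OF this] obtain C where C: "\<And>i x. x \<in> S \<Longrightarrow> \<bar>f x $ i\<bar> \<le> C i"
    "\<And>i x y. x \<in> S \<Longrightarrow> y \<in> S \<Longrightarrow> \<bar>f x $ i - f y $ i\<bar> \<le> C i * dist x y" by blast
  show ?thesis
  proof (rule bounded_lipschitzI[of _ _ "sum C UNIV" "sum C UNIV"])
    show "norm (f x) \<le> sum C UNIV" if "x \<in> S" for x
      using norm_le_l1_cart[of "f x"] sum_mono[of UNIV "\<lambda>i. \<bar>f x $ i\<bar>" C] C(1)[OF that] by fastforce
    show "norm (f x - f y) \<le> sum C UNIV * dist x y" if xy: "x \<in> S" "y \<in> S" for x y
    proof -
      have "norm (f x - f y) \<le> (\<Sum>i\<in>UNIV. \<bar>(f x - f y) $ i\<bar>)" by (rule norm_le_l1_cart)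
      also have "\<dots> \<le> (\<Sum>i\<in>UNIV. C i * dist x y)"
        using C(2)[OF xy] by (intro sum_mono) simp
      finally show ?thesis by (simp add: sum_distrib_right)
    qed
  qed
qed

lemma Cinf_bounded_lipschitz_cball:
  assumes "Cinf_on UNIV (f :: 'a::euclidean_space \<Rightarrow> 'b::real_normed_vector)"
  shows "bounded_lipschitz (cball 0 R) f"
proof -
  obtain L where L: "L-lipschitz_on (cball 0 R) f" using Cinf_lipschitz_on_cball[OF assms] by blast
  have "bounded (f ` cball 0 R)"
    using Cinf_on_continuous[OF assms]
    by (intro compact_imp_bounded compact_continuous_image) (auto intro: continuous_on_subset)
  then obtain B where "\<forall>x\<in>cball 0 R. norm (f x) \<le> B" unfolding bounded_iff by blast
  then show ?thesis
    by (intro bounded_lipschitzI[of _ _ B L]) (use lipschitz_onD[OF L] in \<open>auto simp: dist_norm\<close>)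
qed

section \<open>Coordinates in five dimensions\<close>

lemma exhaust_5:
  fixes x :: 5
  shows "x = 1 \<or> x = 2 \<or> x = 3 \<or> x = 4 \<or> x = 5"
proof (induct x)
  case (of_int z)
  then have "z = 0 \<or> z = 1 \<or> z = 2 \<or> z = 3 \<or> z = 4" by fastforce
  then show ?case by auto
qed

lemma forall_5: "(\<forall>i::5. P i) \<longleftrightarrow> P 1 \<and> P 2 \<and> P 3 \<and> P 4 \<and> P 5"
  by (metis exhaust_5)

lemma vec_eq_iff_5:
  "(x :: 'a^5) = y \<longleftrightarrow> x$1 = y$1 \<and> x$2 = y$2 \<and> x$3 = y$3 \<and> x$4 = y$4 \<and> x$5 = y$5"
  unfolding vec_eq_iff forall_5 ..

lemma vector_5 [simp]:
  "(vector [v, w, x, y, z] :: ('a::zero)^5) $ 1 = v"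
  "(vector [v, w, x, y, z] :: ('a::zero)^5) $ 2 = w"
  "(vector [v, w, x, y, z] :: ('a::zero)^5) $ 3 = x"
  "(vector [v, w, x, y, z] :: ('a::zero)^5) $ 4 = y"
  "(vector [v, w, x, y, z] :: ('a::zero)^5) $ 5 = z"
  unfolding vector_def by auto

section \<open>The rescaled system\<close>

text \<open>The exponents balance the equations inside the strip: the V equation contains the
  derivative of the delta net, of size \<epsilon>^-2, and the Z equations the net itself, of size
  \<epsilon>^-1, while in the U equation a factor \<Phi> of size \<epsilon>^-1 meets |U| <=
  \<epsilon>.\<close>

definition rescale :: "real \<Rightarrow> real^5 \<Rightarrow> real^5" where
  "rescale \<epsilon> x = vector [x$1, \<epsilon>\<^sup>2 * x$2, \<epsilon> * x$3, \<epsilon> * x$4, \<epsilon> * x$5]"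

lemma rescale_nth [simp]:
  "rescale \<epsilon> x $ 1 = x$1" "rescale \<epsilon> x $ 2 = \<epsilon>\<^sup>2 * x$2" "rescale \<epsilon> x $ 3 = \<epsilon> * x$3"
  "rescale \<epsilon> x $ 4 = \<epsilon> * x$4" "rescale \<epsilon> x $ 5 = \<epsilon> * x$5"
  by (simp_all add: rescale_def)

lemma linear_rescale: "linear (rescale \<epsilon>)"
  by (rule linearI) (simp_all add: vec_eq_iff_5 algebra_simps)

lemma rescale_diff: "rescale \<epsilon> (x - y) = rescale \<epsilon> x - rescale \<epsilon> y"
  by (rule linear_diff[OF linear_rescale])

lemma norm_rescale_le:
  assumes "0 \<le> \<epsilon>" "\<epsilon> \<le> 1"
  shows "norm (rescale \<epsilon> x) \<le> norm x"
proof (rule norm_le_componentwise_cart)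
  have e2: "\<epsilon>\<^sup>2 \<le> 1" using assms by (simp add: power_le_one)
  have "\<forall>i. norm (rescale \<epsilon> x $ i) \<le> norm (x $ i)"
    unfolding forall_5 using assms e2 by (simp add: abs_mult mult_left_le_one_le)
  then show "norm (rescale \<epsilon> x $ i) \<le> norm (x $ i)" for i by blast
qed

text \<open>V is scaled most strongly, so undoing the scaling costs two powers of
  \<epsilon>.\<close>

lemma norm_le_rescale:
  assumes "0 < \<epsilon>" "\<epsilon> \<le> 1"
  shows "\<epsilon>\<^sup>2 * norm x \<le> norm (rescale \<epsilon> x)"
proof -
  have e2: "\<epsilon>\<^sup>2 \<le> 1" "\<epsilon>\<^sup>2 \<le> \<epsilon>"
    using assms power_le_one[of \<epsilon> 2] mult_left_le_one_le[of \<epsilon> \<epsilon>] by (auto simp: power2_eq_square)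
  have "norm (\<epsilon>\<^sup>2 *\<^sub>R x) \<le> norm (rescale \<epsilon> x)"
  proof (rule norm_le_componentwise_cart)
    have "\<forall>i. norm ((\<epsilon>\<^sup>2 *\<^sub>R x) $ i) \<le> norm (rescale \<epsilon> x $ i)"
      unfolding forall_5 using assms e2 by (simp add: abs_mult mult_left_le_one_le mult_right_mono)
    then show "norm ((\<epsilon>\<^sup>2 *\<^sub>R x) $ i) \<le> norm (rescale \<epsilon> x $ i)" for i by blast
  qed
  then show ?thesis by simp
qed

lemma has_vector_derivative_rescale:
  assumes "(f has_vector_derivative f') (at t)"
  shows "((\<lambda>t. rescale \<epsilon> (f t)) has_vector_derivative rescale \<epsilon> f') (at t)"
  using bounded_linear.has_vector_derivative[OF linear_conv_bounded_linear[THEN iffD1, OF linear_rescale] assms] .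

text \<open>Clamping \<open>U/\<epsilon>\<close> does not change products with \<open>\<rho>\<close> or its derivative, but makes every factor
  bounded.\<close>

definition clip :: "real \<Rightarrow> real" where
  "clip u = max (- 2) (min 2 u)"

text \<open>The differential at \<open>x\<close> of \<open>H\<close> composed with
  \<open>Zvec\<close>, applied to \<open>w\<close>.\<close>

definition dH :: "(real^3 \<Rightarrow> real) \<Rightarrow> real^5 \<Rightarrow> real^5 \<Rightarrow> real" where
  "dH H x w = Hp H 1 (Zvec x) * w$3 + Hp H 2 (Zvec x) * w$4 + Hp H 3 (Zvec x) * w$5"

text \<open>Here \<open>x\<close> stands for X/\<epsilon> = (U/\<epsilon>, \<epsilon> V, Z) and
  \<open>v\<close> for X'. With u = U/\<epsilon> the product of U^2 and the delta net is \<epsilon>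
  u^2 \<rho>(u), so this is the denominator of the system.\<close>

definition scaled_N :: "real \<Rightarrow> real \<Rightarrow> (real^3 \<Rightarrow> real) \<Rightarrow> (real \<Rightarrow> real) \<Rightarrow> real \<times> (real^5) \<times> (real^5) \<Rightarrow> real" where
  "scaled_N \<sigma> a H \<rho> = (\<lambda>(\<epsilon>, x, v). \<sigma> * a\<^sup>2 - \<epsilon> * (clip (x$1))\<^sup>2 * \<rho> (clip (x$1)) * H (Zvec x))"

text \<open>This is \<epsilon> (\<Phi> - \<kappa> N) with \<kappa> = e / (\<sigma> a^2), the last
  summand being \<epsilon> (e - \<kappa> N). The difference is supported in the strip and bounded
  for bounded states, whereas \<Phi> itself may grow like 1/\<epsilon>.\<close>

definition scaled_Q :: "real \<Rightarrow> real \<Rightarrow> real \<Rightarrow> (real^3 \<Rightarrow> real) \<Rightarrow> (real \<Rightarrow> real) \<Rightarrow> real \<times> (real^5) \<times> (real^5) \<Rightarrow> real" where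
  "scaled_Q \<sigma> a e H \<rho> = (\<lambda>(\<epsilon>, x, v).
    1/2 * (v$1)\<^sup>2 * (\<rho> (clip (x$1)) * dH H x x + H (Zvec x) * tder 1 \<rho> (clip (x$1)) * clip (x$1))
    - v$1 * (v$1 * H (Zvec x) * (tder 1 \<rho> (clip (x$1)) * clip (x$1) + \<rho> (clip (x$1)))
        + \<rho> (clip (x$1)) * clip (x$1) * dH H x v)
    + e / (\<sigma> * a\<^sup>2) * \<epsilon>\<^sup>2 * (clip (x$1))\<^sup>2 * \<rho> (clip (x$1)) * H (Zvec x))"

text \<open>What remains of the rescaled right-hand side once -\<kappa> X is split off. The term
  with \<epsilon>^2 in the second component is \<kappa> applied to the additional summand in the
  numerator of the V equation.\<close>

definition scaled_force :: "real \<Rightarrow> real \<Rightarrow> real \<Rightarrow> (real^3 \<Rightarrow> real) \<Rightarrow> (real \<Rightarrow> real) \<Rightarrow> real \<times> (real^5) \<times> (real^5) \<Rightarrow> real^5" where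
  "scaled_force \<sigma> a e H \<rho> = (\<lambda>(\<epsilon>, x, v).
    let c = clip (x$1); r = \<rho> c; h = H (Zvec x);
        QN = scaled_Q \<sigma> a e H \<rho> (\<epsilon>, x, v) / scaled_N \<sigma> a H \<rho> (\<epsilon>, x, v)
    in vector [ - (c * QN),
      1/2 * h * tder 1 \<rho> c * (v$1)\<^sup>2 + r * v$1 * dH H x v - e / (\<sigma> * a\<^sup>2) * \<epsilon>\<^sup>2 * h * r * c
        - QN * (x$2 + \<epsilon> * h * r * c),
      1/2 * Hp H 1 (Zvec x) * r * (v$1)\<^sup>2 - x$3 * QN,
      1/2 * Hp H 2 (Zvec x) * r * (v$1)\<^sup>2 - x$4 * QN,
      \<sigma>/2 * Hp H 3 (Zvec x) * r * (v$1)\<^sup>2 - x$5 * QN ])"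

text \<open>Treating \<epsilon> as a coordinate makes all bounds uniform in it. The coordinate
  U/\<epsilon> is left free: it has no bound uniform in \<epsilon>, and it enters the force only
  through \<open>clip\<close>.\<close>

definition state_set :: "real \<Rightarrow> real \<Rightarrow> (real \<times> (real^5) \<times> (real^5)) set" where
  "state_set E R = {(\<epsilon>, x, v). 0 \<le> \<epsilon> \<and> \<epsilon> \<le> E \<and> (\<forall>i. i \<noteq> 1 \<longrightarrow> \<bar>x$i\<bar> \<le> R) \<and> norm v \<le> R}"

lemma clip_bounds: "\<bar>clip u\<bar> \<le> 2" "\<bar>clip u - clip v\<bar> \<le> \<bar>u - v\<bar>"
  by (auto simp: clip_def)

lemma dist_tuple_ge:
  "dist (fst p) (fst q) \<le> dist p q" "dist (fst (snd p)) (fst (snd q)) \<le> dist p q"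
  "dist (snd (snd p)) (snd (snd q)) \<le> dist p q"
  for p q :: "'a::metric_space \<times> 'b::metric_space \<times> 'c::metric_space"
  using dist_fst_le[of p q] dist_snd_le[of p q] dist_fst_le[of "snd p" "snd q"] dist_snd_le[of "snd p" "snd q"]
  by linarith+

lemma bounded_lipschitz_coords:
  shows bounded_lipschitz_eps: "bounded_lipschitz (state_set E R) fst"
    and bounded_lipschitz_x: "i \<noteq> 1 \<Longrightarrow> bounded_lipschitz (state_set E R) (\<lambda>q. fst (snd q) $ i)"
    and bounded_lipschitz_v: "bounded_lipschitz (state_set E R) (\<lambda>q. snd (snd q) $ j)"
    and bounded_lipschitz_clip: "bounded_lipschitz (state_set E R) (\<lambda>q. clip (fst (snd q) $ 1))"
proof -
  show "bounded_lipschitz (state_set E R) fst"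
  proof (rule bounded_lipschitzI[of _ _ "\<bar>E\<bar>" 1])
    show "norm (fst p - fst q) \<le> 1 * dist p q" for p q :: "real \<times> (real^5) \<times> (real^5)"
      using dist_tuple_ge(1)[of p q] by (simp add: dist_norm)
  qed (auto simp: state_set_def)
  have x: "norm (fst (snd p) $ i - fst (snd q) $ i) \<le> dist p q" 
    and v: "norm (snd (snd p) $ i - snd (snd q) $ i) \<le> dist p q" for p q :: "real \<times> (real^5) \<times> (real^5)" and i
    using component_le_norm_cart[of "fst (snd p) - fst (snd q)" i] dist_tuple_ge(2)[of p q]
      component_le_norm_cart[of "snd (snd p) - snd (snd q)" i] dist_tuple_ge(3)[of p q]
    by (auto simp: dist_norm)
  show "bounded_lipschitz (state_set E R) (\<lambda>q. fst (snd q) $ i)" if "i \<noteq> 1"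
    by (rule bounded_lipschitzI[of _ _ R 1]) (use that x in \<open>auto simp: state_set_def\<close>)
  show "bounded_lipschitz (state_set E R) (\<lambda>q. snd (snd q) $ j)"
  proof (rule bounded_lipschitzI[of _ _ R 1])
    fix q assume "q \<in> state_set E R"
    then have "norm (snd (snd q)) \<le> R" by (auto simp: state_set_def)
    with component_le_norm_cart[of "snd (snd q)" j] show "norm (snd (snd q) $ j) \<le> R" by simp
  qed (use v in auto)
  show "bounded_lipschitz (state_set E R) (\<lambda>q. clip (fst (snd q) $ 1))"
  proof (rule bounded_lipschitzI[of _ _ 2 1])
    show "norm (clip (fst (snd p) $ 1) - clip (fst (snd q) $ 1)) \<le> 1 * dist p q" for p q :: "real \<times> (real^5) \<times> (real^5)"
      using clip_bounds(2)[of "fst (snd p) $ 1" "fst (snd q) $ 1"] x[of p 1 q] by simp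
  qed (use clip_bounds in auto)
qed

lemma linear_Zvec: "linear Zvec"
  by (rule linearI) (simp_all add: Zvec_def vec_eq_iff forall_3)

lemma norm_Zvec_le: "norm (Zvec x) \<le> norm x"
proof -
  have "(norm (Zvec x))\<^sup>2 = (x$3)\<^sup>2 + (x$4)\<^sup>2 + (x$5)\<^sup>2"
    by (simp add: norm_vec_def L2_set_def sum_3 Zvec_def)
  also have "\<dots> = (\<Sum>i\<in>{3,4,5}. (x$i)\<^sup>2)" by simp
  also have "\<dots> \<le> (\<Sum>i\<in>UNIV. (x$i)\<^sup>2)" by (intro sum_mono2) auto
  also have "\<dots> = (norm x)\<^sup>2"
    by (simp add: norm_vec_def L2_set_def sum_nonneg)
  finally show ?thesis by (simp add: power2_le_iff_abs_le)
qed

lemma bounded_lipschitz_Zvec: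
  assumes "Cinf_on UNIV F"
  shows "bounded_lipschitz (state_set E R) (\<lambda>q. F (Zvec (fst (snd q))))"
proof (rule bounded_lipschitz_compose[where L=1 and g=F and f="\<lambda>q. Zvec (fst (snd q))"])
  \<comment> \<open>Three coordinates of size at most \<open>R\<close> have Euclidean norm at most
    their sum, hence the radius.\<close>
  show "bounded_lipschitz (cball 0 (3 * R)) F" by (rule Cinf_bounded_lipschitz_cball[OF assms])
  show "dist (Zvec (fst (snd p))) (Zvec (fst (snd q))) \<le> 1 * dist p q" for p q :: "real \<times> (real^5) \<times> (real^5)"
    using norm_Zvec_le[of "fst (snd p) - fst (snd q)"] dist_tuple_ge(2)[of p q]
    by (simp add: dist_norm linear_diff[OF linear_Zvec])
  show "Zvec (fst (snd q)) \<in> cball 0 (3 * R)" if "q \<in> state_set E R" for q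
    using that norm_le_l1_cart[of "Zvec (fst (snd q))"]
    by (auto simp: state_set_def sum_3 Zvec_def forall_5)
qed

lemma bounded_lipschitz_profile:
  assumes "Cinf_on UNIV (f :: real \<Rightarrow> real)"
  shows "bounded_lipschitz (state_set E R) (\<lambda>q. f (clip (fst (snd q) $ 1)))"
proof -
  obtain C where C: "\<And>p q. p \<in> state_set E R \<Longrightarrow> q \<in> state_set E R \<Longrightarrow>
    norm (clip (fst (snd p) $ 1) - clip (fst (snd q) $ 1)) \<le> C * dist p q"
    using bounded_lipschitz_clip[of E R] by (rule bounded_lipschitzE) blast
  show ?thesis
    by (rule bounded_lipschitz_compose[OF Cinf_bounded_lipschitz_cball[OF assms, of 2],
          where L=C and f="\<lambda>q. clip (fst (snd q) $ 1)"])
      (use C clip_bounds(1) in \<open>auto simp: dist_real_def\<close>)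
qed

lemma Cinf_Hp: "Cinf_on UNIV H \<Longrightarrow> Cinf_on UNIV (Hp H j)"
proof -
  assume "Cinf_on UNIV H"
  moreover have "Hp H j = dpartial (axis j 1) H" by (auto simp: Hp_def)
  ultimately show ?thesis using Cinf_on_dpartial[of UNIV H "axis j 1"] by simp
qed

lemmas bounded_lipschitz_intros = bounded_lipschitz_add bounded_lipschitz_diff bounded_lipschitz_minus
  bounded_lipschitz_mult bounded_lipschitz_power2 bounded_lipschitz_const bounded_lipschitz_eps bounded_lipschitz_v bounded_lipschitz_clip

context
  fixes \<sigma> a e :: real and H :: "real^3 \<Rightarrow> real" and \<rho> :: "real \<Rightarrow> real"
  assumes sig: "\<sigma> \<in> {1, -1}" and a: "0 < a" and H: "Cinf_on UNIV H" and \<rho>: "Cinf_on UNIV \<rho>"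
begin

text \<open>The leading term has absolute value a^2 and the perturbation carries a factor
  \<epsilon>, so shrinking the range of \<epsilon> keeps the denominator away from 0.\<close>

lemma scaled_N_lower:
  obtains E where "0 < E" "E \<le> 1" "\<And>q. q \<in> state_set E R \<Longrightarrow> a\<^sup>2 / 2 \<le> \<bar>scaled_N \<sigma> a H \<rho> q\<bar>"
proof -
  have "bounded_lipschitz (state_set 1 R)
      (\<lambda>q. (clip (fst (snd q) $ 1))\<^sup>2 * \<rho> (clip (fst (snd q) $ 1)) * H (Zvec (fst (snd q))))"
    by (intro bounded_lipschitz_intros bounded_lipschitz_profile[OF \<rho>] bounded_lipschitz_Zvec[OF H])
  then obtain C where C: "0 \<le> C" "\<And>q. q \<in> state_set 1 R \<Longrightarrow>
    norm ((clip (fst (snd q) $ 1))\<^sup>2 * \<rho> (clip (fst (snd q) $ 1)) * H (Zvec (fst (snd q)))) \<le> C"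
    by (rule bounded_lipschitzE) blast
  \<comment> \<open>\<open>C\<close> was obtained over the full range up to 1, so it stays valid
    after shrinking; adding 1 to it avoids a division by 0.\<close>
  define E where "E = min 1 (a\<^sup>2 / (2 * (C + 1)))"
  have E: "0 < E" "E \<le> 1" using a C(1) by (auto simp: E_def)
  have "E * C \<le> a\<^sup>2 / (2 * (C + 1)) * (C + 1)"
    using C(1) a by (intro mult_mono) (auto simp: E_def)
  also have "\<dots> = a\<^sup>2 / 2" using C(1) nonzero_mult_divide_mult_cancel_right[of "C + 1" "a\<^sup>2" 2] by simp
  finally have EC: "E * C \<le> a\<^sup>2 / 2" .
  have "a\<^sup>2 / 2 \<le> \<bar>scaled_N \<sigma> a H \<rho> q\<bar>" if q: "q \<in> state_set E R" for q
  proof -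
    define w where "w = (clip (fst (snd q) $ 1))\<^sup>2 * \<rho> (clip (fst (snd q) $ 1)) * H (Zvec (fst (snd q)))"
    have "q \<in> state_set 1 R" and e: "0 \<le> fst q" "fst q \<le> E" using q E by (auto simp: state_set_def)
    then have "\<bar>w\<bar> \<le> C" using C(2) by (simp add: w_def)
    then have "\<bar>fst q * w\<bar> \<le> E * C" using e E unfolding abs_mult by (intro mult_mono) auto
    moreover have "scaled_N \<sigma> a H \<rho> q = \<sigma> * a\<^sup>2 - fst q * w"
      by (simp add: scaled_N_def split_def w_def)
    moreover have "\<bar>\<sigma> * a\<^sup>2\<bar> = a\<^sup>2" using sig by auto
    ultimately show ?thesis using EC by linarith
  qed
  with E show ?thesis by (rule that)
qed

lemma bounded_lipschitz_scaled_force: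
  assumes N: "\<And>q. q \<in> state_set E R \<Longrightarrow> a\<^sup>2 / 2 \<le> \<bar>scaled_N \<sigma> a H \<rho> q\<bar>"
  shows "bounded_lipschitz (state_set E R) (scaled_force \<sigma> a e H \<rho>)"
proof -
  note prof = bounded_lipschitz_profile[OF \<rho>] bounded_lipschitz_profile[OF Cinf_tder[OF \<rho>, of 1]] bounded_lipschitz_Zvec[OF H] bounded_lipschitz_Zvec[OF Cinf_Hp[OF H]]
  have x: "bounded_lipschitz (state_set E R) (\<lambda>q. fst (snd q) $ 2)"
    "bounded_lipschitz (state_set E R) (\<lambda>q. fst (snd q) $ 3)"
    "bounded_lipschitz (state_set E R) (\<lambda>q. fst (snd q) $ 4)"
    "bounded_lipschitz (state_set E R) (\<lambda>q. fst (snd q) $ 5)"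
    by (rule bounded_lipschitz_x; simp)+
  note ints = bounded_lipschitz_intros prof x
  have blN: "bounded_lipschitz (state_set E R) (\<lambda>q. scaled_N \<sigma> a H \<rho> q)"
    unfolding scaled_N_def split_def by (intro ints)
  have "bounded_lipschitz (state_set E R) (\<lambda>q. scaled_Q \<sigma> a e H \<rho> q)"
    unfolding scaled_Q_def split_def dH_def by (intro ints)
  from bounded_lipschitz_divide[OF this blN _ N]
  have QN: "bounded_lipschitz (state_set E R) (\<lambda>q. scaled_Q \<sigma> a e H \<rho> q / scaled_N \<sigma> a H \<rho> q)"
    using a by simp
  show ?thesis
  proof (rule bounded_lipschitz_vec)
    have "\<forall>i. bounded_lipschitz (state_set E R) (\<lambda>q. scaled_force \<sigma> a e H \<rho> q $ i)"
      unfolding forall_5 scaled_force_def split_def Let_def vector_5 prod.collapse dH_def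
      by (intro conjI ints QN)
    then show "bounded_lipschitz (state_set E R) (\<lambda>q. scaled_force \<sigma> a e H \<rho> q $ i)" for i by blast
  qed
qed

end

section \<open>From the residual of the system to the rescaled equation\<close>

lemma profile_outside:
  assumes supp: "closure {x. \<rho> x \<noteq> 0} \<subseteq> {-1..1}" and u: "1 < \<bar>u\<bar>"
  shows "\<rho> u = (0::real)" "tder 1 \<rho> u = 0"
proof -
  have z: "\<rho> v = 0" if "1 < \<bar>v\<bar>" for v
    using supp closure_subset[of "{x. \<rho> x \<noteq> 0}"] that by force
  show "\<rho> u = 0" by (rule z[OF u])
  have "open {v::real. 1 < \<bar>v\<bar>}" by (intro open_Collect_less continuous_intros)
  have "(\<rho> has_vector_derivative 0) (at u)"
    by (rule has_vector_derivative_transform_within_open[of "\<lambda>_. 0" _ _ "{v. 1 < \<bar>v\<bar>}"])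
      (use z u \<open>open _\<close> in auto)
  then show "tder 1 \<rho> u = 0" unfolding tder_1 by (rule vector_derivative_at)
qed

lemma clip_outside: "1 < \<bar>u\<bar> \<Longrightarrow> 1 < \<bar>clip u\<bar>" and clip_inside: "\<bar>u\<bar> \<le> 2 \<Longrightarrow> clip u = u"
  by (auto simp: clip_def)

text \<open>Each summand carries \<rho> or its derivative at the clamped point.
  \<open>scaled_Q\<close> vanishes with them, so its quotient by \<open>scaled_N\<close> is 0
  whatever the denominator.\<close>

lemma scaled_force_outside:
  assumes "closure {x. \<rho> x \<noteq> 0} \<subseteq> {-1..1}" and "1 < \<bar>x $ 1\<bar>"
  shows "scaled_force \<sigma> a e H \<rho> (\<epsilon>, x, v) = 0"
  using profile_outside[OF assms(1) clip_outside[OF assms(2)]]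
  by (simp add: scaled_force_def scaled_Q_def Let_def vec_eq_iff_5)

lemma has_vector_derivative_Zvec:
  assumes "(c has_vector_derivative c') (at t)"
  shows "((\<lambda>t. Zvec (c t)) has_vector_derivative Zvec c') (at t)"
  using bounded_linear.has_vector_derivative[OF linear_conv_bounded_linear[THEN iffD1, OF linear_Zvec] assms] .

lemma has_real_derivative_nth:
  assumes "(c has_vector_derivative c') (at t)"
  shows "((\<lambda>t. c t $ i) has_real_derivative c' $ i) (at t)"
  using bounded_linear.has_vector_derivative[OF bounded_linear_vec_nth assms]
  by (simp add: has_real_derivative_iff_has_vector_derivative)

lemma has_real_derivative_H:
  assumes H: "Cinf_on UNIV H" and c: "(c has_vector_derivative c') (at t)"
  shows "((\<lambda>t. H (Zvec (c t))) has_real_derivative dH H (c t) c') (at t)"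
proof -
  have "(\<Sum>b\<in>Basis. (h \<bullet> b) *\<^sub>R dpartial b H z) = Hp H 1 z * h$1 + Hp H 2 z * h$2 + Hp H 3 z * h$3"
    for h z :: "real^3"
  proof -
    have B: "(Basis :: (real^3) set) = (\<lambda>i. axis i 1) ` UNIV" by (auto simp: Basis_vec_def)
    have inj: "inj (\<lambda>i::3. axis i (1::real))" by (auto simp: inj_on_def axis_eq_axis)
    have "(\<Sum>b\<in>Basis. (h \<bullet> b) *\<^sub>R dpartial b H z) =
        (\<Sum>i\<in>UNIV. (h \<bullet> axis i 1) *\<^sub>R dpartial (axis i 1) H z)"
      unfolding B sum.reindex[OF inj] o_def ..
    also have "\<dots> = (\<Sum>i\<in>UNIV. h $ i * Hp H i z)" by (simp add: inner_axis Hp_def)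
    finally show ?thesis by (simp add: sum_3 mult.commute)
  qed
  with Cinf_has_derivative[OF H, of "Zvec (c t)"]
  have "(H has_derivative (\<lambda>h. Hp H 1 (Zvec (c t)) * h$1 + Hp H 2 (Zvec (c t)) * h$2 + Hp H 3 (Zvec (c t)) * h$3))
      (at (Zvec (c t)) within range (\<lambda>t. Zvec (c t)))"
    by (simp add: has_derivative_at_withinI)
  from vector_derivative_diff_chain_within[OF has_vector_derivative_Zvec[OF c] this]
  have "((H \<circ> (\<lambda>t. Zvec (c t))) has_vector_derivative dH H (c t) c') (at t)"
    by (simp add: dH_def Zvec_def)
  then show ?thesis by (simp add: has_real_derivative_iff_has_vector_derivative o_def)
qed

lemma has_real_derivative_delta:
  assumes "Cinf_on UNIV \<rho>" "0 < \<epsilon>"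
  shows "(delta \<rho> \<epsilon> has_real_derivative tder 1 \<rho> (x / \<epsilon>) / \<epsilon>\<^sup>2) (at x)"
proof -
  have "(\<rho> has_real_derivative tder 1 \<rho> (x / \<epsilon>)) (at (x / \<epsilon>))"
    using has_vector_derivative_tder[OF assms(1), of 0 "x / \<epsilon>"]
    by (simp add: has_real_derivative_iff_has_vector_derivative)
  moreover have "((\<lambda>x. x / \<epsilon>) has_real_derivative 1 / \<epsilon>) (at x)"
    using assms(2) by (auto intro!: derivative_eq_intros)
  ultimately have "((\<lambda>x. \<rho> (x / \<epsilon>)) has_real_derivative tder 1 \<rho> (x / \<epsilon>) * (1 / \<epsilon>)) (at x)"
    by (rule DERIV_chain2[where f=\<rho> and g="\<lambda>x. x / \<epsilon>"])
  from DERIV_cdivide[OF this, of \<epsilon>] show ?thesis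
    by (simp add: delta_def[abs_def] power2_eq_square)
qed

text \<open>An exact identity for smooth curves, not an asymptotic one: the failure to solve the
  system is carried along as the last summand. The algebra rests on \<Phi>/N = \<kappa> +
  Q/(\<epsilon> N), which separates the linear background equation from the force in the
  strip.\<close>

lemma scaled_residual:
  assumes sig: "\<sigma> \<in> {1, -1}" and a: "0 < a" and H: "Cinf_on UNIV H" and \<rho>: "Cinf_on UNIV \<rho>"
    and supp: "closure {x. \<rho> x \<noteq> 0} \<subseteq> {-1..1}" and c: "Cinf_on UNIV c" and \<epsilon>: "0 < \<epsilon>"
    and q: "q = (\<epsilon>, (1 / \<epsilon>) *\<^sub>R rescale \<epsilon> (c t), rescale \<epsilon> (tder 1 c t))"
    and N: "scaled_N \<sigma> a H \<rho> q \<noteq> 0"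
  shows "rescale \<epsilon> (tder 2 c t) = - (e / (\<sigma> * a\<^sup>2)) *\<^sub>R rescale \<epsilon> (c t) + scaled_force \<sigma> a e H \<rho> q
    + rescale \<epsilon> (residual \<sigma> a e H \<rho> \<epsilon> c t)"
proof -
  define U V Z2 Z3 Z4 where xs: "U = c t $ 1" "V = c t $ 2" "Z2 = c t $ 3" "Z3 = c t $ 4" "Z4 = c t $ 5"
  define p \<zeta>2 \<zeta>3 \<zeta>4 where vs: "p = tder 1 c t $ 1" "\<zeta>2 = tder 1 c t $ 3" "\<zeta>3 = tder 1 c t $ 4" "\<zeta>4 = tder 1 c t $ 5"
  define h h2 h3 h4 where hs: "h = H (Zvec (c t))" "h2 = Hp H 1 (Zvec (c t))" "h3 = Hp H 2 (Zvec (c t))" "h4 = Hp H 3 (Zvec (c t))"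
  define u R R' where us: "u = U / \<epsilon>" "R = \<rho> u" "R' = tder 1 \<rho> u"
  define s where s: "s = \<sigma> * a\<^sup>2"
  have "s \<noteq> 0" using sig a by (auto simp: s)
  define hZ where "hZ = h2 * Z2 + h3 * Z3 + h4 * Z4"
  define hV where "hV = h2 * \<zeta>2 + h3 * \<zeta>3 + h4 * \<zeta>4"
  define P where "P = 1/2 * p\<^sup>2 * (R * hZ + h * R' * u) - p * (p * h * (R' * u + R) + R * u * (\<epsilon> * hV))"
  define Q where "Q = P + e / s * \<epsilon>\<^sup>2 * u\<^sup>2 * R * h"
  define N where "N = s - \<epsilon> * u\<^sup>2 * R * h"
  define \<Phi> where "\<Phi> = e + P / \<epsilon>"
  have Zq: "Zvec ((1 / \<epsilon>) *\<^sub>R rescale \<epsilon> (c t)) = Zvec (c t)"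
    using \<epsilon> by (simp add: Zvec_def)
  have x1: "((1 / \<epsilon>) *\<^sub>R rescale \<epsilon> (c t)) $ 1 = u" by (simp add: us xs)
  \<comment> \<open>For |u| <= 2 the clamp does nothing; otherwise \<open>u\<close> and its clamped
    value both lie strictly outside [-1, 1], where \<rho> and its derivative vanish.\<close>
  have clipR: "\<rho> (clip u) = R" "tder 1 \<rho> (clip u) = R'" "clip u * R = u * R" "clip u * R' = u * R'"
    using profile_outside[OF supp, of u] profile_outside[OF supp, of "clip u"] clip_outside[of u] clip_inside[of u]
    unfolding us(2,3) by (cases "\<bar>u\<bar> \<le> 2"; simp)+
  have clipR2: "(clip u)\<^sup>2 * R = u\<^sup>2 * R" "R' * clip u = R' * u" "R * clip u = R * u"
    using clipR(3,4) by (simp_all add: power2_eq_square mult_ac) (metis mult.assoc mult.commute)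
  have Nq: "scaled_N \<sigma> a H \<rho> q = N"
    unfolding scaled_N_def q prod.case x1 Zq clipR(1) N_def s hs[symmetric]
    using clipR2(1) by (metis mult.assoc)
  have N0: "N \<noteq> 0" using N Nq by simp
  have dHx: "dH H ((1 / \<epsilon>) *\<^sub>R rescale \<epsilon> (c t)) ((1 / \<epsilon>) *\<^sub>R rescale \<epsilon> (c t)) = hZ"
    unfolding dH_def Zq using \<epsilon> by (simp add: hZ_def hs xs)
  have dHv: "dH H ((1 / \<epsilon>) *\<^sub>R rescale \<epsilon> (c t)) (rescale \<epsilon> (tder 1 c t)) = \<epsilon> * hV"
    unfolding dH_def Zq by (simp add: hV_def hs vs algebra_simps)
  have v1: "rescale \<epsilon> (tder 1 c t) $ 1 = p" by (simp add: vs)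
  have Qq: "scaled_Q \<sigma> a e H \<rho> q = Q"
  proof -
    have "scaled_Q \<sigma> a e H \<rho> q = 1/2 * p\<^sup>2 * (R * hZ + h * (R' * clip u))
      - p * (p * h * (R' * clip u + R) + (R * clip u) * (\<epsilon> * hV)) + e / s * \<epsilon>\<^sup>2 * ((clip u)\<^sup>2 * R) * h"
      unfolding scaled_Q_def q prod.case x1 Zq clipR(1,2) dHx dHv v1 s hs(1)[symmetric] by (simp add: mult_ac)
    then show ?thesis unfolding clipR2 Q_def P_def by (simp add: mult_ac)
  qed
  have fq: "scaled_force \<sigma> a e H \<rho> q = vector [- (clip u * (Q / N)),
      1/2 * h * R' * p\<^sup>2 + R * p * (\<epsilon> * hV) - e / s * \<epsilon>\<^sup>2 * h * R * clip u - Q / N * (\<epsilon> * V + \<epsilon> * h * R * clip u),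
      1/2 * h2 * R * p\<^sup>2 - Z2 * (Q / N), 1/2 * h3 * R * p\<^sup>2 - Z3 * (Q / N), \<sigma>/2 * h4 * R * p\<^sup>2 - Z4 * (Q / N)]"
  proof -
    have x: "((1 / \<epsilon>) *\<^sub>R rescale \<epsilon> (c t)) $ 2 = \<epsilon> * V" "((1 / \<epsilon>) *\<^sub>R rescale \<epsilon> (c t)) $ 3 = Z2"
      "((1 / \<epsilon>) *\<^sub>R rescale \<epsilon> (c t)) $ 4 = Z3" "((1 / \<epsilon>) *\<^sub>R rescale \<epsilon> (c t)) $ 5 = Z4"
      using \<epsilon> by (simp_all add: xs power2_eq_square)
    show ?thesis
      unfolding scaled_force_def Let_def q prod.case
      unfolding q[symmetric] Qq Nq x1 Zq clipR(1,2) dHv v1 x s hs[symmetric] ..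
  qed
  \<comment> \<open>Every summand of \<open>Q\<close> contains \<open>R\<close> or
    \<open>R'\<close>, which allows a factor \<open>clip u\<close> to be traded for
    \<open>u\<close>.\<close>
  have clipQ: "clip u * Q = u * Q"
  proof -
    have "clip u * Q = 1/2 * p\<^sup>2 * ((clip u * R) * hZ + h * ((clip u * R') * u))
      - p * (p * h * ((clip u * R') * u + clip u * R) + (clip u * R) * u * (\<epsilon> * hV)) + e / s * \<epsilon>\<^sup>2 * u\<^sup>2 * (clip u * R) * h"
      unfolding Q_def P_def by (simp add: algebra_simps)
    then show ?thesis unfolding clipR(3,4) Q_def P_def by (simp add: algebra_simps)
  qed
  have d: "delta \<rho> \<epsilon> U = R / \<epsilon>" by (simp add: delta_def us)
  have d': "deriv (delta \<rho> \<epsilon>) U = R' / \<epsilon>\<^sup>2"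
    using DERIV_imp_deriv[OF has_real_derivative_delta[OF \<rho> \<epsilon>, of U]] by (simp add: us)
  have cd: "(c has_vector_derivative tder 1 c t) (at t)"
    using has_vector_derivative_tder[OF c, of 0 t] by simp
  have "((\<lambda>s. H (Zvec (c s)) * delta \<rho> \<epsilon> (c s $ 1) * c s $ 1) has_real_derivative
      (hV * (R / \<epsilon>) + R' / \<epsilon>\<^sup>2 * p * h) * U + p * (h * (R / \<epsilon>))) (at t)"
  proof -
    have 1: "((\<lambda>s. H (Zvec (c s))) has_real_derivative hV) (at t)"
      using has_real_derivative_H[OF H cd] by (simp add: dH_def hV_def hs vs)
    have 3: "((\<lambda>s. c s $ 1) has_real_derivative p) (at t)"
      unfolding vs by (rule has_real_derivative_nth[OF cd])
    have 2: "((\<lambda>s. delta \<rho> \<epsilon> (c s $ 1)) has_real_derivative R' / \<epsilon>\<^sup>2 * p) (at t)"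
      unfolding us(3) us(1) xs(1) by (rule DERIV_chain2[where g="\<lambda>s. c s $ 1", OF has_real_derivative_delta[OF \<rho> \<epsilon>] 3])
    show ?thesis
      using DERIV_mult[OF DERIV_mult[OF 1 2] 3] d by (simp add: xs hs)
  qed
  then have vd: "vector_derivative (\<lambda>s. H (Zvec (c s)) * delta \<rho> \<epsilon> (c s $ 1) * c s $ 1) (at t)
     = (hV * (R / \<epsilon>) + R' / \<epsilon>\<^sup>2 * p * h) * U + p * (h * (R / \<epsilon>))"
    by (simp add: has_real_derivative_iff_has_vector_derivative vector_derivative_at)
  have U: "U = \<epsilon> * u" using \<epsilon> by (simp add: us)
  have NU: "\<sigma> * a\<^sup>2 - U\<^sup>2 * h * (R / \<epsilon>) = N"
    unfolding N_def s U using \<epsilon> by (simp add: power2_eq_square)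
  \<comment> \<open>The factors 1/\<epsilon> of the delta net, 1/\<epsilon>^2 of its derivative and
    U = \<epsilon> u combine to a single 1/\<epsilon>.\<close>
  have \<Phi>: "e + 1/2 * p\<^sup>2 * (R / \<epsilon> * hZ + h * (R' / \<epsilon>\<^sup>2) * U)
      - p * ((hV * (R / \<epsilon>) + R' / \<epsilon>\<^sup>2 * p * h) * U + p * (h * (R / \<epsilon>))) = \<Phi>"
    unfolding \<Phi>_def P_def U using \<epsilon> by (simp add: field_simps power2_eq_square)
  have res: "residual \<sigma> a e H \<rho> \<epsilon> c t = vector [tder 2 c t $ 1 + \<Phi> * U / N,
      tder 2 c t $ 2 - 1/2 * h * (R' / \<epsilon>\<^sup>2) * p\<^sup>2 - R / \<epsilon> * p * hV + \<Phi> * (V + h * (R / \<epsilon>) * U) / N,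
      tder 2 c t $ 3 - 1/2 * h2 * (R / \<epsilon>) * p\<^sup>2 + \<Phi> * Z2 / N,
      tder 2 c t $ 4 - 1/2 * h3 * (R / \<epsilon>) * p\<^sup>2 + \<Phi> * Z3 / N,
      tder 2 c t $ 5 - \<sigma>/2 * h4 * (R / \<epsilon>) * p\<^sup>2 + \<Phi> * Z4 / N]"
    unfolding residual_def Let_def hs[symmetric] xs[symmetric] vs[symmetric] d d' vd NU hZ_def[symmetric] hV_def[symmetric] \<Phi> ..
  \<comment> \<open>Here the extra summand of \<open>Q\<close> pays off: e - (e/s) N equals e/s
    times \<epsilon> u^2 R h.\<close>
  have \<Phi>N: "\<Phi> / N = e / s + Q / (\<epsilon> * N)"
    unfolding \<Phi>_def Q_def using N0 \<open>s \<noteq> 0\<close> \<epsilon>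
    by (simp add: divide_simps) (simp add: N_def algebra_simps power2_eq_square)
  define \<phi> where "\<phi> = \<Phi> / N"
  have \<epsilon>\<phi>: "\<epsilon> * \<phi> = \<epsilon> * (e / s) + Q / N" unfolding \<phi>_def \<Phi>N using \<epsilon> by (simp add: algebra_simps)
  have i1: "p1 = - (e / s) * U + - (u * (Q / N)) + (p1 + \<phi> * U)" for p1
  proof -
    have "\<phi> * U = u * (\<epsilon> * \<phi>)" unfolding U by simp
    also have "\<dots> = e / s * U + u * (Q / N)" unfolding \<epsilon>\<phi> U by (simp add: algebra_simps)
    finally show ?thesis by simp
  qed
  \<comment> \<open>One identity for the three Z equations, with \<open>k\<close> equal to h2/2,
    h3/2 and \<sigma> h4/2.\<close>
  have i3: "\<epsilon> * p3 = - (e / s) * (\<epsilon> * Z) + (k * R * p\<^sup>2 - Z * (Q / N)) + \<epsilon> * (p3 - k * (R / \<epsilon>) * p\<^sup>2 + \<phi> * Z)" for p3 k Z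
  proof -
    have "\<epsilon> * (\<phi> * Z) = Z * (\<epsilon> * \<phi>)" by simp
    also have "\<dots> = e / s * (\<epsilon> * Z) + Z * (Q / N)" unfolding \<epsilon>\<phi> by (simp add: algebra_simps)
    finally show ?thesis using \<epsilon> by (simp add: distrib_left right_diff_distrib)
  qed
  have i2: "\<epsilon>\<^sup>2 * p2 = - (e / s) * (\<epsilon>\<^sup>2 * V) + (1/2 * h * R' * p\<^sup>2 + R * p * (\<epsilon> * hV) - e / s * \<epsilon>\<^sup>2 * h * R * u
        - Q / N * (\<epsilon> * V + \<epsilon> * h * R * u))
      + \<epsilon>\<^sup>2 * (p2 - 1/2 * h * (R' / \<epsilon>\<^sup>2) * p\<^sup>2 - R / \<epsilon> * p * hV + \<phi> * (V + h * (R / \<epsilon>) * U))" for p2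
  proof -
    have "\<epsilon>\<^sup>2 * (\<phi> * (V + h * (R / \<epsilon>) * U)) = (\<epsilon> * \<phi>) * (\<epsilon> * V + \<epsilon> * h * R * u)"
      unfolding U using \<epsilon> by (simp add: field_simps power2_eq_square)
    also have "\<dots> = e / s * (\<epsilon>\<^sup>2 * V) + e / s * \<epsilon>\<^sup>2 * h * R * u + Q / N * (\<epsilon> * V + \<epsilon> * h * R * u)"
      unfolding \<epsilon>\<phi> by (simp add: algebra_simps power2_eq_square)
    finally have 1: "\<epsilon>\<^sup>2 * (\<phi> * (V + h * (R / \<epsilon>) * U)) =
      e / s * (\<epsilon>\<^sup>2 * V) + e / s * \<epsilon>\<^sup>2 * h * R * u + Q / N * (\<epsilon> * V + \<epsilon> * h * R * u)" .
    have 2: "\<epsilon>\<^sup>2 * (1/2 * h * (R' / \<epsilon>\<^sup>2) * p\<^sup>2) = 1/2 * h * R' * p\<^sup>2" "\<epsilon>\<^sup>2 * (R / \<epsilon> * p * hV) = R * p * (\<epsilon> * hV)"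
      using \<epsilon> by (simp_all add: power2_eq_square)
    show ?thesis unfolding distrib_left[of "\<epsilon>\<^sup>2"] right_diff_distrib[of "\<epsilon>\<^sup>2"] 1[unfolded distrib_left[of "\<epsilon>\<^sup>2"]] 2 by simp
  qed
  have hRc: "e / s * \<epsilon>\<^sup>2 * h * R * clip u = e / s * \<epsilon>\<^sup>2 * h * R * u" "\<epsilon> * h * R * clip u = \<epsilon> * h * R * u"
    unfolding mult.assoc clipR2(3) by simp_all
  have cQN: "clip u * (Q / N) = u * (Q / N)" using clipQ by simp
  have \<phi>': "\<Phi> * y / N = \<phi> * y" for y by (simp add: \<phi>_def)
  show ?thesis
    unfolding fq res hRc cQN \<phi>' vec_eq_iff_5 vector_add_component vector_scaleR_component rescale_nth vector_5
      xs[symmetric] s[symmetric] real_scaleR_def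
    by (intro conjI i1 i2 i3)
qed

section \<open>The background geodesic\<close>

lemma has_real_derivative_tder_nth:
  assumes "Cinf_on UNIV (c :: real \<Rightarrow> real^5)"
  shows "((\<lambda>t. tder k c t $ i) has_real_derivative tder (Suc k) c t $ i) (at t)"
  by (rule has_real_derivative_nth[OF has_vector_derivative_tder[OF assms]])

lemma has_real_derivative_eta:
  assumes "\<And>i. ((\<lambda>t. x t $ i) has_real_derivative x' $ i) (at t)"
    "\<And>i. ((\<lambda>t. y t $ i) has_real_derivative y' $ i) (at t)"
  shows "((\<lambda>t. eta \<sigma> (x t) (y t)) has_real_derivative eta \<sigma> x' (y t) + eta \<sigma> (x t) y') (at t)"
  unfolding eta_def by (auto intro!: derivative_eq_intros assms simp: algebra_simps)

lemma eta_commute: "eta \<sigma> x y = eta \<sigma> y x"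
  by (simp add: eta_def algebra_simps)

text \<open>The position vector is \<open>eta\<close>-normal to M and its square \<sigma> a^2 is
  nonzero, so a vanishing tangential acceleration leaves only a multiple of \<open>c\<close>. The
  coefficient follows by differentiating the constant square twice and inserting the given square of
  the velocity.\<close>

lemma geodesic_equation:
  assumes geo: "geodesic_M \<sigma> a c" and sig: "\<sigma> \<in> {1, -1}" and a: "0 < a"
    and sp: "\<And>t. eta \<sigma> (tder 1 c t) (tder 1 c t) = e"
  shows "tder 2 c t = - (e / (\<sigma> * a\<^sup>2)) *\<^sub>R c t"
proof -
  define s where "s = \<sigma> * a\<^sup>2"
  have s: "s \<noteq> 0" using sig a by (auto simp: s_def)
  have c: "Cinf_on UNIV c" using geo by (simp add: geodesic_M_def)
  have d: "((\<lambda>t. tder k c t $ i) has_real_derivative tder (Suc k) c t $ i) (at t)" for k i t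
    by (rule has_real_derivative_tder_nth[OF c])
  have d0: "((\<lambda>t. c t $ i) has_real_derivative tder 1 c t $ i) (at t)" for i t
    using d[of 0 i t] by simp
  have d1: "((\<lambda>t. tder 1 c t $ i) has_real_derivative tder 2 c t $ i) (at t)" for i t
    using d[of 1 i t] by (simp add: numeral_2_eq_2)
  have cc: "eta \<sigma> (c t) (c t) = s" for t
  proof -
    have "c t \<in> Mset \<sigma> a" using geo by (simp add: geodesic_M_def)
    then show ?thesis by (simp add: Mset_def eta_def s_def power2_eq_square algebra_simps)
  qed
  have "((\<lambda>t. s) has_real_derivative 2 * eta \<sigma> (c t) (tder 1 c t)) (at t)" for t
    using has_real_derivative_eta[OF d0 d0, of \<sigma> t] unfolding cc eta_commute[of \<sigma> "tder 1 c t" "c t"] by simp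
  from DERIV_unique[OF this DERIV_const] have cc1: "eta \<sigma> (c t) (tder 1 c t) = 0" for t by simp
  have "((\<lambda>t. 0) has_real_derivative e + eta \<sigma> (c t) (tder 2 c t)) (at t)" for t
    using has_real_derivative_eta[OF d0 d1, of \<sigma> t] unfolding cc1 sp .
  from DERIV_unique[OF this DERIV_const] have cc2: "eta \<sigma> (tder 2 c t) (c t) = - e"
    by (simp add: eta_commute[of \<sigma> "tder 2 c t"] add_eq_0_iff)
  have main: "eta \<sigma> (tder 2 c t) v = - (e / s) * eta \<sigma> (c t) v" for v
  proof -
    define k where "k = eta \<sigma> (c t) v / s"
    \<comment> \<open>Removing the normal component of \<open>v\<close> gives a tangent vector, to
      which the geodesic condition applies.\<close>
    define w where "w = v - k *\<^sub>R c t"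
    have lin: "eta \<sigma> z w = eta \<sigma> z v - k * eta \<sigma> z (c t)" for z
      unfolding w_def by (simp add: eta_def algebra_simps)
    have "eta \<sigma> (c t) w = 0" unfolding lin cc using s by (simp add: k_def)
    then have "w \<in> tangent_M \<sigma> (c t)" by (simp add: tangent_M_def eta_def algebra_simps)
    then have "eta \<sigma> (tder 2 c t) w = 0" using geo by (simp add: geodesic_M_def)
    then show ?thesis unfolding lin cc2 k_def by (simp add: mult.commute)
  qed
  \<comment> \<open>\<open>eta\<close> is nondegenerate: testing with the five basis vectors
    recovers all coordinates, with U and V interchanged.\<close>
  show ?thesis
    using main[of "axis 1 1"] main[of "axis 2 1"] main[of "axis 3 1"] main[of "axis 4 1"] main[of "axis 5 1"] sig
    unfolding vec_eq_iff_5 s_def[symmetric] by (auto simp: eta_def axis_def)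
qed

text \<open>U'^2 + \<kappa> U^2 is conserved and positive at time 0. For either sign of \<kappa>
  this excludes a common zero of U and U'.\<close>

lemma geodesic_U_nondegenerate:
  fixes c :: "real \<Rightarrow> real^5"
  assumes c: "Cinf_on UNIV c" and eq: "\<And>t. tder 2 c t = - \<kappa> *\<^sub>R c t"
    and 0: "c 0 $ 1 = 0" "tder 1 c 0 $ 1 > 0"
  shows "c t $ 1 \<noteq> 0 \<or> tder 1 c t $ 1 \<noteq> 0"
proof -
  define f where "f t = (tder 1 c t $ 1)\<^sup>2 + \<kappa> * (c t $ 1)\<^sup>2" for t
  have "(f has_real_derivative 0) (at t)" for t
  proof -
    have 1: "((\<lambda>t. c t $ 1) has_real_derivative tder 1 c t $ 1) (at t)"
      using has_real_derivative_tder_nth[OF c, of 0] by simp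
    have 2: "((\<lambda>t. tder 1 c t $ 1) has_real_derivative - \<kappa> * c t $ 1) (at t)"
      using has_real_derivative_tder_nth[OF c, of 1 1 t] eq[of t] by (simp add: numeral_2_eq_2)
    show ?thesis
      unfolding f_def by (rule derivative_eq_intros 1 2 refl)+ (simp add: algebra_simps)
  qed
  then have "f t = f 0" using DERIV_isconst_all[of f] by blast
  moreover have "f 0 > 0" using 0 by (simp add: f_def)
  ultimately show ?thesis by (auto simp: f_def)
qed

text \<open>A \<open>GREATEST\<close> over the reals is meaningful only if the maximum is attained.
  Just before time 0 the component U is negative, so for small \<epsilon> the level -\<epsilon> is
  reached in [-r, 0]; the level set there is compact and does not contain 0. The outcome needed
  later is a fixed compact interval containing the initial times.\<close>

lemma alpha_in_interval:
  fixes c :: "real \<Rightarrow> real^5"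
  assumes c: "Cinf_on UNIV c" and 0: "c 0 $ 1 = 0" "tder 1 c 0 $ 1 > 0"
  shows "eventually (\<lambda>\<epsilon>. alpha c \<epsilon> \<in> {-1..1}) (at_right 0)"
proof -
  have d: "((\<lambda>t. c t $ 1) has_real_derivative tder 1 c t $ 1) (at t)" for t
    using has_real_derivative_tder_nth[OF c, of 0] by simp
  have cont: "continuous_on S (\<lambda>t. c t $ 1)" for S
    using d DERIV_isCont continuous_at_imp_continuous_on by blast
  obtain d0 where d0: "0 < d0" "\<And>h. 0 < h \<Longrightarrow> h < d0 \<Longrightarrow> c (0 - h) $ 1 < c 0 $ 1"
    using DERIV_pos_inc_left[OF d 0(2)] by blast
  define r where "r = min (d0 / 2) 1"
  have r: "0 < r" "r \<le> 1" "c (- r) $ 1 < 0" using d0(1) d0(2)[of r] 0 by (auto simp: r_def)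
  have "eventually (\<lambda>\<epsilon>. \<epsilon> \<in> {0<..<- c (- r) $ 1}) (at_right 0)"
    using r by (intro eventually_at_right_real) simp
  then show ?thesis
  proof eventually_elim
    case (elim \<epsilon>)
    define S where "S = {t \<in> {- r..0}. c t $ 1 = - \<epsilon>}"
    have "\<exists>t\<ge>- r. t \<le> 0 \<and> c t $ 1 = - \<epsilon>"
      using elim 0 r cont by (intro IVT') auto
    then have "S \<noteq> {}" by (auto simp: S_def)
    have "closed S" unfolding S_def
      by (rule continuous_closed_preimage_constant[OF cont closed_atLeastAtMost])
    moreover have "bounded S" by (rule bounded_subset[of "{- r..0}"]) (auto simp: S_def)
    ultimately have "compact S" by (simp add: compact_eq_bounded_closed)
    from compact_attains_sup[OF this \<open>S \<noteq> {}\<close>] obtain x where x: "x \<in> S" "\<And>t. t \<in> S \<Longrightarrow> t \<le> x"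
      by blast
    have "alpha c \<epsilon> = x"
      unfolding alpha_def
    proof (rule Greatest_equality)
      have "x \<noteq> 0" using x 0 elim by (auto simp: S_def)
      then show "x < 0 \<and> c x $ 1 = - \<epsilon>" using x by (auto simp: S_def)
      show "t \<le> x" if "t < 0 \<and> c t $ 1 = - \<epsilon>" for t
        using that x by (cases "- r \<le> t") (auto simp: S_def)
    qed
    then show ?case using x r by (auto simp: S_def)
  qed
qed

section \<open>Energy estimates\<close>

text \<open>One spare power of \<epsilon> absorbs the constant. Afterwards all smallness conditions
  are free of constants and can be combined at a single \<epsilon>.\<close>

lemma eventually_le_power:
  fixes f :: "real \<Rightarrow> 'a \<Rightarrow> 'b::real_normed_vector"
  assumes "\<exists>C. eventually (\<lambda>\<epsilon>. \<forall>t\<in>K. norm (f \<epsilon> t) \<le> C * \<epsilon> ^ Suc m) (at_right 0)"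
  shows "eventually (\<lambda>\<epsilon>. \<forall>t\<in>K. norm (f \<epsilon> t) \<le> \<epsilon> ^ m) (at_right 0)"
proof -
  from assms obtain C where C: "eventually (\<lambda>\<epsilon>. \<forall>t\<in>K. norm (f \<epsilon> t) \<le> C * \<epsilon> ^ Suc m) (at_right 0)" ..
  have "0 < 1 / (\<bar>C\<bar> + 1)" by simp
  from C eventually_at_right_real[OF this] show ?thesis
  proof eventually_elim
    case (elim \<epsilon>)
    then have "C * \<epsilon> \<le> (\<bar>C\<bar> + 1) * \<epsilon>" by (intro mult_right_mono) auto
    moreover have "(\<bar>C\<bar> + 1) * \<epsilon> \<le> 1" using elim(2) by (simp add: pos_less_divide_eq mult.commute)
    ultimately have "C * \<epsilon> \<le> 1" by linarith
    then have "C * \<epsilon> * \<epsilon> ^ m \<le> 1 * \<epsilon> ^ m" using elim by (intro mult_right_mono) auto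
    then show ?case using elim(1) by (auto simp: mult.assoc intro: order_trans)
  qed
qed

text \<open>The floor n^2 makes the differential inequality homogeneous: error terms of size
  \<open>n\<close> are at most the square root of the energy.\<close>

definition energy :: "real \<Rightarrow> real \<Rightarrow> (real \<Rightarrow> real^5) \<Rightarrow> (real \<Rightarrow> real^5) \<Rightarrow> real \<Rightarrow> real" where
  "energy n \<epsilon> c b t = (norm (rescale \<epsilon> (c t - b t)))\<^sup>2 + (norm (rescale \<epsilon> (tder 1 c t - tder 1 b t)))\<^sup>2 + n\<^sup>2"

lemma energy_bounds:
  shows energy_nonneg: "0 \<le> energy n \<epsilon> c b t"
    and energy_ge: "norm (rescale \<epsilon> (c t - b t)) \<le> sqrt (energy n \<epsilon> c b t)"
      "norm (rescale \<epsilon> (tder 1 c t - tder 1 b t)) \<le> sqrt (energy n \<epsilon> c b t)"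
      "n \<le> sqrt (energy n \<epsilon> c b t)"
  by (auto simp: energy_def intro!: real_le_rsqrt)

definition energy_deriv :: "real \<Rightarrow> (real \<Rightarrow> real^5) \<Rightarrow> (real \<Rightarrow> real^5) \<Rightarrow> real \<Rightarrow> real" where
  "energy_deriv \<epsilon> c b t = 2 * (rescale \<epsilon> (c t - b t) \<bullet> rescale \<epsilon> (tder 1 c t - tder 1 b t))
    + 2 * (rescale \<epsilon> (tder 1 c t - tder 1 b t) \<bullet> rescale \<epsilon> (tder 2 c t - tder 2 b t))"

lemma has_real_derivative_norm_power2:
  fixes x :: "real \<Rightarrow> 'a::real_inner"
  assumes "(x has_vector_derivative x') (at t)"
  shows "((\<lambda>t. (norm (x t))\<^sup>2) has_real_derivative 2 * (x t \<bullet> x')) (at t)"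
proof -
  have "((\<lambda>t. x t \<bullet> x t) has_derivative (\<lambda>h. x t \<bullet> (h *\<^sub>R x') + (h *\<^sub>R x') \<bullet> x t)) (at t)"
    using assms unfolding has_vector_derivative_def by (intro has_derivative_inner)
  then show ?thesis
    unfolding power2_norm_eq_inner has_field_derivative_def
    by (rule has_derivative_eq_rhs) (simp add: fun_eq_iff inner_commute algebra_simps)
qed

lemma has_real_derivative_energy:
  assumes c: "Cinf_on UNIV c" and b: "Cinf_on UNIV b"
  shows "(energy n \<epsilon> c b has_real_derivative energy_deriv \<epsilon> c b t) (at t)"
proof -
  have d: "((\<lambda>t. rescale \<epsilon> (tder k c t - tder k b t)) has_vector_derivative
      rescale \<epsilon> (tder (Suc k) c t - tder (Suc k) b t)) (at t)" for k
    by (intro has_vector_derivative_rescale has_vector_derivative_diff has_vector_derivative_tder c b)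
  have "((\<lambda>t. (norm (rescale \<epsilon> (tder 0 c t - tder 0 b t)))\<^sup>2 + (norm (rescale \<epsilon> (tder 1 c t - tder 1 b t)))\<^sup>2 + n\<^sup>2)
     has_real_derivative 2 * (rescale \<epsilon> (tder 0 c t - tder 0 b t) \<bullet> rescale \<epsilon> (tder (Suc 0) c t - tder (Suc 0) b t))
    + 2 * (rescale \<epsilon> (tder 1 c t - tder 1 b t) \<bullet> rescale \<epsilon> (tder (Suc 1) c t - tder (Suc 1) b t)) + 0) (at t)"
    by (intro DERIV_add has_real_derivative_norm_power2 d DERIV_const)
  then show ?thesis
    unfolding energy_def[abs_def] energy_deriv_def by (simp add: numeral_2_eq_2)
qed

text \<open>By Cauchy-Schwarz the second derivative occurs only next to a factor at most sqrt y, so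
  a bound linear in sqrt y becomes one linear in y. W >= 1 lets the term without weight be absorbed
  as well.\<close>

lemma energy_deriv_le:
  assumes M: "0 \<le> M" and W: "1 \<le> W"
    and le: "norm (rescale \<epsilon> (tder 2 c t - tder 2 b t)) \<le> M * W * sqrt (energy n \<epsilon> c b t)"
  shows "\<bar>energy_deriv \<epsilon> c b t\<bar> \<le> (1 + 2 * M) * W * energy n \<epsilon> c b t"
proof -
  define X X' X'' y where [simp]: "X = rescale \<epsilon> (c t - b t)" "X' = rescale \<epsilon> (tder 1 c t - tder 1 b t)"
    "X'' = rescale \<epsilon> (tder 2 c t - tder 2 b t)" "y = energy n \<epsilon> c b t"
  have y: "0 \<le> y" by (simp add: energy_nonneg)
  have "\<bar>2 * (X \<bullet> X')\<bar> \<le> 2 * (norm X * norm X')"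
    using Cauchy_Schwarz_ineq2[of X X'] by (simp add: abs_mult)
  also have "\<dots> \<le> (norm X)\<^sup>2 + (norm X')\<^sup>2"
    using sum_squares_bound[of "norm X" "norm X'"] by simp
  also have "\<dots> \<le> y" by (simp add: energy_def)
  also have "\<dots> \<le> W * y" using W y by (simp add: mult_le_cancel_right1)
  finally have 1: "\<bar>2 * (X \<bullet> X')\<bar> \<le> W * y" .
  have "\<bar>2 * (X' \<bullet> X'')\<bar> \<le> 2 * (norm X' * norm X'')"
    using Cauchy_Schwarz_ineq2[of X' X''] by (simp add: abs_mult)
  also have "\<dots> \<le> 2 * (sqrt y * (M * W * sqrt y))"
    using le energy_ge(2)[of \<epsilon> c t b n] y by (intro mult_left_mono mult_mono) auto
  also have "\<dots> = 2 * M * W * (sqrt y * sqrt y)" by (simp only: mult_ac)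
  also have "\<dots> = 2 * M * W * y" using y by simp
  finally have "\<bar>2 * (X' \<bullet> X'')\<bar> \<le> 2 * M * W * y" .
  with 1 have "\<bar>2 * (X \<bullet> X') + 2 * (X' \<bullet> X'')\<bar> \<le> W * y + 2 * M * W * y" by linarith
  also have "\<dots> = (1 + 2 * M) * W * y" by (simp add: algebra_simps)
  finally show ?thesis by (simp add: energy_deriv_def)
qed

definition state :: "real \<Rightarrow> (real \<Rightarrow> real^5) \<Rightarrow> real \<Rightarrow> real \<times> (real^5) \<times> (real^5)" where
  "state \<epsilon> c t = (\<epsilon>, (1 / \<epsilon>) *\<^sub>R rescale \<epsilon> (c t), rescale \<epsilon> (tder 1 c t))"

text \<open>The division of the position by \<epsilon> is the place where a uniform Lipschitz bound
  in the state turns into the constant 1/\<epsilon> in X.\<close>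

lemma dist_state_le:
  "0 < \<epsilon> \<Longrightarrow> dist (state \<epsilon> c t) (state \<epsilon> b t) \<le>
    norm (rescale \<epsilon> (c t - b t)) / \<epsilon> + norm (rescale \<epsilon> (tder 1 c t - tder 1 b t))"
proof -
  assume "0 < \<epsilon>"
  have "state \<epsilon> c t - state \<epsilon> b t =
    (0, (1 / \<epsilon>) *\<^sub>R rescale \<epsilon> (c t - b t), rescale \<epsilon> (tder 1 c t - tder 1 b t))"
    by (simp add: state_def rescale_diff scaleR_diff_right)
  note eq = this
  have "dist (state \<epsilon> c t) (state \<epsilon> b t) \<le> norm (0::real) +
      (norm ((1 / \<epsilon>) *\<^sub>R rescale \<epsilon> (c t - b t)) + norm (rescale \<epsilon> (tder 1 c t - tder 1 b t)))"
    unfolding dist_norm eq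
    using norm_Pair_le[of "0::real" "((1 / \<epsilon>) *\<^sub>R rescale \<epsilon> (c t - b t), rescale \<epsilon> (tder 1 c t - tder 1 b t))"]
      norm_Pair_le[of "(1 / \<epsilon>) *\<^sub>R rescale \<epsilon> (c t - b t)" "rescale \<epsilon> (tder 1 c t - tder 1 b t)"]
    by linarith
  then show ?thesis using \<open>0 < \<epsilon>\<close> by simp
qed

text \<open>The position bound will come from c-boundedness, which has no counterpart for
  velocities. Those are read off from the energy: the rescaled velocity stays within distance 1 of
  the rescaled background velocity.\<close>

lemma state_in_state_set:
  assumes \<epsilon>: "0 < \<epsilon>" "\<epsilon> \<le> E" "E \<le> 1" and en: "energy n \<epsilon> c b t \<le> 1"
    and bd: "norm (c t) \<le> L" "norm (tder 1 b t) \<le> M" and R: "L + M + 1 \<le> R"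
  shows "state \<epsilon> c t \<in> state_set E R"
proof -
  have comp: "\<bar>c t $ i\<bar> \<le> L" for i
    using component_le_norm_cart[of "c t" i] bd(1) by linarith
  have LM: "0 \<le> L" "0 \<le> M" using bd norm_ge_zero order_trans by blast+
  have "norm (rescale \<epsilon> (tder 1 c t)) \<le> norm (rescale \<epsilon> (tder 1 c t - tder 1 b t)) + norm (rescale \<epsilon> (tder 1 b t))"
    unfolding rescale_diff using norm_triangle_ineq[of "rescale \<epsilon> (tder 1 c t) - rescale \<epsilon> (tder 1 b t)" "rescale \<epsilon> (tder 1 b t)"]
    by simp
  also have "\<dots> \<le> sqrt (energy n \<epsilon> c b t) + norm (tder 1 b t)"
    using energy_ge(2) norm_rescale_le[of \<epsilon>] \<epsilon> by (intro add_mono) auto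
  also have "\<dots> \<le> 1 + M" using en bd by (intro add_mono) auto
  finally have 1: "norm (rescale \<epsilon> (tder 1 c t)) \<le> R" using R LM by linarith
  have "\<bar>\<epsilon> * c t $ 2\<bar> \<le> 1 * L"
    unfolding abs_mult using \<epsilon> comp by (intro mult_mono) auto
  then have "\<forall>i. i \<noteq> 1 \<longrightarrow> \<bar>((1 / \<epsilon>) *\<^sub>R rescale \<epsilon> (c t)) $ i\<bar> \<le> L"
    unfolding forall_5 using \<epsilon> comp by (auto simp: power2_eq_square)
  then have "\<forall>i. i \<noteq> 1 \<longrightarrow> \<bar>((1 / \<epsilon>) *\<^sub>R rescale \<epsilon> (c t)) $ i\<bar> \<le> R"
    using R LM by force
  with 1 \<epsilon> show ?thesis by (simp add: state_def state_set_def)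
qed

text \<open>U is the one coordinate that is not scaled, so the energy controls it and its derivative
  without loss.\<close>

lemma C1_near_of_energy:
  assumes c: "Cinf_on UNIV c" and \<delta>: "0 \<le> \<delta>" and en: "\<And>t. t \<in> S \<Longrightarrow> energy n \<epsilon> c b t \<le> \<delta>\<^sup>2"
  shows "C1_near (\<lambda>t. b t $ 1) (\<lambda>t. tder 1 b t $ 1) \<delta> (\<lambda>t. c t $ 1) (\<lambda>t. tder 1 c t $ 1) S"
  unfolding C1_near_def
proof (intro ballI conjI)
  fix t assume "t \<in> S"
  then have e: "sqrt (energy n \<epsilon> c b t) \<le> \<delta>" using en \<delta> by (simp add: real_le_lsqrt)
  show "((\<lambda>t. c t $ 1) has_real_derivative tder 1 c t $ 1) (at t)"
    using has_real_derivative_tder_nth[OF c, of 0] by simp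
  show "\<bar>c t $ 1 - b t $ 1\<bar> \<le> \<delta>"
    using component_le_norm_cart[of "rescale \<epsilon> (c t - b t)" 1] energy_ge(1)[of \<epsilon> c t b n] e by simp
  show "\<bar>tder 1 c t $ 1 - tder 1 b t $ 1\<bar> \<le> \<delta>"
    using component_le_norm_cart[of "rescale \<epsilon> (tder 1 c t - tder 1 b t)" 1] energy_ge(2)[of \<epsilon> c t b n] e by simp
qed

lemma growth_bound_energy:
  assumes gb: "growth_bound g g' C \<delta> K (- T) T" and K: "1 \<le> K" and \<epsilon>: "0 < \<epsilon>" "\<epsilon> \<le> 1"
    and c: "Cinf_on UNIV c" and b: "Cinf_on UNIV b"
    and \<alpha>: "\<alpha> \<in> {- T..T}" and t: "t \<in> {- T..T}"
    and f: "C1_near g g' \<delta> f f' (closed_segment \<alpha> t)" and h: "C1_near g g' \<delta> h h' (closed_segment \<alpha> t)"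
    and y: "\<And>s. s \<in> closed_segment \<alpha> t \<Longrightarrow>
      \<bar>energy_deriv \<epsilon> c b s\<bar> \<le> C * (1 + delta_weight \<epsilon> (f s) + delta_weight \<epsilon> (h s)) * energy n \<epsilon> c b s"
  shows "energy n \<epsilon> c b t \<le> K * energy n \<epsilon> c b \<alpha>"
proof -
  have seg: "closed_segment \<alpha> t = {min \<alpha> t..max \<alpha> t}"
    by (auto simp: closed_segment_eq_real_ivl)
  have "delta_growth C \<epsilon> f h (energy n \<epsilon> c b) (energy_deriv \<epsilon> c b) {min \<alpha> t..max \<alpha> t}"
    unfolding delta_growth_def seg[symmetric]
    by (intro ballI conjI has_real_derivative_energy[OF c b] energy_nonneg y)
  moreover have "- T \<le> min \<alpha> t" "min \<alpha> t \<le> max \<alpha> t" "max \<alpha> t \<le> T" using \<alpha> t by auto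
  ultimately have "energy n \<epsilon> c b (max \<alpha> t) \<le> K * energy n \<epsilon> c b (min \<alpha> t) \<and>
      energy n \<epsilon> c b (min \<alpha> t) \<le> K * energy n \<epsilon> c b (max \<alpha> t)"
    using gb[unfolded growth_bound_def, rule_format, OF \<epsilon> _ _ _ f[unfolded seg] h[unfolded seg]] by blast
  then show ?thesis by (auto simp: max_def min_def split: if_splits)
qed

section \<open>The two comparison estimates\<close>

context
  fixes \<sigma> a e \<kappa> E R F :: real and H :: "real^3 \<Rightarrow> real" and \<rho> :: "real \<Rightarrow> real" and gm :: "real \<Rightarrow> real^5"
  assumes sig: "\<sigma> \<in> {1, -1}" and a: "0 < a" and H: "Cinf_on UNIV H" and \<rho>: "Cinf_on UNIV \<rho>"
    and supp: "closure {x. \<rho> x \<noteq> 0} \<subseteq> {-1..1}"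
    and gm: "Cinf_on UNIV gm" and gm_eq: "\<And>t. tder 2 gm t = - \<kappa> *\<^sub>R gm t"
    and \<kappa>: "\<kappa> = e / (\<sigma> * a\<^sup>2)" and E: "E \<le> 1"
    and N: "\<And>q. q \<in> state_set E R \<Longrightarrow> scaled_N \<sigma> a H \<rho> q \<noteq> 0"
    and F: "0 \<le> F" "\<And>q. q \<in> state_set E R \<Longrightarrow> norm (scaled_force \<sigma> a e H \<rho> q) \<le> F"
      "\<And>q q'. q \<in> state_set E R \<Longrightarrow> q' \<in> state_set E R \<Longrightarrow>
        norm (scaled_force \<sigma> a e H \<rho> q - scaled_force \<sigma> a e H \<rho> q') \<le> F * dist q q'"
begin

lemma scaled_equation:
  assumes "0 < \<epsilon>" "Cinf_on UNIV c" "state \<epsilon> c t \<in> state_set E R"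
  shows "rescale \<epsilon> (tder 2 c t) = - \<kappa> *\<^sub>R rescale \<epsilon> (c t) + scaled_force \<sigma> a e H \<rho> (state \<epsilon> c t)
    + rescale \<epsilon> (residual \<sigma> a e H \<rho> \<epsilon> c t)"
  unfolding \<kappa> by (rule scaled_residual[OF sig a H \<rho> supp assms(2,1) state_def N[OF assms(3)]])

lemma scaled_force_state_outside:
  assumes "0 < \<epsilon>" "\<epsilon> < \<bar>c t $ 1\<bar>"
  shows "scaled_force \<sigma> a e H \<rho> (state \<epsilon> c t) = 0"
  unfolding state_def by (rule scaled_force_outside[OF supp]) (use assms in \<open>simp add: abs_mult\<close>)

text \<open>The growth bound demands closeness to the background on the whole segment, which is what
  the continuation hypothesis supplies; it returns K times the initial energy, strictly below the
  threshold. A threshold of at most 1 also keeps the state in \<open>state_set\<close>.\<close>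

lemma bootstrap_near:
  assumes \<epsilon>: "0 < \<epsilon>" "\<epsilon> \<le> E" and c: "Cinf_on UNIV c"
    and gb: "growth_bound (\<lambda>t. gm t $ 1) (\<lambda>t. tder 1 gm t $ 1) (1 + 2 * (\<bar>\<kappa>\<bar> + 2 * F + 1)) \<delta> K (- T) T"
    and K: "1 \<le> K" and \<delta>: "0 < \<delta>'" "\<delta>' \<le> \<delta>" "\<delta>' \<le> 1"
    and bd: "\<And>t. t \<in> {- T..T} \<Longrightarrow> norm (c t) \<le> L" "\<And>t. t \<in> {- T..T} \<Longrightarrow> norm (tder 1 gm t) \<le> M" "L + M + 1 \<le> R"
    and res: "\<And>t. t \<in> {- T..T} \<Longrightarrow> norm (residual \<sigma> a e H \<rho> \<epsilon> c t) \<le> \<epsilon>"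
    and \<alpha>: "\<alpha> \<in> {- T..T}" and init: "K * energy \<epsilon> \<epsilon> c gm \<alpha> < \<delta>'\<^sup>2"
    and t: "t \<in> {- T..T}"
  shows "energy \<epsilon> \<epsilon> c gm t < \<delta>'\<^sup>2"
proof (rule bootstrap_closed_segment[OF _ \<alpha> _ _ t])
  have "energy \<epsilon> \<epsilon> c gm \<alpha> \<le> K * energy \<epsilon> \<epsilon> c gm \<alpha>"
    using K energy_nonneg[of \<epsilon> \<epsilon> c gm \<alpha>] by (simp add: mult_le_cancel_right1)
  with init show "energy \<epsilon> \<epsilon> c gm \<alpha> < \<delta>'\<^sup>2" by linarith
  show "continuous_on {- T..T} (energy \<epsilon> \<epsilon> c gm)"
    using has_real_derivative_energy[OF c gm] DERIV_isCont continuous_at_imp_continuous_on by blast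
  fix t assume t: "t \<in> {- T..T}" and small: "\<And>s. s \<in> closed_segment \<alpha> t \<Longrightarrow> energy \<epsilon> \<epsilon> c gm s \<le> \<delta>'\<^sup>2"
  have seg: "closed_segment \<alpha> t \<subseteq> {- T..T}"
    using \<alpha> t by (auto simp: closed_segment_eq_real_ivl split: if_splits)
  have "\<delta>'\<^sup>2 \<le> 1" using \<delta> by (simp add: power_le_one)
  have near: "C1_near (\<lambda>t. gm t $ 1) (\<lambda>t. tder 1 gm t $ 1) \<delta> (\<lambda>t. c t $ 1) (\<lambda>t. tder 1 c t $ 1) (closed_segment \<alpha> t)"
    by (rule C1_near_mono[OF C1_near_of_energy[OF c _ small]]) (use \<delta> in auto)
  have "energy \<epsilon> \<epsilon> c gm t \<le> K * energy \<epsilon> \<epsilon> c gm \<alpha>"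
  proof (rule growth_bound_energy[OF gb K _ _ c gm \<alpha> t near near])
    show "0 < \<epsilon>" "\<epsilon> \<le> 1" using \<epsilon> E by auto
    fix s assume s: "s \<in> closed_segment \<alpha> t"
    then have sT: "s \<in> {- T..T}" using seg by blast
    define y where "y = energy \<epsilon> \<epsilon> c gm s"
    define l where "l = delta_weight \<epsilon> (c s $ 1)"
    have l: "0 \<le> l" unfolding l_def by (rule delta_weight_nonneg[OF \<epsilon>(1)])
    have st: "state \<epsilon> c s \<in> state_set E R"
      using small[OF s] \<open>\<delta>'\<^sup>2 \<le> 1\<close> by (intro state_in_state_set[where c=c and t=s and b=gm and n=\<epsilon>, OF \<epsilon> E _ bd(1)[OF sT] bd(2)[OF sT] bd(3)]) auto
    have sy: "norm (rescale \<epsilon> (c s - gm s)) \<le> sqrt y" "\<epsilon> \<le> sqrt y" "0 \<le> sqrt y"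
      unfolding y_def by (rule energy_ge real_sqrt_ge_zero energy_nonneg)+
    have W: "sqrt y \<le> (1 + l + l) * sqrt y" "l * sqrt y \<le> (1 + l + l) * sqrt y"
      using l sy(3) by (auto intro!: mult_right_mono simp: mult_le_cancel_right1)
    have force: "norm (scaled_force \<sigma> a e H \<rho> (state \<epsilon> c s)) \<le> 2 * F * (l * sqrt y)"
    proof (cases "\<epsilon> < \<bar>c s $ 1\<bar>")
      case True
      then show ?thesis using scaled_force_state_outside[OF \<epsilon>(1)] F(1) l sy(3) by simp
    next
      case False
      then have "1 / \<epsilon> \<le> 2 * l" unfolding l_def by (intro delta_weight_ge \<epsilon>) simp
      \<comment> \<open>The floor \<epsilon> <= sqrt y turns the mere bound \<open>F\<close> on the
        force into a multiple of l sqrt y.\<close>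
      then have "1 \<le> 2 * (l * \<epsilon>)" using \<epsilon> by (simp add: field_simps)
      also have "\<dots> \<le> 2 * (l * sqrt y)" using l sy by (intro mult_left_mono) auto
      finally have "F * 1 \<le> F * (2 * (l * sqrt y))" using F(1) by (intro mult_left_mono)
      then show ?thesis using F(2)[OF st] by simp
    qed
    \<comment> \<open>The background contributes only its linear term, so the whole force of
      \<open>c\<close> remains in the difference.\<close>
    have "rescale \<epsilon> (tder 2 c s - tder 2 gm s) = - \<kappa> *\<^sub>R rescale \<epsilon> (c s - gm s)
        + scaled_force \<sigma> a e H \<rho> (state \<epsilon> c s) + rescale \<epsilon> (residual \<sigma> a e H \<rho> \<epsilon> c s)"
      unfolding rescale_diff scaled_equation[OF \<epsilon>(1) c st] gm_eq linear_cmul[OF linear_rescale, of \<epsilon> "- \<kappa>"]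
      by (simp add: algebra_simps)
    then have "norm (rescale \<epsilon> (tder 2 c s - tder 2 gm s)) \<le> norm (- \<kappa> *\<^sub>R rescale \<epsilon> (c s - gm s))
        + norm (scaled_force \<sigma> a e H \<rho> (state \<epsilon> c s)) + norm (rescale \<epsilon> (residual \<sigma> a e H \<rho> \<epsilon> c s))"
      by (simp only:) (intro norm_triangle_mono order_refl)
    also have "\<dots> \<le> \<bar>\<kappa>\<bar> * sqrt y + 2 * F * (l * sqrt y) + sqrt y"
    proof (intro add_mono force)
      show "norm (- \<kappa> *\<^sub>R rescale \<epsilon> (c s - gm s)) \<le> \<bar>\<kappa>\<bar> * sqrt y"
        using sy(1) by (simp add: mult_left_mono)
      show "norm (rescale \<epsilon> (residual \<sigma> a e H \<rho> \<epsilon> c s)) \<le> sqrt y"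
        using norm_rescale_le[of \<epsilon> "residual \<sigma> a e H \<rho> \<epsilon> c s"] res[OF sT] \<epsilon> E sy(2) by linarith
    qed
    also have "\<dots> \<le> \<bar>\<kappa>\<bar> * ((1 + l + l) * sqrt y) + 2 * F * ((1 + l + l) * sqrt y) + (1 + l + l) * sqrt y"
      using W F(1) by (intro add_mono mult_left_mono) auto
    also have "\<dots> = (\<bar>\<kappa>\<bar> + 2 * F + 1) * (1 + l + l) * sqrt y" by (simp add: algebra_simps)
    finally show "\<bar>energy_deriv \<epsilon> c gm s\<bar> \<le> (1 + 2 * (\<bar>\<kappa>\<bar> + 2 * F + 1)) *
        (1 + delta_weight \<epsilon> (c s $ 1) + delta_weight \<epsilon> (c s $ 1)) * energy \<epsilon> \<epsilon> c gm s"
      unfolding y_def l_def[symmetric] using F(1) l by (intro energy_deriv_le) auto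
  qed
  with init show "energy \<epsilon> \<epsilon> c gm t < \<delta>'\<^sup>2" by linarith
qed

text \<open>With both curves known to stay near the background, the forces can be compared through
  their Lipschitz constant, and the floor \<open>n\<close> may be as small as the residuals. The
  factor \<open>K\<close> depends neither on \<epsilon> nor on \<open>n\<close>.\<close>

lemma difference_bound:
  assumes \<epsilon>: "0 < \<epsilon>" "\<epsilon> \<le> E" and c: "Cinf_on UNIV c" and b: "Cinf_on UNIV b"
    and gb: "growth_bound (\<lambda>t. gm t $ 1) (\<lambda>t. tder 1 gm t $ 1) (1 + 2 * (\<bar>\<kappa>\<bar> + 4 * F + 2)) \<delta> K (- T) T"
    and K: "1 \<le> K" and \<delta>: "0 \<le> \<delta>" "\<delta> \<le> 1"
    and bd: "\<And>t. t \<in> {- T..T} \<Longrightarrow> norm (c t) \<le> L" "\<And>t. t \<in> {- T..T} \<Longrightarrow> norm (b t) \<le> L"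
      "\<And>t. t \<in> {- T..T} \<Longrightarrow> norm (tder 1 gm t) \<le> M" "L + M + 1 \<le> R"
    and near: "\<And>t. t \<in> {- T..T} \<Longrightarrow> energy \<epsilon> \<epsilon> c gm t \<le> \<delta>\<^sup>2" "\<And>t. t \<in> {- T..T} \<Longrightarrow> energy \<epsilon> \<epsilon> b gm t \<le> \<delta>\<^sup>2"
    and res: "\<And>t. t \<in> {- T..T} \<Longrightarrow> norm (residual \<sigma> a e H \<rho> \<epsilon> c t) \<le> n"
      "\<And>t. t \<in> {- T..T} \<Longrightarrow> norm (residual \<sigma> a e H \<rho> \<epsilon> b t) \<le> n"
    and \<alpha>: "\<alpha> \<in> {- T..T}"
    and t: "t \<in> {- T..T}"
  shows "energy n \<epsilon> c b t \<le> K * energy n \<epsilon> c b \<alpha>"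
proof (rule growth_bound_energy[OF gb K _ _ c b \<alpha> t])
  show "0 < \<epsilon>" "\<epsilon> \<le> 1" using \<epsilon> E by auto
  have seg: "closed_segment \<alpha> t \<subseteq> {- T..T}"
    using \<alpha> t by (auto simp: closed_segment_eq_real_ivl split: if_splits)
  have "\<delta>\<^sup>2 \<le> 1" using \<delta> by (simp add: power_le_one)
  show "C1_near (\<lambda>t. gm t $ 1) (\<lambda>t. tder 1 gm t $ 1) \<delta> (\<lambda>t. c t $ 1) (\<lambda>t. tder 1 c t $ 1) (closed_segment \<alpha> t)"
    by (rule C1_near_of_energy[OF c \<delta>(1)]) (use seg near in blast)
  show "C1_near (\<lambda>t. gm t $ 1) (\<lambda>t. tder 1 gm t $ 1) \<delta> (\<lambda>t. b t $ 1) (\<lambda>t. tder 1 b t $ 1) (closed_segment \<alpha> t)"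
    by (rule C1_near_of_energy[OF b \<delta>(1)]) (use seg near in blast)
  fix s assume "s \<in> closed_segment \<alpha> t"
  then have sT: "s \<in> {- T..T}" using seg by blast
  define y where "y = energy n \<epsilon> c b s"
  define l where "l = delta_weight \<epsilon> (c s $ 1)"
  define l' where "l' = delta_weight \<epsilon> (b s $ 1)"
  have l: "0 \<le> l" "0 \<le> l'" unfolding l_def l'_def by (rule delta_weight_nonneg[OF \<epsilon>(1)])+
  have st: "state \<epsilon> c s \<in> state_set E R" 
    using near(1)[OF sT] \<open>\<delta>\<^sup>2 \<le> 1\<close>
    by (intro state_in_state_set[where c=c and t=s and b=gm and n=\<epsilon>, OF \<epsilon> E _ bd(1)[OF sT] bd(3)[OF sT] bd(4)]) auto
  have st': "state \<epsilon> b s \<in> state_set E R"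
    using near(2)[OF sT] \<open>\<delta>\<^sup>2 \<le> 1\<close>
    by (intro state_in_state_set[where c=b and t=s and b=gm and n=\<epsilon>, OF \<epsilon> E _ bd(2)[OF sT] bd(3)[OF sT] bd(4)]) auto
  have sy: "norm (rescale \<epsilon> (c s - b s)) \<le> sqrt y" "norm (rescale \<epsilon> (tder 1 c s - tder 1 b s)) \<le> sqrt y"
      "n \<le> sqrt y" "0 \<le> sqrt y"
    unfolding y_def by (rule energy_ge real_sqrt_ge_zero energy_nonneg)+
  have W: "sqrt y \<le> (1 + l + l') * sqrt y" "(l + l') * sqrt y \<le> (1 + l + l') * sqrt y"
    using l sy(4) by (auto intro!: mult_right_mono simp: mult_le_cancel_right1)
  define D where "D = scaled_force \<sigma> a e H \<rho> (state \<epsilon> c s) - scaled_force \<sigma> a e H \<rho> (state \<epsilon> b s)"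
  have force: "norm D \<le> 4 * F * ((l + l') * sqrt y)"
  \<comment> \<open>If both curves are outside the strip the forces vanish; if either is inside,
    1/\<epsilon> <= 2 (l + l'). The states are at distance at most 2 sqrt y / \<epsilon>, with the
    velocity part enlarged by 1 <= 1/\<epsilon>, whence the constant 4 F.\<close>
  proof (cases "\<epsilon> < \<bar>c s $ 1\<bar> \<and> \<epsilon> < \<bar>b s $ 1\<bar>")
    case True
    then show ?thesis unfolding D_def using scaled_force_state_outside[OF \<epsilon>(1)] F(1) l sy(4) by simp
  next
    case False
    then have "1 / \<epsilon> \<le> 2 * l \<or> 1 / \<epsilon> \<le> 2 * l'"
      unfolding l_def l'_def
    using delta_weight_ge[OF \<epsilon>(1), of "c s $ 1"] delta_weight_ge[OF \<epsilon>(1), of "b s $ 1"] by linarith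
    then have ll: "1 / \<epsilon> \<le> 2 * (l + l')" using l by auto
    have "1 \<le> 1 / \<epsilon>" using \<epsilon> E by simp
    have "dist (state \<epsilon> c s) (state \<epsilon> b s) \<le> norm (rescale \<epsilon> (c s - b s)) / \<epsilon> + norm (rescale \<epsilon> (tder 1 c s - tder 1 b s))"
      by (rule dist_state_le[OF \<epsilon>(1)])
    also have "\<dots> \<le> sqrt y / \<epsilon> + sqrt y" using sy \<epsilon> by (intro add_mono divide_right_mono) auto
    also have "\<dots> \<le> 1 / \<epsilon> * sqrt y + 1 / \<epsilon> * sqrt y"
      using mult_right_mono[OF \<open>1 \<le> 1 / \<epsilon>\<close> sy(4)] by simp
    also have "\<dots> \<le> 2 * (l + l') * sqrt y + 2 * (l + l') * sqrt y"
      using ll sy(4) by (intro add_mono mult_right_mono)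
    finally have "dist (state \<epsilon> c s) (state \<epsilon> b s) \<le> 4 * ((l + l') * sqrt y)"
      by (simp add: algebra_simps)
    then have "F * dist (state \<epsilon> c s) (state \<epsilon> b s) \<le> F * (4 * ((l + l') * sqrt y))"
      using F(1) by (intro mult_left_mono)
    with F(3)[OF st st'] show ?thesis unfolding D_def by simp
  qed
  have "rescale \<epsilon> (tder 2 c s - tder 2 b s) = - \<kappa> *\<^sub>R rescale \<epsilon> (c s - b s) + D
      + (rescale \<epsilon> (residual \<sigma> a e H \<rho> \<epsilon> c s) - rescale \<epsilon> (residual \<sigma> a e H \<rho> \<epsilon> b s))"
    unfolding rescale_diff scaled_equation[OF \<epsilon>(1) c st] scaled_equation[OF \<epsilon>(1) b st'] D_def
    by (simp add: algebra_simps)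
  then have "norm (rescale \<epsilon> (tder 2 c s - tder 2 b s)) \<le> norm (- \<kappa> *\<^sub>R rescale \<epsilon> (c s - b s)) + norm D
      + norm (rescale \<epsilon> (residual \<sigma> a e H \<rho> \<epsilon> c s) - rescale \<epsilon> (residual \<sigma> a e H \<rho> \<epsilon> b s))"
    by (simp only:) (intro norm_triangle_mono order_refl)
  also have "\<dots> \<le> \<bar>\<kappa>\<bar> * sqrt y + 4 * F * ((l + l') * sqrt y) + 2 * sqrt y"
  proof (intro add_mono force)
    show "norm (- \<kappa> *\<^sub>R rescale \<epsilon> (c s - b s)) \<le> \<bar>\<kappa>\<bar> * sqrt y"
      using sy(1) by (simp add: mult_left_mono)
    show "norm (rescale \<epsilon> (residual \<sigma> a e H \<rho> \<epsilon> c s) - rescale \<epsilon> (residual \<sigma> a e H \<rho> \<epsilon> b s)) \<le> 2 * sqrt y"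
      using norm_triangle_ineq4[of "rescale \<epsilon> (residual \<sigma> a e H \<rho> \<epsilon> c s)" "rescale \<epsilon> (residual \<sigma> a e H \<rho> \<epsilon> b s)"]
        norm_rescale_le[of \<epsilon> "residual \<sigma> a e H \<rho> \<epsilon> c s"] norm_rescale_le[of \<epsilon> "residual \<sigma> a e H \<rho> \<epsilon> b s"]
        res[OF sT] \<epsilon> E sy(3) by linarith
  qed
  also have "\<dots> \<le> \<bar>\<kappa>\<bar> * ((1 + l + l') * sqrt y) + 4 * F * ((1 + l + l') * sqrt y) + 2 * ((1 + l + l') * sqrt y)"
    using W F(1) by (intro add_mono mult_left_mono) auto
  also have "\<dots> = (\<bar>\<kappa>\<bar> + 4 * F + 2) * (1 + l + l') * sqrt y" by (simp add: algebra_simps)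
  finally show "\<bar>energy_deriv \<epsilon> c b s\<bar> \<le> (1 + 2 * (\<bar>\<kappa>\<bar> + 4 * F + 2)) *
      (1 + delta_weight \<epsilon> (c s $ 1) + delta_weight \<epsilon> (b s $ 1)) * energy n \<epsilon> c b s"
    unfolding y_def l_def[symmetric] l'_def[symmetric] using F(1) l by (intro energy_deriv_le) auto
qed

end

section \<open>From nets to estimates at a single \<epsilon>\<close>

lemma negl_vec_eventually:
  assumes "negl_vec r"
  shows "eventually (\<lambda>\<epsilon>. norm (r \<epsilon>) \<le> \<epsilon> ^ m) (at_right 0)"
proof -
  have "\<exists>C. eventually (\<lambda>\<epsilon>. norm (r \<epsilon>) \<le> C * \<epsilon> ^ Suc m) (at_right 0)"
    using assms unfolding negl_vec_def by blast
  then show ?thesis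
    using eventually_le_power[of "UNIV :: unit set" "\<lambda>\<epsilon> _. r \<epsilon>" m] by simp
qed

lemma negligible_net_eventually:
  assumes "negligible_net \<gamma>" "compact K"
  shows "eventually (\<lambda>\<epsilon>. \<forall>t\<in>K. norm (\<gamma> \<epsilon> t) \<le> \<epsilon> ^ m) (at_right 0)"
  using eventually_le_power[of K \<gamma> m] assms unfolding negligible_net_def by blast

lemma c_bounded_eventually:
  assumes "c_bounded \<gamma>" "compact K"
  obtains L where "eventually (\<lambda>\<epsilon>. \<forall>t\<in>K. norm (\<gamma> \<epsilon> t) \<le> L) (at_right 0)"
proof -
  from assms obtain C where C: "compact C" "eventually (\<lambda>\<epsilon>. \<gamma> \<epsilon> ` K \<subseteq> C) (at_right 0)"
    unfolding c_bounded_def by meson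
  from compact_imp_bounded[OF C(1)] obtain L where "\<forall>x\<in>C. norm x \<le> L" by (auto simp: bounded_iff)
  with C(2) have "eventually (\<lambda>\<epsilon>. \<forall>t\<in>K. norm (\<gamma> \<epsilon> t) \<le> L) (at_right 0)"
    by (auto elim!: eventually_mono)
  then show ?thesis by (rule that)
qed

theorem mainTheorem3:
  fixes \<sigma> a e :: real and H :: "real^3 \<Rightarrow> real" and \<rho> :: "real \<Rightarrow> real"
    and gm :: "real \<Rightarrow> real^5" and \<gamma> \<gamma>' :: "real \<Rightarrow> real \<Rightarrow> real^5"
  assumes "\<sigma> \<in> {1, -1}" and "a > 0" and "e \<in> {-1, 0, 1}"
    and "Cinf_on UNIV H"
    and "Cinf_on UNIV \<rho>" and "closure {x. \<rho> x \<noteq> 0} \<subseteq> {-1..1}" and "(\<rho> has_integral 1) UNIV"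
    and "geodesic_M \<sigma> a gm" and "gm 0 $ 1 = 0" and "vector_derivative gm (at 0) $ 1 > 0"
    and "\<forall>t. eta \<sigma> (vector_derivative gm (at t)) (vector_derivative gm (at t)) = e"
    and "gen_curve_M \<sigma> a \<gamma>" and "solves_gen \<sigma> a e H \<rho> \<gamma>"
    and "negl_vec (\<lambda>\<epsilon>. \<gamma> \<epsilon> (alpha gm \<epsilon>) - gm (alpha gm \<epsilon>))"
    and "negl_vec (\<lambda>\<epsilon>. vector_derivative (\<gamma> \<epsilon>) (at (alpha gm \<epsilon>)) - vector_derivative gm (at (alpha gm \<epsilon>)))"
    and "gen_curve_M \<sigma> a \<gamma>'" and "solves_gen \<sigma> a e H \<rho> \<gamma>'"
    and "negl_vec (\<lambda>\<epsilon>. \<gamma>' \<epsilon> (alpha gm \<epsilon>) - gm (alpha gm \<epsilon>))"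
    and "negl_vec (\<lambda>\<epsilon>. vector_derivative (\<gamma>' \<epsilon>) (at (alpha gm \<epsilon>)) - vector_derivative gm (at (alpha gm \<epsilon>)))"
  shows "negligible_net (\<lambda>\<epsilon> t. \<gamma> \<epsilon> t - \<gamma>' \<epsilon> t)"
proof -
  define \<kappa> where "\<kappa> = e / (\<sigma> * a\<^sup>2)"
  have gm: "Cinf_on UNIV gm" using assms(8) by (simp add: geodesic_M_def)
  have gm1: "vector_derivative gm (at t) = tder 1 gm t" for t by (rule tder_1[symmetric])
  have gm0: "tder 1 gm 0 $ 1 > 0" using assms(10) unfolding gm1 .
  have gm_eq: "tder 2 gm t = - \<kappa> *\<^sub>R gm t" for t
    unfolding \<kappa>_def by (rule geodesic_equation[OF assms(8,1,2)]) (use assms(11) in \<open>unfold gm1, blast\<close>)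
  have nondeg: "gm t $ 1 \<noteq> 0 \<or> tder 1 gm t $ 1 \<noteq> 0" for t
    by (rule geodesic_U_nondegenerate[OF gm gm_eq assms(9) gm0])
  have isC: "isCont (\<lambda>t. tder k gm t $ 1) t" for k t
    using has_real_derivative_tder_nth[OF gm] by (rule DERIV_isCont)
  have isC0: "isCont (\<lambda>t. gm t $ 1) t" for t using isC[where k=0] by simp
  have mod: "moderate_net \<gamma>" "moderate_net \<gamma>'" and cb: "c_bounded \<gamma>" "c_bounded \<gamma>'"
    using assms(12,16) by (simp_all add: gen_curve_M_def)
  have "\<exists>C. \<forall>\<^sub>F \<epsilon> in at_right 0. \<forall>t\<in>K. norm (\<gamma> \<epsilon> t - \<gamma>' \<epsilon> t) \<le> C * \<epsilon> ^ m"
    if "compact K" for K :: "real set" and m :: nat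
  proof -
    \<comment> \<open>Two extra powers pay for undoing the scaling at the end.\<close>
    define k where "k = m + 2"
    obtain T0 where T0: "\<forall>t\<in>K. norm t \<le> T0" using compact_imp_bounded[OF \<open>compact K\<close>] by (auto simp: bounded_iff)
    \<comment> \<open>The interval must contain \<open>K\<close> and also [-1, 1], where the initial
      time lies for small \<epsilon>.\<close>
    define T where "T = max 1 T0"
    have T: "1 \<le> T" "K \<subseteq> {- T..T}" using T0 by (fastforce simp: T_def abs_le_iff)+
    have cT: "compact {- T..T}" by simp
    obtain L1 where L1: "\<forall>\<^sub>F \<epsilon> in at_right 0. \<forall>t\<in>{- T..T}. norm (\<gamma> \<epsilon> t) \<le> L1"
      by (rule c_bounded_eventually[OF cb(1) cT])
    obtain L2 where L2: "\<forall>\<^sub>F \<epsilon> in at_right 0. \<forall>t\<in>{- T..T}. norm (\<gamma>' \<epsilon> t) \<le> L2"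
      by (rule c_bounded_eventually[OF cb(2) cT])
    define L where "L = max L1 L2"
    have "continuous_on {- T..T} (tder 1 gm)"
      using Cinf_on_continuous[OF Cinf_tder[OF gm]] continuous_on_subset by blast
    from compact_imp_bounded[OF compact_continuous_image[OF this cT]]
    obtain M where M: "\<And>t. t \<in> {- T..T} \<Longrightarrow> norm (tder 1 gm t) \<le> M"
      unfolding bounded_iff by blast
    \<comment> \<open>The constants are chosen without circularity: \<open>R\<close> from the bounds
      on the curves and on the background velocity, then \<open>E\<close> and \<open>F\<close>, then
      the growth bounds from \<open>F\<close>, then \<delta>, and only at the end \<epsilon> is made
      small. The summand 1 is the room that the energy leaves to velocities.\<close>
    define R where "R = L + M + 1"
    obtain E where E: "0 < E" "E \<le> 1" "\<And>q. q \<in> state_set E R \<Longrightarrow> a\<^sup>2 / 2 \<le> \<bar>scaled_N \<sigma> a H \<rho> q\<bar>"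
      using scaled_N_lower[OF assms(1,2,4,5)] by blast
    have N: "scaled_N \<sigma> a H \<rho> q \<noteq> 0" if "q \<in> state_set E R" for q
      using E(3)[OF that] assms(2) by auto
    have "bounded_lipschitz (state_set E R) (scaled_force \<sigma> a e H \<rho>)"
      by (rule bounded_lipschitz_scaled_force[OF assms(1,2,4,5) E(3)])
    then obtain F where F: "0 \<le> F" "\<And>q. q \<in> state_set E R \<Longrightarrow> norm (scaled_force \<sigma> a e H \<rho> q) \<le> F"
      "\<And>q q'. q \<in> state_set E R \<Longrightarrow> q' \<in> state_set E R \<Longrightarrow>
        norm (scaled_force \<sigma> a e H \<rho> q - scaled_force \<sigma> a e H \<rho> q') \<le> F * dist q q'"
      by (rule bounded_lipschitzE) blast
    have gbe: "\<exists>\<delta>>0. \<exists>K\<ge>1. growth_bound (\<lambda>t. gm t $ 1) (\<lambda>t. tder 1 gm t $ 1) C \<delta> K (- T) T"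
      if "0 \<le> C" for C
      using T by (intro growth_bound_exists that isC isC0 nondeg) simp
    obtain \<delta>1 K1 where 1: "0 < \<delta>1" "1 \<le> K1"
      "growth_bound (\<lambda>t. gm t $ 1) (\<lambda>t. tder 1 gm t $ 1) (1 + 2 * (\<bar>\<kappa>\<bar> + 2 * F + 1)) \<delta>1 K1 (- T) T"
      using gbe[of "1 + 2 * (\<bar>\<kappa>\<bar> + 2 * F + 1)"] F(1) by auto
    obtain \<delta>2 K2 where 2: "0 < \<delta>2" "1 \<le> K2"
      "growth_bound (\<lambda>t. gm t $ 1) (\<lambda>t. tder 1 gm t $ 1) (1 + 2 * (\<bar>\<kappa>\<bar> + 4 * F + 2)) \<delta>2 K2 (- T) T"
      using gbe[of "1 + 2 * (\<bar>\<kappa>\<bar> + 4 * F + 2)"] F(1) by auto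
    define \<delta> where "\<delta> = min (min \<delta>1 \<delta>2) 1"
    have \<delta>: "0 < \<delta>" "\<delta> \<le> \<delta>1" "\<delta> \<le> \<delta>2" "\<delta> \<le> 1" using 1 2 by (auto simp: \<delta>_def)
    \<comment> \<open>Below this value of \<epsilon> the initial energy, at most 4 \<epsilon>^2,
      satisfies the continuation hypothesis: K1 times it is at most (2 K1 \<epsilon>)^2, which is
      less than \<delta>^2.\<close>
    have "0 < \<delta> / (2 * K1)" using \<delta> 1 by simp
    note ev = eventually_at_right_real[OF E(1)] eventually_at_right_real[OF this]
      alpha_in_interval[OF gm assms(9) gm0] L1 L2
      negligible_net_eventually[OF assms(13)[unfolded solves_gen_def] cT, of k]
      negligible_net_eventually[OF assms(17)[unfolded solves_gen_def] cT, of k]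
      negl_vec_eventually[OF assms(14), of k] negl_vec_eventually[OF assms(15), of k]
      negl_vec_eventually[OF assms(18), of k] negl_vec_eventually[OF assms(19), of k]
    have "\<forall>\<^sub>F \<epsilon> in at_right 0. \<forall>t\<in>K. norm (\<gamma> \<epsilon> t - \<gamma>' \<epsilon> t) \<le> 3 * sqrt K2 * \<epsilon> ^ m"
      using ev
    proof eventually_elim
      case (elim \<epsilon>)
      define \<alpha> where "\<alpha> = alpha gm \<epsilon>"
      have \<epsilon>: "0 < \<epsilon>" "\<epsilon> \<le> E" "\<epsilon> \<le> 1" "2 * K1 * \<epsilon> < \<delta>"
        using elim(1,2) E(2) 1(2) by (auto simp: field_simps)
      have \<alpha>: "\<alpha> \<in> {- T..T}" using elim(3) T(1) by (auto simp: \<alpha>_def)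
      have sm: "Cinf_on UNIV (\<gamma> \<epsilon>)" "Cinf_on UNIV (\<gamma>' \<epsilon>)"
        using mod \<epsilon> by (auto simp: moderate_net_def smooth_net_def)
      have bd: "\<And>t. t \<in> {- T..T} \<Longrightarrow> norm (\<gamma> \<epsilon> t) \<le> L" "\<And>t. t \<in> {- T..T} \<Longrightarrow> norm (\<gamma>' \<epsilon> t) \<le> L"
        using elim(4,5) by (fastforce simp: L_def)+
      have "\<epsilon> ^ k \<le> \<epsilon> ^ 1" using \<epsilon> by (intro power_decreasing) (auto simp: k_def)
      then have \<epsilon>k: "\<epsilon> ^ k \<le> \<epsilon>" "0 \<le> \<epsilon> ^ k" using \<epsilon> by auto
      have init: "norm (\<gamma> \<epsilon> \<alpha> - gm \<alpha>) \<le> \<epsilon> ^ k" "norm (tder 1 (\<gamma> \<epsilon>) \<alpha> - tder 1 gm \<alpha>) \<le> \<epsilon> ^ k"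
        "norm (\<gamma>' \<epsilon> \<alpha> - gm \<alpha>) \<le> \<epsilon> ^ k" "norm (tder 1 (\<gamma>' \<epsilon>) \<alpha> - tder 1 gm \<alpha>) \<le> \<epsilon> ^ k"
        using elim(8-11) unfolding tder_1 \<alpha>_def by auto
      have en: "energy n \<epsilon> c b \<alpha> \<le> x\<^sup>2 + x\<^sup>2 + n\<^sup>2"
        if "norm (c \<alpha> - b \<alpha>) \<le> x" "norm (tder 1 c \<alpha> - tder 1 b \<alpha>) \<le> x" for n c b x
        unfolding energy_def
        using norm_rescale_le[of \<epsilon> "c \<alpha> - b \<alpha>"] norm_rescale_le[of \<epsilon> "tder 1 c \<alpha> - tder 1 b \<alpha>"] that \<epsilon>
        by (intro add_mono power_mono order_refl) auto
      have near: "energy \<epsilon> \<epsilon> c gm t \<le> \<delta>\<^sup>2"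
        if c: "Cinf_on UNIV c" "\<And>t. t \<in> {- T..T} \<Longrightarrow> norm (c t) \<le> L"
          "\<forall>t\<in>{- T..T}. norm (residual \<sigma> a e H \<rho> \<epsilon> c t) \<le> \<epsilon> ^ k"
          "norm (c \<alpha> - gm \<alpha>) \<le> \<epsilon> ^ k" "norm (tder 1 c \<alpha> - tder 1 gm \<alpha>) \<le> \<epsilon> ^ k" 
          and t: "t \<in> {- T..T}" for c t
      proof -
        have "energy \<epsilon> \<epsilon> c gm \<alpha> \<le> \<epsilon>\<^sup>2 + \<epsilon>\<^sup>2 + \<epsilon>\<^sup>2"
          using c(4,5) \<epsilon>k by (intro en) auto
        also have "\<dots> \<le> 4 * \<epsilon>\<^sup>2" by simp
        finally have "energy \<epsilon> \<epsilon> c gm \<alpha> \<le> 4 * \<epsilon>\<^sup>2" .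
        then have "K1 * energy \<epsilon> \<epsilon> c gm \<alpha> \<le> K1 * (4 * \<epsilon>\<^sup>2)"
          using 1(2) by (intro mult_left_mono) auto
        also have "\<dots> \<le> (2 * K1 * \<epsilon>)\<^sup>2"
          using 1(2) mult_right_mono[of 1 K1 "K1 * \<epsilon>\<^sup>2"] by (simp add: power2_eq_square mult_ac)
        also have "\<dots> < \<delta>\<^sup>2" using \<epsilon> 1(2) by (intro power_strict_mono) auto
        finally have in0: "K1 * energy \<epsilon> \<epsilon> c gm \<alpha> < \<delta>\<^sup>2" .
        have res: "norm (residual \<sigma> a e H \<rho> \<epsilon> c t) \<le> \<epsilon>" if "t \<in> {- T..T}" for t
          using c(3) that \<epsilon>k by fastforce
        have "energy \<epsilon> \<epsilon> c gm t < \<delta>\<^sup>2"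
          by (rule bootstrap_near[OF assms(1,2,4,5,6) gm gm_eq \<kappa>_def E(2) N F \<epsilon>(1,2) c(1) 1(3,2) \<delta>(1,2,4) c(2) M
            _ res \<alpha> in0 t]) (auto simp: R_def)
        then show ?thesis by simp
      qed
      show ?case
      proof
        fix t assume "t \<in> K"
        then have t: "t \<in> {- T..T}" using T by blast
        \<comment> \<open>The floor is now the size of the residuals. Initially both curves are
          within \<epsilon>^k of the background, so positions and velocities differ by at most 2
          \<epsilon>^k each; 4 + 4 + 1 gives the factor 9 below.\<close>
        have "energy (\<epsilon> ^ k) \<epsilon> (\<gamma> \<epsilon>) (\<gamma>' \<epsilon>) t \<le> K2 * energy (\<epsilon> ^ k) \<epsilon> (\<gamma> \<epsilon>) (\<gamma>' \<epsilon>) \<alpha>"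
        proof (rule difference_bound[OF assms(1,2,4,5,6) gm gm_eq \<kappa>_def E(2) N F \<epsilon>(1,2) sm
              growth_bound_mono[OF 2(3) \<delta>(3)] 2(2) less_imp_le[OF \<delta>(1)] \<delta>(4) bd M])
          show "energy \<epsilon> \<epsilon> (\<gamma> \<epsilon>) gm s \<le> \<delta>\<^sup>2" if "s \<in> {- T..T}" for s
            by (rule near[OF sm(1) bd(1) elim(6) init(1,2) that])
          show "energy \<epsilon> \<epsilon> (\<gamma>' \<epsilon>) gm s \<le> \<delta>\<^sup>2" if "s \<in> {- T..T}" for s
            by (rule near[OF sm(2) bd(2) elim(7) init(3,4) that])
        qed (use elim(6,7) \<alpha> t in \<open>auto simp: R_def\<close>)
        also have "\<dots> \<le> K2 * (9 * (\<epsilon> ^ k)\<^sup>2)"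
        proof (rule mult_left_mono)
          have "norm (\<gamma> \<epsilon> \<alpha> - \<gamma>' \<epsilon> \<alpha>) \<le> 2 * \<epsilon> ^ k"
            using norm_triangle_ineq4[of "\<gamma> \<epsilon> \<alpha> - gm \<alpha>" "\<gamma>' \<epsilon> \<alpha> - gm \<alpha>"] init(1,3) by simp
          moreover have "norm (tder 1 (\<gamma> \<epsilon>) \<alpha> - tder 1 (\<gamma>' \<epsilon>) \<alpha>) \<le> 2 * \<epsilon> ^ k"
            using norm_triangle_ineq4[of "tder 1 (\<gamma> \<epsilon>) \<alpha> - tder 1 gm \<alpha>" "tder 1 (\<gamma>' \<epsilon>) \<alpha> - tder 1 gm \<alpha>"]
              init(2,4) by simp
          ultimately show "energy (\<epsilon> ^ k) \<epsilon> (\<gamma> \<epsilon>) (\<gamma>' \<epsilon>) \<alpha> \<le> 9 * (\<epsilon> ^ k)\<^sup>2"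
            using en[of "\<gamma> \<epsilon>" "\<gamma>' \<epsilon>" "2 * \<epsilon> ^ k" "\<epsilon> ^ k"] by (simp add: power_mult_distrib)
        qed (use 2 in simp)
        finally have "sqrt (energy (\<epsilon> ^ k) \<epsilon> (\<gamma> \<epsilon>) (\<gamma>' \<epsilon>) t) \<le> sqrt (K2 * (9 * (\<epsilon> ^ k)\<^sup>2))"
          by (rule real_sqrt_le_mono)
        also have "\<dots> = 3 * sqrt K2 * \<epsilon> ^ k"
          using \<epsilon>k(2) by (simp add: real_sqrt_mult)
        finally have "\<epsilon>\<^sup>2 * norm (\<gamma> \<epsilon> t - \<gamma>' \<epsilon> t) \<le> 3 * sqrt K2 * \<epsilon> ^ k"
          using norm_le_rescale[OF \<epsilon>(1,3), of "\<gamma> \<epsilon> t - \<gamma>' \<epsilon> t"]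
            energy_ge(1)[of \<epsilon> "\<gamma> \<epsilon>" t "\<gamma>' \<epsilon>" "\<epsilon> ^ k"] by linarith
        also have "\<dots> = \<epsilon>\<^sup>2 * (3 * sqrt K2 * \<epsilon> ^ m)" by (simp add: k_def power_add power2_eq_square)
        finally show "norm (\<gamma> \<epsilon> t - \<gamma>' \<epsilon> t) \<le> 3 * sqrt K2 * \<epsilon> ^ m" using \<epsilon>(1) by simp
      qed
    qed
    then show ?thesis by blast
  qed
  \<comment> \<open>Estimates of order zero suffice, since \<open>negligible_net\<close> asks beyond
    them only for moderateness, which differences inherit.\<close>
  with moderate_net_diff[OF mod] show ?thesis unfolding negligible_net_def by blast
qed

end
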